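(* Assume that $n \geq 2$, $0 < s,t < 1$, $n > 2s$, $n > 2t$, $p,q > 0$ and $pq > 1$. Then the only non-negative viscosity super-solution $(u,v)$ of the system $$\begin{cases}(-\Delta)^{s} u = v^{p} & \text{in } \mathbb{R}^n\\ (-\Delta)^{t} v = u^{q} & \text{in } \mathbb{R}^n\end{cases}$$ is the trivial one $(u,v)=(0,0)$ if and only if $$\left(\frac{2s}{p}+2t\right)\frac{p}{pq-1}\geq n-2s \quad\text{or}\quad \left(\frac{2t}{q}+2s\right)\frac{q}{pq-1}\geq n-2t .$$
   Context: For $0<s<1$ the fractional Laplace operator on $\mathbb{R}^n$ is $$(-\Delta)^{s}u(x) = C(n,s)\,\mathrm{P.V.}\int_{\mathbb{R}^{n}}\frac{u(x)-u(y)}{|x-y|^{n+2s}}\,dy,\qquad C(n,s) = \left(\int_{\mathbb{R}^{n}}\frac{1-\cos(\zeta_{1})}{|\zeta|^{n+2s}}\, d\zeta\right)^{-1}.$$ A non-negative viscosity super-solution of the system in $\mathbb{R}^n$ is a couple $(u,v)$ of non-negative continuous functions on $\mathbb{R}^n$ such that for each point $x_{0}\in \mathbb{R}^n$ there exists a neighborhood $U$ of $x_{0}$ such that for any $\varphi,\psi \in C^{2}(\overline{U})$ satisfying $u(x_{0}) = \varphi(x_{0})$, $v(x_{0}) = \psi(x_{0})$, $u \geq \varphi$ and $v \geq \psi$ in $U$, the functions $$\overline{u}=\begin{cases}\varphi & \text{in } U\\ u & \text{in } \mathbb{R}^{n}\setminus U\end{cases}\qquad \overline{v}=\begin{cases}\psi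 & \text{in } U\\ v & \text{in } \mathbb{R}^{n}\setminus U\end{cases}$$ satisfy $(-\Delta)^{s}\overline{u}(x_{0}) \geq v^{p}(x_{0})$ and $(-\Delta)^{t}\overline{v}(x_{0}) \geq u^{q}(x_{0})$.
   Formalization: The two inequalities are tested separately (φ alone for the first, ψ alone for the second); with simultaneous pairs (φ,ψ), as written, continuous positive u, v with no common point admitting test functions would be vacuous nontrivial super-solutions. *)

theory Defs
  imports "HOL-Analysis.Analysis"
begin

(* The constant C(n,s) on real^'n. An abstract finite index type has no first element, so the
   coordinate zeta_1 is a fixed but unspecified one; by invariance of Lebesgue measure under
   permutations of the coordinates the integral does not depend on the choice. *)
definition frac_const :: "'n::finite itself \<Rightarrow> real \<Rightarrow> real" where
  "frac_const _ s =
     inverse (LINT \<zeta>::real^'n|lborel.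
       (1 - cos (\<zeta> $ (SOME i. True))) / norm \<zeta> powr (real CARD('n) + 2 * s))"

(* (-Delta)^s w exists at x, and its value is L. The principal value is the limit of the Lebesgue
   integrals over the complements of balls around x. Integrability over these complements is
   demanded explicitly: the Bochner integral of a non-integrable function is 0 by convention, which
   must not be mistaken for the value of the operator. *)
definition has_frac_laplacian ::
    "real \<Rightarrow> (real^'n::finite \<Rightarrow> real) \<Rightarrow> real^'n \<Rightarrow> real \<Rightarrow> bool" where
  "has_frac_laplacian s w x L \<longleftrightarrow>
     (\<forall>\<epsilon>>0. set_integrable lborel (- ball x \<epsilon>)
        (\<lambda>y. (w x - w y) / norm (x - y) powr (real CARD('n) + 2 * s))) \<and>
     ((\<lambda>\<epsilon>. frac_const TYPE('n) s *
        (LINT y : - ball x \<epsilon> | lborel. (w x - w y) / norm (x - y) powr (real CARD('n) + 2 * s)))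
       \<longlongrightarrow> L) (at_right 0)"

(* phi belongs to C^2 of the closure of the open set U: phi is twice continuously differentiable
   in U, and phi, its gradient G and its Hessian H extend continuously to the closure. *)
definition C2_closure :: "(real^'n::finite) set \<Rightarrow> (real^'n \<Rightarrow> real) \<Rightarrow> bool" where
  "C2_closure U \<phi> \<longleftrightarrow> continuous_on (closure U) \<phi> \<and>
     (\<exists>(G :: real^'n \<Rightarrow> real^'n) (H :: real^'n \<Rightarrow> real^'n^'n).
        continuous_on (closure U) G \<and> continuous_on (closure U) H \<and>
        (\<forall>x\<in>U. (\<phi> has_derivative (\<lambda>h. G x \<bullet> h)) (at x) \<and>
                (G has_derivative (\<lambda>h. H x *v h)) (at x)))"

definition touches_below ::
    "(real^'n::finite) set \<Rightarrow> real^'n \<Rightarrow> (real^'n \<Rightarrow> real) \<Rightarrow> (real^'n \<Rightarrow> real) \<Rightarrow> bool" where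
  "touches_below U x0 \<phi> u \<longleftrightarrow> C2_closure U \<phi> \<and> u x0 = \<phi> x0 \<and> (\<forall>x\<in>U. u x \<ge> \<phi> x)"

definition glue :: "'a set \<Rightarrow> ('a \<Rightarrow> 'b) \<Rightarrow> ('a \<Rightarrow> 'b) \<Rightarrow> 'a \<Rightarrow> 'b" where
  "glue U \<phi> u = (\<lambda>x. if x \<in> U then \<phi> x else u x)"

(* The test functions of the two components are independent: phi tests the first inequality and
   psi the second one. If both inequalities were only required for pairs (phi, psi) of
   simultaneous test functions, then any continuous pair (u, v) having no point at which both
   components admit a test function (such pairs exist) would vacuously be a super-solution. *)
definition viscosity_supersolution ::
    "real \<Rightarrow> real \<Rightarrow> real \<Rightarrow> real \<Rightarrow> (real^'n::finite \<Rightarrow> real) \<Rightarrow> (real^'n \<Rightarrow> real) \<Rightarrow> bool" where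
  "viscosity_supersolution s t p q u v \<longleftrightarrow>
     continuous_on UNIV u \<and> continuous_on UNIV v \<and>
     (\<forall>x0. \<exists>U. open U \<and> x0 \<in> U \<and>
        (\<forall>\<phi>. touches_below U x0 \<phi> u \<longrightarrow>
           (\<exists>L. has_frac_laplacian s (glue U \<phi> u) x0 L \<and> L \<ge> v x0 powr p)) \<and>
        (\<forall>\<psi>. touches_below U x0 \<psi> v \<longrightarrow>
           (\<exists>L. has_frac_laplacian t (glue U \<psi> v) x0 L \<and> L \<ge> u x0 powr q)))"

definition nonneg_viscosity_supersolution ::
    "real \<Rightarrow> real \<Rightarrow> real \<Rightarrow> real \<Rightarrow> (real^'n::finite \<Rightarrow> real) \<Rightarrow> (real^'n \<Rightarrow> real) \<Rightarrow> bool" where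
  "nonneg_viscosity_supersolution s t p q u v \<longleftrightarrow>
     (\<forall>x. u x \<ge> 0) \<and> (\<forall>x. v x \<ge> 0) \<and> viscosity_supersolution s t p q u v"

end

theory Submission
  imports Defs "HOL-Probability.Distributions"
begin

text \<open>Everything is built from Gaussians. Writing both the singular kernel and the potentials
  \<open>pot g a\<close> as mixtures of heat kernels turns \<open>(-\<Delta>)\<^sup>s (pot g a)\<close> into a one-dimensional Abel
  equation in the time variable: it is a positive multiple of \<open>heat a\<close> for \<open>g = s\<close> and of
  \<open>pot (g - s) a\<close> for \<open>g > s\<close>. Since \<open>pot g 1\<close> decays like \<open>\<bar>x\<bar>\<close> to the power \<open>2g - n\<close>,
  suitable multiples of two such potentials form a nontrivial classical super-solution when both inequalities fail.

  Conversely, comparison with \<open>pot s a - \<kappa> pot s (2a)\<close> shows that \<open>u \<ge> c M R\<^sup>2\<^sup>s\<close> on the ball of radius \<open>R\<close>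
  if \<open>v\<^sup>p \<ge> M\<close> there. Hence the minima of \<open>u\<close> and \<open>v\<close> over balls control each other, which yields
  \<open>min u \<le> C R\<^sup>-\<^sup>\<alpha>\<close> with \<open>\<alpha> = (2s + 2tp) / (pq - 1)\<close>, while comparison on a fixed ball yields
  \<open>min u \<ge> c R\<^sup>2\<^sup>s\<^sup>-\<^sup>n\<close>. So \<open>\<alpha> > n - 2s\<close> is impossible. If \<open>\<alpha> = n - 2s\<close>, then \<open>v\<^sup>p\<close> decays no
  faster than \<open>\<bar>x\<bar>\<close> to the power \<open>-n\<close>, and adding up the barriers of all dyadic radii gains a logarithm in the
  lower bound for \<open>u\<close>.\<close>

section \<open>Gaussians and power weights\<close>

text \<open>The exponents come from scaling: profiles decaying like \<open>|x|^(-\<alpha>)\<close>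
  and \<open>|x|^(-\<beta>)\<close> balance the system when \<open>\<beta> p = \<alpha> + 2s\<close>
  and \<open>\<alpha> q = \<beta> + 2t\<close>, and the two alternatives compare \<alpha> with n -
  2s and \<beta> with n - 2t, the decay rates of the fundamental solutions. Exchanging (s, p, u)
  with (t, q, v) exchanges the alternatives, so only the first one is treated. Gaussians form a
  convolution semigroup, which replaces polar coordinates and the Fourier transform; constants only
  have to be positive and independent of position and scale. The obstacle is that
  \<open>heat t x\<close> is not monotone in t for x \<noteq> 0, whereas the Abel inversion is
  carried out with nonnegative integrands, hence for decreasing functions; a splitting into two
  decreasing functions cures this. A viscosity super-solution can only be tested where it is touched
  from below, so every lower bound goes through comparison with C2 functions vanishing at infinity.
  A single potential \<open>pot s a\<close> is no good for this: its fractional Laplacian is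
  positive everywhere, while the right-hand side is known to be positive only on a ball.\<close>

text \<open>\<open>heat a\<close> has variance \<open>a\<close> in each coordinate, so it is the kernel of \<open>exp (a \<Delta> / 2)\<close>.\<close>

definition heat :: "real \<Rightarrow> real^'n::finite \<Rightarrow> real" where
  "heat a x = (2 * pi * a) powr (- (real CARD('n) / 2)) * exp (- (norm x)\<^sup>2 / (2 * a))"

lemma heat_measurable [measurable (raw)]:
  assumes [measurable]: "f \<in> borel_measurable M" "g \<in> borel_measurable M"
  shows "(\<lambda>z. heat (f z) (g z)) \<in> borel_measurable M"
  unfolding heat_def by measurable

lemma heat_nonneg [simp]: "0 \<le> heat a x"
  by (simp add: heat_def)

lemma heat_minus [simp]: "heat a (- x) = heat a x"
  by (simp add: heat_def)

text \<open>The product form reduces Gaussian integrals on \<open>real^'n\<close> to one-dimensional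
  ones about \<open>normal_density\<close>; as \<open>a\<close> is the variance, the standard
  deviation is \<open>sqrt a\<close>.\<close>

lemma heat_eq_prod:
  fixes x :: "real^'n::finite"
  assumes "a > 0"
  shows "heat a x = (\<Prod>b\<in>Basis. normal_density 0 (sqrt a) (x \<bullet> b))"
proof -
  have "(\<Prod>b\<in>(Basis::(real^'n) set). normal_density 0 (sqrt a) (x \<bullet> b)) =
      (\<Prod>b\<in>(Basis::(real^'n) set). 1 / sqrt (2 * pi * a)) * (\<Prod>b\<in>Basis. exp (- (x \<bullet> b)\<^sup>2 / (2 * a)))"
    using assms by (simp add: normal_density_def prod.distrib [symmetric] del: prod_constant)
  also have "(\<Prod>b\<in>Basis. exp (- (x \<bullet> b)\<^sup>2 / (2 * a))) = exp (- (norm x)\<^sup>2 / (2 * a))"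
    by (simp add: exp_sum [symmetric] sum_divide_distrib [symmetric] sum_negf euclidean_inner [of x x]
        power2_norm_eq_inner power2_eq_square [of "_ \<bullet> _"])
  also have "(\<Prod>b\<in>(Basis::(real^'n) set). 1 / sqrt (2 * pi * a)) = (2 * pi * a) powr (- (real CARD('n) / 2))"
  proof -
    have "1 / sqrt (2 * pi * a) = (2 * pi * a) powr (-1/2)"
      using assms by (simp add: powr_half_sqrt [symmetric] powr_minus_divide)
    then show ?thesis
      using assms by (simp add: powr_realpow [symmetric] powr_powr)
  qed
  finally show ?thesis by (simp add: heat_def)
qed

text \<open>This is the semigroup law of the heat kernels, factor by factor the convolution of
  centred normal densities. Since Gaussians are even, the shift may be written \<open>x + z\<close>,
  the form in which the operator uses it later.\<close>

lemma nn_integral_heat_conv: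
  fixes x :: "real^'n::finite"
  assumes "a > 0" "h > 0"
  shows "(\<integral>\<^sup>+z. ennreal (heat a (x + z)) * ennreal (heat h z) \<partial>lborel) = ennreal (heat (a + h) x)"
proof -
  let ?y = "- x"
  let ?f = "\<lambda>b t. normal_density 0 (sqrt a) (?y \<bullet> b - t) * normal_density 0 (sqrt h) t"
  have "(\<integral>\<^sup>+z. ennreal (heat a (x + z)) * ennreal (heat h z) \<partial>lborel)
      = (\<integral>\<^sup>+z. (\<Prod>b\<in>Basis. ennreal (?f b (z \<bullet> b))) \<partial>lborel)"
  proof (rule nn_integral_cong)
    fix z :: "real^'n"
    have "heat a (x + z) = heat a (?y - z)"
      by (metis heat_minus minus_add_distrib diff_conv_add_uminus)
    then show "ennreal (heat a (x + z)) * ennreal (heat h z) = (\<Prod>b\<in>Basis. ennreal (?f b (z \<bullet> b)))"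
      using assms
      by (simp add: ennreal_mult' [symmetric] heat_eq_prod prod_ennreal prod.distrib inner_diff_left
          prod_nonneg)
  qed
  also have "\<dots> = (\<Prod>b\<in>Basis. (\<integral>\<^sup>+t. ennreal (?f b t) \<partial>lborel))"
    by (rule nn_integral_lborel_prod) auto
  also have "\<dots> = (\<Prod>b\<in>Basis. ennreal (normal_density 0 (sqrt (a + h)) (?y \<bullet> b)))"
  proof (rule prod.cong [OF refl])
    fix b :: "real^'n"
    show "(\<integral>\<^sup>+t. ennreal (?f b t) \<partial>lborel) = ennreal (normal_density 0 (sqrt (a + h)) (?y \<bullet> b))"
      using fun_cong [OF conv_normal_density_zero_mean [of "sqrt a" "sqrt h"], of "?y \<bullet> b"] assms by simp
  qed
  also have "\<dots> = ennreal (heat (a + h) ?y)"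
    using assms by (simp only: heat_eq_prod add_pos_pos prod_ennreal normal_density_nonneg)
  finally show ?thesis by simp
qed

lemma nn_integral_heat:
  assumes "h > 0"
  shows "(\<integral>\<^sup>+z. ennreal (heat h z) \<partial>(lborel :: (real^'n::finite) measure)) = 1"
proof -
  have "(\<integral>\<^sup>+z. ennreal (heat h z) \<partial>(lborel :: (real^'n) measure))
      = (\<integral>\<^sup>+z. (\<Prod>b\<in>Basis. ennreal (normal_density 0 (sqrt h) (z \<bullet> b))) \<partial>(lborel :: (real^'n) measure))"
    using assms by (intro nn_integral_cong) (simp add: heat_eq_prod prod_ennreal)
  also have "\<dots> = (\<Prod>b\<in>(Basis::(real^'n) set). (\<integral>\<^sup>+t. ennreal (normal_density 0 (sqrt h) t) \<partial>lborel))"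
    by (rule nn_integral_lborel_prod) auto
  also have "(\<integral>\<^sup>+t. ennreal (normal_density 0 (sqrt h) t) \<partial>lborel) = 1"
    using assms by (subst nn_integral_eq_integral) auto
  finally show ?thesis by simp
qed

text \<open>The extension by zero turns half-line integrals into integrals over the whole line, so
  that substitutions and Tonelli need no domains. Negative orders are allowed:
  \<open>pw (- s)\<close> is the weight of the Marchaud derivative.\<close>

definition pw :: "real \<Rightarrow> real \<Rightarrow> real" where
  "pw g t = (if 0 < t then t powr (g - 1) else 0)"

lemma pw_measurable [measurable (raw)]:
  assumes [measurable]: "f \<in> borel_measurable M"
  shows "(\<lambda>z. pw g (f z)) \<in> borel_measurable M"
  unfolding pw_def by measurable

lemma pw_nonneg [simp]: "0 \<le> pw g t"
  by (simp add: pw_def)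

lemma pw_scale: "c > 0 \<Longrightarrow> pw g (c * t) = c powr (g - 1) * pw g t"
  by (simp add: pw_def powr_mult zero_less_mult_iff)

lemma nn_integral_pw_scale:
  assumes [measurable]: "f \<in> borel_measurable borel" and c: "c > 0"
  shows "(\<integral>\<^sup>+\<tau>. ennreal (pw m \<tau>) * f \<tau> \<partial>lborel) = ennreal (c powr m) * (\<integral>\<^sup>+\<tau>. ennreal (pw m \<tau>) * f (c * \<tau>) \<partial>lborel)"
proof -
  have "(\<integral>\<^sup>+\<tau>. ennreal (pw m \<tau>) * f \<tau> \<partial>lborel)
     = ennreal \<bar>c\<bar> * (\<integral>\<^sup>+\<tau>. ennreal (pw m (0 + c * \<tau>)) * f (0 + c * \<tau>) \<partial>lborel)"
    using c by (subst nn_integral_real_affine [where t = 0 and c = c]) simp_all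
  also have "\<dots> = ennreal c * (ennreal (c powr (m - 1)) * (\<integral>\<^sup>+\<tau>. ennreal (pw m \<tau>) * f (c * \<tau>) \<partial>lborel))"
    using c by (simp add: pw_scale ennreal_mult' mult.assoc nn_integral_cmult)
  also have "\<dots> = ennreal (c * c powr (m - 1)) * (\<integral>\<^sup>+\<tau>. ennreal (pw m \<tau>) * f (c * \<tau>) \<partial>lborel)"
    using c by (simp add: ennreal_mult' mult.assoc)
  finally show ?thesis using c by (simp add: powr_mult_base)
qed

text \<open>Up to the factor \<open>\<Gamma>(g)\<close>, \<open>weyl g\<close> is the Weyl fractional integral of order \<open>g\<close>.\<close>

abbreviation weyl :: "real \<Rightarrow> (real \<Rightarrow> ennreal) \<Rightarrow> real \<Rightarrow> ennreal" where
  "weyl g \<Phi> \<sigma> \<equiv> (\<integral>\<^sup>+\<tau>. ennreal (pw g \<tau>) * \<Phi> (\<sigma> + \<tau>) \<partial>lborel)"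

lemma nn_integral_pw_beta:
  assumes "m > 0" "s > 0" "\<sigma> > 0"
  shows "(\<integral>\<^sup>+b. ennreal (pw m b) * ennreal (pw s (\<sigma> - b)) \<partial>lborel) = ennreal (Beta m s * \<sigma> powr (m + s - 1))"
proof -
  have "(\<integral>\<^sup>+b. ennreal (pw m b) * ennreal (pw s (\<sigma> - b)) \<partial>lborel)
      = ennreal \<bar>\<sigma>\<bar> * (\<integral>\<^sup>+b. ennreal (pw m (0 + \<sigma> * b)) * ennreal (pw s (\<sigma> - (0 + \<sigma> * b))) \<partial>lborel)"
    using assms by (subst nn_integral_real_affine [where t = 0 and c = \<sigma>]) simp_all
  also have "(\<integral>\<^sup>+b. ennreal (pw m (0 + \<sigma> * b)) * ennreal (pw s (\<sigma> - (0 + \<sigma> * b))) \<partial>lborel)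
      = (\<integral>\<^sup>+b. ennreal (\<sigma> powr (m + s - 2)) * (ennreal (b powr (m - 1) * (1 - b) powr (s - 1)) * indicator {0<..<1} b) \<partial>lborel)"
  proof (rule nn_integral_cong)
    fix b :: real
    have e: "\<sigma> - (0 + \<sigma> * b) = \<sigma> * (1 - b)" by (simp add: algebra_simps)
    show "ennreal (pw m (0 + \<sigma> * b)) * ennreal (pw s (\<sigma> - (0 + \<sigma> * b)))
      = ennreal (\<sigma> powr (m + s - 2)) * (ennreal (b powr (m - 1) * (1 - b) powr (s - 1)) * indicator {0<..<1} b)"
    proof (cases "0 < b \<and> b < 1")
      case True
      have "(\<sigma> * b) powr (m - 1) * (\<sigma> * (1 - b)) powr (s - 1)
          = (\<sigma> powr (m - 1) * \<sigma> powr (s - 1)) * (b powr (m - 1) * (1 - b) powr (s - 1))"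
        using True assms by (simp add: powr_mult)
      also have "\<sigma> powr (m - 1) * \<sigma> powr (s - 1) = \<sigma> powr (m + s - 2)"
        by (simp add: powr_add [symmetric] algebra_simps)
      finally show ?thesis
        unfolding e using True assms by (simp add: pw_def ennreal_mult' [symmetric])
    next
      case False
      then show ?thesis
        unfolding e using assms by (auto simp: pw_def zero_less_mult_iff not_less)
    qed
  qed
  also have "\<dots> = ennreal (\<sigma> powr (m + s - 2)) * ennreal (Beta m s)"
  proof -
    have "((\<lambda>t. t powr (m - 1) * (1 - t) powr (s - 1)) has_integral Beta m s) {0<..<1}"
      using has_integral_Beta_real [of m s] assms by (simp add: has_integral_Icc_iff_Ioo)
    from nn_integral_has_integral_lebesgue' [OF _ this] show ?thesis
      by (subst nn_integral_cmult) auto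
  qed
  also have "ennreal \<bar>\<sigma>\<bar> * (ennreal (\<sigma> powr (m + s - 2)) * ennreal (Beta m s)) = ennreal (Beta m s * \<sigma> powr (m + s - 1))"
  proof -
    have "\<sigma> * \<sigma> powr (m + s - 2) = \<sigma> powr (m + s - 1)"
      using assms by (simp add: powr_mult_base)
    moreover have "Beta m s \<ge> 0" using assms by (simp add: Beta_def Gamma_real_pos less_imp_le)
    ultimately show ?thesis
      using assms by (simp add: ennreal_mult' [symmetric] mult.assoc [symmetric] mult.commute)
  qed
  finally show ?thesis .
qed

text \<open>Weyl integrals of orders \<open>m\<close> and \<open>s\<close> compose to order
  \<open>m + s\<close>; evaluated at 0 this is Tonelli followed by the Beta integral over
  \<open>0 < b < \<sigma>\<close>. The factor \<open>Beta m s\<close> appears because the weights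
  are not divided by Gamma values.\<close>

lemma nn_integral_pw_conv:
  fixes \<Phi> :: "real \<Rightarrow> ennreal"
  assumes [measurable]: "\<Phi> \<in> borel_measurable borel" and "m > 0" "s > 0"
  shows "(\<integral>\<^sup>+b. ennreal (pw m b) * weyl s \<Phi> b \<partial>lborel)
       = ennreal (Beta m s) * (\<integral>\<^sup>+\<sigma>. ennreal (pw (m + s) \<sigma>) * \<Phi> \<sigma> \<partial>lborel)"
proof -
  have "(\<integral>\<^sup>+b. ennreal (pw m b) * weyl s \<Phi> b \<partial>lborel)
      = (\<integral>\<^sup>+b. (\<integral>\<^sup>+\<sigma>. ennreal (pw m b) * (ennreal (pw s (\<sigma> - b)) * \<Phi> \<sigma>) \<partial>lborel) \<partial>lborel)"
  proof (rule nn_integral_cong)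
    fix b :: real
    have "weyl s \<Phi> b
        = (\<integral>\<^sup>+\<tau>. ennreal (pw s (- b + 1 * \<tau>)) * \<Phi> (b + (- b + 1 * \<tau>)) \<partial>lborel)"
      by (subst nn_integral_real_affine [where t = "- b" and c = 1]) simp_all
    then show "ennreal (pw m b) * weyl s \<Phi> b
        = (\<integral>\<^sup>+\<sigma>. ennreal (pw m b) * (ennreal (pw s (\<sigma> - b)) * \<Phi> \<sigma>) \<partial>lborel)"
      by (subst nn_integral_cmult) (simp_all add: add.commute)
  qed
  also have "\<dots> = (\<integral>\<^sup>+\<sigma>. (\<integral>\<^sup>+b. ennreal (pw m b) * (ennreal (pw s (\<sigma> - b)) * \<Phi> \<sigma>) \<partial>lborel) \<partial>lborel)"
    by (rule lborel_pair.Fubini') measurable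
  also have "\<dots> = (\<integral>\<^sup>+\<sigma>. ennreal (Beta m s) * (ennreal (pw (m + s) \<sigma>) * \<Phi> \<sigma>) \<partial>lborel)"
  proof (rule nn_integral_cong)
    fix \<sigma> :: real
    have "(\<integral>\<^sup>+b. ennreal (pw m b) * (ennreal (pw s (\<sigma> - b)) * \<Phi> \<sigma>) \<partial>lborel)
        = (\<integral>\<^sup>+b. ennreal (pw m b) * ennreal (pw s (\<sigma> - b)) \<partial>lborel) * \<Phi> \<sigma>"
      by (simp add: nn_integral_multc mult.assoc [symmetric])
    also have "(\<integral>\<^sup>+b. ennreal (pw m b) * ennreal (pw s (\<sigma> - b)) \<partial>lborel) = ennreal (Beta m s) * ennreal (pw (m + s) \<sigma>)"
    proof (cases "\<sigma> > 0")
      case True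
      moreover have "Beta m s \<ge> 0" using assms by (simp add: Beta_def Gamma_real_pos less_imp_le)
      ultimately show ?thesis using assms
        by (simp only: nn_integral_pw_beta) (simp add: pw_def ennreal_mult')
    next
      case False
      then have "(\<lambda>b. ennreal (pw m b) * ennreal (pw s (\<sigma> - b))) = (\<lambda>b. 0)"
        by (auto simp: pw_def fun_eq_iff)
      then show ?thesis using False by (simp add: pw_def)
    qed
    finally show "(\<integral>\<^sup>+b. ennreal (pw m b) * (ennreal (pw s (\<sigma> - b)) * \<Phi> \<sigma>) \<partial>lborel)
       = ennreal (Beta m s) * (ennreal (pw (m + s) \<sigma>) * \<Phi> \<sigma>)" by (simp add: mult.assoc)
  qed
  also have "\<dots> = ennreal (Beta m s) * (\<integral>\<^sup>+\<sigma>. ennreal (pw (m + s) \<sigma>) * \<Phi> \<sigma> \<partial>lborel)"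
    by (rule nn_integral_cmult) simp
  finally show ?thesis .
qed

lemma Beta_real_pos: "a > 0 \<Longrightarrow> b > 0 \<Longrightarrow> Beta a b > (0::real)"
  by (simp add: Beta_def Gamma_real_pos)

lemma nn_integral_pw_tail:
  assumes "s > 0" "r > 0"
  shows "(\<integral>\<^sup>+h. ennreal (pw (- s) h) * indicator {r<..} h \<partial>lborel) = ennreal (r powr (- s) / s)"
proof -
  have "(\<integral>\<^sup>+h. ennreal (pw (- s) h) * indicator {r<..} h \<partial>lborel)
      = (\<integral>\<^sup>+h. ennreal (h powr (- s - 1)) * indicator {r..} h \<partial>lborel)"
    using assms by (intro nn_integral_cong_AE, use AE_lborel_singleton [of r] in eventually_elim)
      (auto simp: pw_def indicator_def)
  also have "\<dots> = ennreal (- (r powr (- s - 1 + 1)) / (- s - 1 + 1))"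
    using assms by (intro nn_integral_has_integral_lebesgue' has_integral_powr_to_inf) auto
  finally show ?thesis by simp
qed

lemma nn_integral_pw_head:
  assumes "s > 0" "r > 0"
  shows "(\<integral>\<^sup>+h. ennreal (pw s h) * indicator {..r} h \<partial>lborel) = ennreal (r powr s / s)"
proof -
  have "(\<integral>\<^sup>+h. ennreal (pw s h) * indicator {..r} h \<partial>lborel)
      = (\<integral>\<^sup>+h. ennreal (h powr (s - 1)) * indicator {0..r} h \<partial>lborel)"
    using assms by (intro nn_integral_cong) (auto simp: pw_def indicator_def)
  also have "\<dots> = ennreal (r powr (s - 1 + 1) / (s - 1 + 1))"
    using assms by (intro nn_integral_has_integral_lebesgue' has_integral_powr_from_0) auto
  finally show ?thesis by simp
qed

text \<open>The Abel-type inversion behind \<open>(-\<Delta>)\<^sup>s I\<^sub>2\<^sub>s = id\<close>, for the one-parameter family of heat kernels.\<close>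

lemma nn_integral_marchaud:
  fixes \<psi> :: "real \<Rightarrow> ennreal"
  assumes [measurable]: "\<psi> \<in> borel_measurable borel" and s: "0 < s" "s < 1"
  shows "(\<integral>\<^sup>+h. ennreal (pw (- s) h) *
            (\<integral>\<^sup>+\<tau>. ennreal (pw s \<tau>) * (\<integral>\<^sup>+r. indicator {0<..<h} r * \<psi> (\<tau> + r) \<partial>lborel) \<partial>lborel) \<partial>lborel)
       = ennreal (Beta (1 - s) s / s) * (\<integral>\<^sup>+\<sigma>. ennreal (pw 1 \<sigma>) * \<psi> \<sigma> \<partial>lborel)"
proof -
  \<comment> \<open>A joint condition on \<open>r\<close> and \<open>h\<close> replaces the
    indicator of an interval depending on \<open>h\<close>, so that joint measurability is derived
    automatically.\<close>
  let ?\<chi> = "\<lambda>r h. if 0 < r \<and> r < h then 1 else 0 :: ennreal"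
  have "(\<integral>\<^sup>+h. ennreal (pw (- s) h) *
            (\<integral>\<^sup>+\<tau>. ennreal (pw s \<tau>) * (\<integral>\<^sup>+r. indicator {0<..<h} r * \<psi> (\<tau> + r) \<partial>lborel) \<partial>lborel) \<partial>lborel)
     = (\<integral>\<^sup>+h. ennreal (pw (- s) h) *
            (\<integral>\<^sup>+\<tau>. (\<integral>\<^sup>+r. ennreal (pw s \<tau>) * (?\<chi> r h * \<psi> (\<tau> + r)) \<partial>lborel) \<partial>lborel) \<partial>lborel)"
  proof -
    have ind: "indicator {0<..<h} r = ?\<chi> r h" for h r :: real
      by (simp add: indicator_def)
    show ?thesis by (simp only: ind) (simp add: nn_integral_cmult [symmetric])
  qed
  also have "\<dots> = (\<integral>\<^sup>+h. ennreal (pw (- s) h) *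
            (\<integral>\<^sup>+r. (\<integral>\<^sup>+\<tau>. ennreal (pw s \<tau>) * (?\<chi> r h * \<psi> (\<tau> + r)) \<partial>lborel) \<partial>lborel) \<partial>lborel)"
    by (intro nn_integral_cong arg_cong2 [where f = "(*)"] refl lborel_pair.Fubini') measurable
  also have "\<dots> = (\<integral>\<^sup>+h. (\<integral>\<^sup>+r. ennreal (pw (- s) h) * (?\<chi> r h *
             weyl s \<psi> r) \<partial>lborel) \<partial>lborel)"
    by (simp add: nn_integral_cmult [symmetric] ac_simps)
  also have "\<dots> = (\<integral>\<^sup>+r. (\<integral>\<^sup>+h. ennreal (pw (- s) h) * (?\<chi> r h *
             weyl s \<psi> r) \<partial>lborel) \<partial>lborel)"
    by (rule lborel_pair.Fubini') measurable
  \<comment> \<open>Integrating the weight of order \<open>- s\<close> over \<open>h > r\<close>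
    leaves order \<open>1 - s\<close>; composed with the Weyl integral of order \<open>s\<close>
    this gives total order 1.\<close>
  also have "\<dots> = (\<integral>\<^sup>+r. ennreal (1 / s) * (ennreal (pw (1 - s) r) * weyl s \<psi> r) \<partial>lborel)"
  proof (rule nn_integral_cong)
    fix r :: real
    let ?P = "weyl s \<psi> r"
    have "(\<integral>\<^sup>+h. ennreal (pw (- s) h) * (?\<chi> r h * ?P) \<partial>lborel)
        = (\<integral>\<^sup>+h. ennreal (pw (- s) h) * ?\<chi> r h * ?P \<partial>lborel)"
      by (simp add: mult.assoc)
    also have "\<dots> = (\<integral>\<^sup>+h. ennreal (pw (- s) h) * ?\<chi> r h \<partial>lborel) * ?P"
      by (rule nn_integral_multc) measurable
    also have "(\<integral>\<^sup>+h. ennreal (pw (- s) h) * ?\<chi> r h \<partial>lborel) = ennreal (1 / s) * ennreal (pw (1 - s) r)"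
    proof (cases "r > 0")
      case True
      have "?\<chi> r h = indicator {r<..} h" for h
        using True by (simp add: indicator_def)
      then show ?thesis
        using nn_integral_pw_tail [OF s(1) True] True s by (simp add: pw_def ennreal_mult' [symmetric])
    qed (simp add: pw_def)
    finally show "(\<integral>\<^sup>+h. ennreal (pw (- s) h) * (?\<chi> r h * ?P) \<partial>lborel)
      = ennreal (1 / s) * (ennreal (pw (1 - s) r) * ?P)" by (simp add: mult.assoc)
  qed
  also have "\<dots> = ennreal (1 / s) * (ennreal (Beta (1 - s) s) * (\<integral>\<^sup>+\<sigma>. ennreal (pw (1 - s + s) \<sigma>) * \<psi> \<sigma> \<partial>lborel))"
    using s by (subst nn_integral_pw_conv [symmetric]) (simp_all add: nn_integral_cmult)
  also have "\<dots> = ennreal (Beta (1 - s) s / s) * (\<integral>\<^sup>+\<sigma>. ennreal (pw 1 \<sigma>) * \<psi> \<sigma> \<partial>lborel)"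
    using s Beta_real_pos [of "1 - s" s]
    by (simp add: mult.assoc [symmetric] ennreal_mult' [symmetric])
  finally show ?thesis .
qed

section \<open>Potentials of Gaussians\<close>

text \<open>With K = \<open>max 1 k\<close>, one has 1 + y \<le> K (1 + y/k) \<le> K exp (y/k); the
  k-th power of this is the claim. Trading exponentials for powers makes the later time integrals
  homogeneous.\<close>

lemma exp_minus_le_powr:
  fixes k y :: real
  assumes "k > 0" "y \<ge> 0"
  shows "exp (- y) \<le> max 1 k powr k * (1 + y) powr (- k)"
proof -
  have "1 + y \<le> max 1 k * (1 + y / k)"
  proof (cases "k \<ge> 1")
    case False
    have "k * y \<le> 1 * y" using False assms by (intro mult_right_mono) auto
    then show ?thesis using False assms by (simp add: field_simps)
  qed (use assms in \<open>simp add: field_simps\<close>)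
  also have "\<dots> \<le> max 1 k * exp (y / k)"
    by (intro mult_left_mono exp_ge_add_one_self) auto
  finally have "(1 + y) powr k \<le> (max 1 k * exp (y / k)) powr k"
    using assms by (intro powr_mono2) auto
  also have "\<dots> = max 1 k powr k * exp y"
    using assms by (subst powr_mult) (auto simp: exp_powr_real)
  finally have "(1 + y) powr k \<le> max 1 k powr k * exp y" .
  then show ?thesis
    using assms by (simp add: exp_minus powr_minus field_simps)
qed

text \<open>Supplies the positivity of constants that are otherwise only known as the values of
  finite integrals.\<close>

lemma nn_integral_neq_0:
  fixes f :: "real \<Rightarrow> ennreal"
  assumes [measurable]: "f \<in> borel_measurable borel" and f: "\<And>t. t > 0 \<Longrightarrow> f t \<noteq> 0"
  shows "(\<integral>\<^sup>+t. f t \<partial>lborel) \<noteq> 0"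
proof
  assume "(\<integral>\<^sup>+t. f t \<partial>lborel) = 0"
  then have "AE t in lborel. f t = 0" by (subst (asm) nn_integral_0_iff_AE) auto
  then have "AE t in lborel. t \<notin> {0<..<1::real}" by eventually_elim (use f in auto)
  then have "{0<..<1::real} \<in> null_sets lborel"
    by (subst (asm) AE_iff_null_sets [symmetric]) auto
  then show False by (auto simp: null_sets_def)
qed

text \<open>The substitution \<tau> -> \<rho> \<tau> extracts the power of \<rho>. The remaining
  integral, with \<rho> = 1, converges at 0 because m > 0 and at infinity because m < \<theta>; its
  value is not computed.\<close>

lemma nn_integral_pw_shift:
  assumes "0 < m" "m < \<theta>"
  shows "\<exists>C>0. \<forall>\<rho>>0. (\<integral>\<^sup>+\<tau>. ennreal (pw m \<tau>) * ennreal ((\<tau> + \<rho>) powr (- \<theta>)) \<partial>lborel) = ennreal (C * \<rho> powr (m - \<theta>))"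
proof -
  let ?I = "\<integral>\<^sup>+\<tau>. ennreal (pw m \<tau>) * ennreal ((\<tau> + 1) powr (- \<theta>)) \<partial>lborel"
  have "?I \<le> (\<integral>\<^sup>+\<tau>. ennreal (pw m \<tau>) * indicator {..1} \<tau> + ennreal (pw (- (\<theta> - m)) \<tau>) * indicator {1<..} \<tau> \<partial>lborel)"
  proof (rule nn_integral_mono)
    fix \<tau> :: real
    consider "\<tau> \<le> 0" | "0 < \<tau>" "\<tau> \<le> 1" | "\<tau> > 1" by linarith
    then show "ennreal (pw m \<tau>) * ennreal ((\<tau> + 1) powr (- \<theta>)) \<le>
      ennreal (pw m \<tau>) * indicator {..1} \<tau> + ennreal (pw (- (\<theta> - m)) \<tau>) * indicator {1<..} \<tau>"
    proof cases
      case 2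
      have "(\<tau> + 1) powr (- \<theta>) \<le> 1"
        using powr_mono2' [of "- \<theta>" 1 "\<tau> + 1"] 2 assms by simp
      with 2 show ?thesis
        by (simp add: ennreal_mult' [symmetric] mult_left_le)
    next
      case 3
      have "\<tau> powr (m - 1) * (\<tau> + 1) powr (- \<theta>) \<le> \<tau> powr (m - 1) * \<tau> powr (- \<theta>)"
        using 3 assms by (intro mult_left_mono powr_mono2') auto
      also have "\<dots> = \<tau> powr (- (\<theta> - m) - 1)"
        by (simp add: powr_add [symmetric] algebra_simps)
      finally show ?thesis using 3 by (simp add: pw_def ennreal_mult' [symmetric])
    qed (simp add: pw_def)
  qed
  also have "\<dots> = ennreal (1 powr m / m) + ennreal (1 powr (- (\<theta> - m)) / (\<theta> - m))"
    using assms by (subst nn_integral_add) (simp_all add: nn_integral_pw_tail nn_integral_pw_head del: minus_diff_eq)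
  also have "\<dots> < \<infinity>" by simp
  finally obtain C where C: "C \<ge> 0" "?I = ennreal C" by (cases ?I) auto
  have eq: "(\<integral>\<^sup>+\<tau>. ennreal (pw m \<tau>) * ennreal ((\<tau> + \<rho>) powr (- \<theta>)) \<partial>lborel) = ennreal (C * \<rho> powr (m - \<theta>))"
    if "\<rho> > 0" for \<rho>
  proof -
    have "(\<integral>\<^sup>+\<tau>. ennreal (pw m \<tau>) * ennreal ((\<tau> + \<rho>) powr (- \<theta>)) \<partial>lborel)
       = ennreal (\<rho> powr m) * (\<integral>\<^sup>+\<tau>. ennreal (pw m \<tau>) * ennreal ((\<rho> * \<tau> + \<rho>) powr (- \<theta>)) \<partial>lborel)"
      using that by (intro nn_integral_pw_scale) auto
    also have "(\<integral>\<^sup>+\<tau>. ennreal (pw m \<tau>) * ennreal ((\<rho> * \<tau> + \<rho>) powr (- \<theta>)) \<partial>lborel)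
       = (\<integral>\<^sup>+\<tau>. ennreal (\<rho> powr (- \<theta>)) * (ennreal (pw m \<tau>) * ennreal ((\<tau> + 1) powr (- \<theta>))) \<partial>lborel)"
    proof (rule nn_integral_cong)
      fix \<tau> :: real
      have "\<rho> * \<tau> + \<rho> = \<rho> * (\<tau> + 1)" by (simp add: algebra_simps)
      then have "(\<rho> * \<tau> + \<rho>) powr (- \<theta>) = \<rho> powr (- \<theta>) * (\<tau> + 1) powr (- \<theta>)"
        by (simp only: powr_mult)
      then show "ennreal (pw m \<tau>) * ennreal ((\<rho> * \<tau> + \<rho>) powr (- \<theta>))
          = ennreal (\<rho> powr (- \<theta>)) * (ennreal (pw m \<tau>) * ennreal ((\<tau> + 1) powr (- \<theta>)))"
        by (simp add: ennreal_mult' mult.left_commute)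
    qed
    also have "\<dots> = ennreal (\<rho> powr (- \<theta>)) * ennreal C"
      using C by (subst nn_integral_cmult) auto
    also have "ennreal (\<rho> powr m) * \<dots> = ennreal (C * (\<rho> powr m * \<rho> powr (- \<theta>)))"
      using C by (simp add: ennreal_mult' [symmetric] mult_ac)
    finally show ?thesis by (simp add: powr_add [symmetric])
  qed
  have "?I \<noteq> 0" by (rule nn_integral_neq_0) (auto simp: pw_def)
  then have "C \<noteq> 0" using C by auto
  with C eq show ?thesis by (intro exI [of _ C]) auto
qed

text \<open>With exponent n/2 in \<open>exp_minus_le_powr\<close>, the time factor and the Gaussian
  factor merge into one power of a sum, so the bound holds in all regimes of t and |x| at
  once.\<close>

lemma heat_le:
  "\<exists>C>0. \<forall>t>0. \<forall>x :: real^'n::finite. heat t x \<le> C * (t + (norm x)\<^sup>2) powr (- (real CARD('n) / 2))"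
proof -
  define \<nu> where "\<nu> = real CARD('n) / 2"
  have \<nu>: "\<nu> > 0" by (simp add: \<nu>_def)
  define C where "C = max 1 \<nu> powr \<nu> * pi powr (- \<nu>)"
  have "heat t x \<le> C * (t + (norm x)\<^sup>2) powr (- \<nu>)" if t: "t > 0" for t and x :: "real^'n"
  proof -
    have "heat t x = (2 * pi * t) powr (- \<nu>) * exp (- ((norm x)\<^sup>2 / (2 * t)))"
      by (simp add: heat_def \<nu>_def)
    also have "\<dots> \<le> (2 * pi * t) powr (- \<nu>) * (max 1 \<nu> powr \<nu> * (1 + (norm x)\<^sup>2 / (2 * t)) powr (- \<nu>))"
      using \<nu> t by (intro mult_left_mono exp_minus_le_powr) auto
    also have "\<dots> = max 1 \<nu> powr \<nu> * pi powr (- \<nu>) * ((2 * t) powr (- \<nu>) * (1 + (norm x)\<^sup>2 / (2 * t)) powr (- \<nu>))"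
      using t by (simp add: powr_mult)
    also have "(2 * t) powr (- \<nu>) * (1 + (norm x)\<^sup>2 / (2 * t)) powr (- \<nu>) = (2 * t + (norm x)\<^sup>2) powr (- \<nu>)"
    proof -
      have "2 * t * (1 + (norm x)\<^sup>2 / (2 * t)) = 2 * t + (norm x)\<^sup>2"
        using t by (simp add: distrib_left)
      then show ?thesis by (simp only: powr_mult [symmetric])
    qed
    also have "max 1 \<nu> powr \<nu> * pi powr (- \<nu>) * \<dots> \<le> max 1 \<nu> powr \<nu> * pi powr (- \<nu>) * (t + (norm x)\<^sup>2) powr (- \<nu>)"
      using t \<nu> by (intro mult_left_mono powr_mono2') (auto intro: add_pos_nonneg)
    finally show ?thesis by (simp add: C_def)
  qed
  moreover have "C > 0" by (simp add: C_def)
  ultimately show ?thesis by (auto simp: \<nu>_def)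
qed

text \<open>Up to a constant this is (-\<Delta>)^(-g) applied to \<open>heat a\<close>, that is, the
  Riesz potential of order 2g of a Gaussian. Smoothing by \<open>a > 0\<close> removes the
  singularity at the origin without changing the decay.\<close>

definition pot :: "real \<Rightarrow> real \<Rightarrow> real^'n::finite \<Rightarrow> real" where
  "pot g a x = (\<integral>\<tau>. pw g \<tau> * heat (a + \<tau>) x \<partial>lborel)"

lemma pot_nonneg [simp]: "0 \<le> pot g a x"
  by (simp add: pot_def)

lemma pot_measurable [measurable (raw)]:
  assumes [measurable]: "f \<in> borel_measurable M" "h \<in> borel_measurable M"
  shows "(\<lambda>z. pot g (f z) (h z)) \<in> borel_measurable M"
  unfolding pot_def by measurable

text \<open>The bound in \<open>heat_le\<close> involves the time \<open>a + \<tau>\<close> and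
  |x|^2 only through their sum, so \<open>nn_integral_pw_shift\<close> applies with \<rho> = a +
  |x|^2.\<close>

lemma nn_integral_pot_le:
  assumes "0 < g" "g < real CARD('n) / 2"
  shows "\<exists>C>0. \<forall>a>0. \<forall>x :: real^'n::finite.
     weyl g (\<lambda>t. ennreal (heat t x)) a \<le> ennreal (C * (a + (norm x)\<^sup>2) powr (g - real CARD('n) / 2))"
proof -
  obtain C where C: "C > 0" "\<And>t x. t > 0 \<Longrightarrow> heat t (x :: real^'n) \<le> C * (t + (norm x)\<^sup>2) powr (- (real CARD('n) / 2))"
    using heat_le [where ?'n = 'n] by blast
  obtain D where D: "D > 0" "\<And>\<rho>. \<rho> > 0 \<Longrightarrow> (\<integral>\<^sup>+\<tau>. ennreal (pw g \<tau>) * ennreal ((\<tau> + \<rho>) powr (- (real CARD('n) / 2))) \<partial>lborel)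
      = ennreal (D * \<rho> powr (g - real CARD('n) / 2))"
    using nn_integral_pw_shift [OF assms] by blast
  have "weyl g (\<lambda>t. ennreal (heat t x)) a \<le> ennreal (C * D * (a + (norm x)\<^sup>2) powr (g - real CARD('n) / 2))"
    if a: "a > 0" for a and x :: "real^'n"
  proof -
    have "weyl g (\<lambda>t. ennreal (heat t x)) a
       \<le> (\<integral>\<^sup>+\<tau>. ennreal C * (ennreal (pw g \<tau>) * ennreal ((\<tau> + (a + (norm x)\<^sup>2)) powr (- (real CARD('n) / 2)))) \<partial>lborel)"
    proof (rule nn_integral_mono)
      fix \<tau> :: real
      show "ennreal (pw g \<tau>) * ennreal (heat (a + \<tau>) x) \<le> ennreal C * (ennreal (pw g \<tau>) * ennreal ((\<tau> + (a + (norm x)\<^sup>2)) powr (- (real CARD('n) / 2))))"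
      proof (cases "\<tau> > 0")
        case True
        with C(2) [of "a + \<tau>" x] a have "heat (a + \<tau>) x \<le> C * (\<tau> + (a + (norm x)\<^sup>2)) powr (- (real CARD('n) / 2))"
          by (simp add: add_ac)
        then have "pw g \<tau> * heat (a + \<tau>) x \<le> pw g \<tau> * (C * (\<tau> + (a + (norm x)\<^sup>2)) powr (- (real CARD('n) / 2)))"
          by (rule mult_left_mono) simp
        then have "pw g \<tau> * heat (a + \<tau>) x \<le> C * (pw g \<tau> * (\<tau> + (a + (norm x)\<^sup>2)) powr (- (real CARD('n) / 2)))"
          by (simp only: mult.left_commute)
        from ennreal_leI [OF this] C(1) show ?thesis
          by (simp add: ennreal_mult)
      qed (simp add: pw_def)
    qed
    also have "\<dots> = ennreal (C * D * (a + (norm x)\<^sup>2) powr (g - real CARD('n) / 2))"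
      using C(1) D(1) D(2) [of "a + (norm x)\<^sup>2"] a
      by (subst nn_integral_cmult) (simp_all add: add_pos_nonneg ennreal_mult mult.assoc)
    finally show ?thesis .
  qed
  moreover have "C * D > 0" using C D by simp
  ultimately show ?thesis by blast
qed

lemma nn_integral_pot:
  fixes x :: "real^'n::finite"
  assumes "0 < g" "g < real CARD('n) / 2" "a > 0"
  shows "weyl g (\<lambda>t. ennreal (heat t x)) a = ennreal (pot g a x)"
proof -
  obtain C where "weyl g (\<lambda>t. ennreal (heat t x)) a \<le> ennreal (C * (a + (norm x)\<^sup>2) powr (g - real CARD('n) / 2))"
    using nn_integral_pot_le [OF assms(1,2)] assms(3) by blast
  also have "\<dots> < \<infinity>" by simp
  finally have int: "integrable lborel (\<lambda>\<tau>. pw g \<tau> * heat (a + \<tau>) x)"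
    by (intro integrableI_nonneg) (auto simp: ennreal_mult)
  show ?thesis
    unfolding pot_def using nn_integral_eq_integral [OF int] by (simp add: ennreal_mult)
qed

lemma pot_le:
  assumes "0 < g" "g < real CARD('n) / 2"
  shows "\<exists>C>0. \<forall>a>0. \<forall>x :: real^'n::finite. pot g a x \<le> C * (a + (norm x)\<^sup>2) powr (g - real CARD('n) / 2)"
proof -
  obtain C where C: "C > 0" "\<And>a x. a > 0 \<Longrightarrow> weyl g (\<lambda>t. ennreal (heat t (x :: real^'n))) a \<le> ennreal (C * (a + (norm x)\<^sup>2) powr (g - real CARD('n) / 2))"
    using nn_integral_pot_le [OF assms] by blast
  have "pot g a x \<le> C * (a + (norm x)\<^sup>2) powr (g - real CARD('n) / 2)" if "a > 0" for a and x :: "real^'n"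
    using C(2) [OF that, of x] C(1) unfolding nn_integral_pot [OF assms that]
    by (subst (asm) ennreal_le_iff) auto
  with C(1) show ?thesis by blast
qed

text \<open>Only the window \<rho> \<le> \<tau> \<le> 2 \<rho> with \<rho> = a + |x|^2 is kept.
  There the integrand is at least of order \<rho>^(g - 1 - n/2), and the window has length
  \<rho>.\<close>

lemma pot_ge:
  assumes "0 < g" "g < real CARD('n) / 2"
  shows "\<exists>c>0. \<forall>a>0. \<forall>x :: real^'n::finite. pot g a x \<ge> c * (a + (norm x)\<^sup>2) powr (g - real CARD('n) / 2)"
proof -
  define \<nu> where "\<nu> = real CARD('n) / 2"
  have \<nu>: "\<nu> > 0" by (simp add: \<nu>_def)
  \<comment> \<open>The minimum covers both monotonicity regimes of
    \<open>\<tau> powr (g - 1)\<close> on the window, \<open>6 * pi\<close> comes from a + \<tau>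
    \<le> 3 \<rho>, and the exponent -1/2 from |x|^2 \<le> \<rho> \<le> \<tau>.\<close>
  define c where "c = min 1 (2 powr (g - 1)) * ((6 * pi) powr (- \<nu>) * exp (- (1/2)))"
  have c: "c > 0" by (simp add: c_def)
  have "pot g a x \<ge> c * (a + (norm x)\<^sup>2) powr (g - \<nu>)" if a: "a > 0" for a and x :: "real^'n"
  proof -
    define \<rho> where "\<rho> = a + (norm x)\<^sup>2"
    have \<rho>: "\<rho> > 0" using a by (simp add: \<rho>_def add_pos_nonneg)
    have le: "c * \<rho> powr (g - 1 - \<nu>) \<le> pw g \<tau> * heat (a + \<tau>) x" if \<tau>: "\<rho> \<le> \<tau>" "\<tau> \<le> 2 * \<rho>" for \<tau>
    proof -
      have "min 1 (2 powr (g - 1)) * \<rho> powr (g - 1) \<le> \<tau> powr (g - 1)"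
      proof (cases "g \<ge> 1")
        case True
        then have "\<rho> powr (g - 1) \<le> \<tau> powr (g - 1)" using \<tau> \<rho> by (intro powr_mono2) auto
        moreover have "min 1 (2 powr (g - 1)) * \<rho> powr (g - 1) \<le> 1 * \<rho> powr (g - 1)"
          by (intro mult_right_mono) auto
        ultimately show ?thesis by simp
      next
        case False
        then have "(2 * \<rho>) powr (g - 1) \<le> \<tau> powr (g - 1)" using \<tau> \<rho> by (intro powr_mono2') auto
        moreover have "min 1 (2 powr (g - 1)) * \<rho> powr (g - 1) \<le> 2 powr (g - 1) * \<rho> powr (g - 1)"
          by (intro mult_right_mono) auto
        moreover have "(2 * \<rho>) powr (g - 1) = 2 powr (g - 1) * \<rho> powr (g - 1)"
          using \<rho> by (simp add: powr_mult)
        ultimately show ?thesis by linarith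
      qed
      then have 1: "min 1 (2 powr (g - 1)) * \<rho> powr (g - 1) \<le> pw g \<tau>"
        using \<tau> \<rho> by (simp add: pw_def)
      have 2: "(2 * pi * (a + \<tau>)) powr (- \<nu>) \<ge> (2 * pi * (3 * \<rho>)) powr (- \<nu>)"
      proof (intro powr_mono2')
        have "a \<le> \<rho>" by (simp add: \<rho>_def)
        then have "a + \<tau> \<le> 3 * \<rho>" using \<tau> by linarith
        then show "2 * pi * (a + \<tau>) \<le> 2 * pi * (3 * \<rho>)" by simp
      qed (use \<tau> \<rho> \<nu> a in auto)
      have 3: "exp (- (norm x)\<^sup>2 / (2 * (a + \<tau>))) \<ge> exp (- (1/2))"
        using \<tau> \<rho> a by (auto simp: \<rho>_def field_simps)
      have "(6 * pi) powr (- \<nu>) * \<rho> powr (- \<nu>) * exp (- (1/2)) \<le> heat (a + \<tau>) x"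
        unfolding heat_def \<nu>_def [symmetric] using mult_mono [OF 2 3] \<rho> by (simp add: powr_mult [symmetric] mult_ac)
      from mult_mono [OF 1 this] have
        "min 1 (2 powr (g - 1)) * \<rho> powr (g - 1) * ((6 * pi) powr (- \<nu>) * \<rho> powr (- \<nu>) * exp (- (1/2))) \<le> pw g \<tau> * heat (a + \<tau>) x"
        by simp
      moreover have "\<rho> powr (g - 1 - \<nu>) = \<rho> powr (g - 1) * \<rho> powr (- \<nu>)"
        by (simp add: powr_add [symmetric])
      ultimately show ?thesis by (simp add: c_def mult_ac)
    qed
    have "ennreal (c * \<rho> powr (g - \<nu>)) = ennreal (c * \<rho> powr (g - 1 - \<nu>)) * emeasure lborel {\<rho>..2 * \<rho>}"
    proof -
      have "\<rho> powr (g - \<nu>) = \<rho> * \<rho> powr (g - 1 - \<nu>)" using \<rho> by (simp add: powr_mult_base)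
      then show ?thesis using \<rho> c by (simp add: ennreal_mult' [symmetric] mult_ac)
    qed
    also have "\<dots> = (\<integral>\<^sup>+\<tau>. ennreal (c * \<rho> powr (g - 1 - \<nu>)) * indicator {\<rho>..2 * \<rho>} \<tau> \<partial>lborel)"
      by (simp add: nn_integral_cmult_indicator)
    also have "\<dots> \<le> weyl g (\<lambda>t. ennreal (heat t x)) a"
      by (intro nn_integral_mono) (auto simp: indicator_def ennreal_mult [symmetric] intro!: le ennreal_leI)
    also have "\<dots> = ennreal (pot g a x)"
      using assms a by (intro nn_integral_pot)
    finally show ?thesis by (simp add: \<rho>_def)
  qed
  with c show ?thesis by (auto simp: \<nu>_def)
qed

text \<open>Running the heat flow for time \<open>h\<close> merely shifts the parameter
  \<open>a\<close>. This is what turns the n-dimensional operator into a one-dimensional one acting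
  on \<open>a\<close>.\<close>

lemma nn_integral_pot_conv:
  fixes x :: "real^'n::finite"
  assumes "0 < g" "g < real CARD('n) / 2" "a > 0" "h > 0"
  shows "(\<integral>\<^sup>+z. ennreal (pot g a (x + z)) * ennreal (heat h z) \<partial>lborel) = ennreal (pot g (a + h) x)"
proof -
  have "(\<integral>\<^sup>+z. ennreal (pot g a (x + z)) * ennreal (heat h z) \<partial>lborel)
      = (\<integral>\<^sup>+z. (\<integral>\<^sup>+\<tau>. ennreal (pw g \<tau>) * ennreal (heat (a + \<tau>) (x + z)) * ennreal (heat h z) \<partial>lborel) \<partial>lborel)"
    using assms by (simp add: nn_integral_pot [symmetric] nn_integral_multc)
  also have "\<dots> = (\<integral>\<^sup>+\<tau>. (\<integral>\<^sup>+z. ennreal (pw g \<tau>) * ennreal (heat (a + \<tau>) (x + z)) * ennreal (heat h z) \<partial>lborel) \<partial>lborel)"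
    by (rule lborel_pair.Fubini') measurable
  also have "\<dots> = weyl g (\<lambda>t. ennreal (heat t x)) (a + h)"
  proof (rule nn_integral_cong)
    fix \<tau> :: real
    have "(\<integral>\<^sup>+z. ennreal (pw g \<tau>) * ennreal (heat (a + \<tau>) (x + z)) * ennreal (heat h z) \<partial>lborel)
        = ennreal (pw g \<tau>) * (\<integral>\<^sup>+z. ennreal (heat (a + \<tau>) (x + z)) * ennreal (heat h z) \<partial>lborel)"
      by (simp add: nn_integral_cmult mult.assoc)
    also have "\<dots> = ennreal (pw g \<tau>) * ennreal (heat (a + h + \<tau>) x)"
      using nn_integral_heat_conv [of "a + \<tau>" h x] assms by (cases "\<tau> > 0") (simp_all add: pw_def add_ac)
    finally show "(\<integral>\<^sup>+z. ennreal (pw g \<tau>) * ennreal (heat (a + \<tau>) (x + z)) * ennreal (heat h z) \<partial>lborel)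
       = ennreal (pw g \<tau>) * ennreal (heat (a + h + \<tau>) x)" .
  qed
  also have "\<dots> = ennreal (pot g (a + h) x)"
    using assms by (intro nn_integral_pot) auto
  finally show ?thesis .
qed

section \<open>The singular kernel as a mixture of heat kernels\<close>

abbreviation frac_kernel :: "real \<Rightarrow> real^'n::finite \<Rightarrow> real" where
  "frac_kernel s z \<equiv> norm z powr (- (real CARD('n) + 2 * s))"

text \<open>The substitution h -> |z|^2 h extracts the power of |z| by homogeneity; \<open>c\<close>
  is the remaining integral, which belongs to |z| = 1.\<close>

lemma nn_integral_heat_kernel:
  assumes s: "s > 0"
  shows "\<exists>c>0. \<forall>z :: real^'n::finite. z \<noteq> 0 \<longrightarrow>
    (\<integral>\<^sup>+h. ennreal (pw (- s) h) * ennreal (heat h z) \<partial>lborel) = ennreal (c * frac_kernel s z)"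
proof -
  define \<nu> where "\<nu> = real CARD('n) / 2"
  have \<nu>: "\<nu> > 0" by (simp add: \<nu>_def)
  define f where "f h = (2 * pi * h) powr (- \<nu>) * exp (- 1 / (2 * h))" for h :: real
  have [measurable]: "f \<in> borel_measurable borel" unfolding f_def by measurable
  let ?I = "\<integral>\<^sup>+h. ennreal (pw (- s) h) * ennreal (f h) \<partial>lborel"
  \<comment> \<open>This exponent collects all negative powers of \<open>h\<close>, so that the
    estimate of the exponential turns \<open>h powr (- k)\<close> into
    \<open>(h + 1/2) powr (- k)\<close>: no singularity at 0 is left, and k > 1 gives convergence at
    infinity.\<close>
  define k where "k = s + \<nu> + 1"
  define C where "C = max 1 k powr k * (2 * pi) powr (- \<nu>)"
  have k: "k > 1" using s \<nu> by (simp add: k_def)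
  obtain D where D: "D > 0" "(\<integral>\<^sup>+\<tau>. ennreal (pw 1 \<tau>) * ennreal ((\<tau> + 1/2) powr (- k)) \<partial>lborel) = ennreal (D * (1/2) powr (1 - k))"
    using nn_integral_pw_shift [of 1 k] k by fastforce
  have "?I \<le> (\<integral>\<^sup>+h. ennreal C * (ennreal (pw 1 h) * ennreal ((h + 1/2) powr (- k))) \<partial>lborel)"
  proof (rule nn_integral_mono)
    fix h :: real
    show "ennreal (pw (- s) h) * ennreal (f h) \<le> ennreal C * (ennreal (pw 1 h) * ennreal ((h + 1/2) powr (- k)))"
    proof (cases "h > 0")
      case True
      have "exp (- 1 / (2 * h)) \<le> max 1 k powr k * (1 + 1 / (2 * h)) powr (- k)"
        using exp_minus_le_powr [of k "1 / (2 * h)"] True k by simp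
      then have "pw (- s) h * f h \<le> h powr (- s - 1) * ((2 * pi * h) powr (- \<nu>) * (max 1 k powr k * (1 + 1 / (2 * h)) powr (- k)))"
        unfolding f_def using True by (auto simp: pw_def intro!: mult_left_mono)
      also have "\<dots> = C * ((h powr (- s - 1) * h powr (- \<nu>)) * (1 + 1 / (2 * h)) powr (- k))"
        using True by (simp add: C_def powr_mult)
      also have "h powr (- s - 1) * h powr (- \<nu>) = h powr (- k)"
      proof -
        have "- k = (- s - 1) + (- \<nu>)" by (simp add: k_def)
        then show ?thesis by (simp only: powr_add)
      qed
      also have "h powr (- k) * (1 + 1 / (2 * h)) powr (- k) = (h + 1/2) powr (- k)"
      proof -
        have "h * (1 + 1 / (2 * h)) = h + 1/2" using True by (simp add: distrib_left)
        then show ?thesis by (simp only: powr_mult [symmetric])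
      qed
      finally show ?thesis using True by (simp add: ennreal_mult' [symmetric] pw_def C_def f_def)
    qed (simp add: pw_def)
  qed
  also have "\<dots> < \<infinity>" using D by (simp add: nn_integral_cmult ennreal_mult_less_top)
  finally obtain c where c: "c \<ge> 0" "?I = ennreal c" by (cases ?I) auto
  have "?I \<noteq> 0" by (rule nn_integral_neq_0) (auto simp: pw_def f_def)
  then have "c \<noteq> 0" using c by auto
  moreover have "(\<integral>\<^sup>+h. ennreal (pw (- s) h) * ennreal (heat h z) \<partial>lborel) = ennreal (c * frac_kernel s z)"
    if z: "z \<noteq> 0" for z :: "real^'n"
  proof -
    define r where "r = (norm z)\<^sup>2"
    have r: "r > 0" using z by (simp add: r_def)
    have "(\<integral>\<^sup>+h. ennreal (pw (- s) h) * ennreal (heat h z) \<partial>lborel)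
       = ennreal (r powr (- s)) * (\<integral>\<^sup>+h. ennreal (pw (- s) h) * ennreal (heat (r * h) z) \<partial>lborel)"
      using r by (intro nn_integral_pw_scale) auto
    also have "(\<integral>\<^sup>+h. ennreal (pw (- s) h) * ennreal (heat (r * h) z) \<partial>lborel)
       = (\<integral>\<^sup>+h. ennreal (r powr (- \<nu>)) * (ennreal (pw (- s) h) * ennreal (f h)) \<partial>lborel)"
    proof (rule nn_integral_cong)
      fix h :: real
      have "2 * pi * (r * h) = r * (2 * pi * h)" by simp
      then have "(2 * pi * (r * h)) powr (- \<nu>) = r powr (- \<nu>) * (2 * pi * h) powr (- \<nu>)"
        by (simp only: powr_mult)
      moreover have "- (norm z)\<^sup>2 / (2 * (r * h)) = - 1 / (2 * h)"
        using r by (simp add: r_def [symmetric])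
      ultimately have "heat (r * h) z = r powr (- \<nu>) * f h" by (simp add: heat_def f_def \<nu>_def)
      then show "ennreal (pw (- s) h) * ennreal (heat (r * h) z)
          = ennreal (r powr (- \<nu>)) * (ennreal (pw (- s) h) * ennreal (f h))"
        by (simp add: ennreal_mult' mult.left_commute)
    qed
    also have "\<dots> = ennreal (r powr (- \<nu>)) * ennreal c"
      using c by (subst nn_integral_cmult) auto
    also have "ennreal (r powr (- s)) * \<dots> = ennreal (c * (r powr (- s) * r powr (- \<nu>)))"
      using c by (simp add: ennreal_mult' [symmetric] mult_ac)
    also have "r powr (- s) * r powr (- \<nu>) = r powr (- s - \<nu>)"
      by (simp add: powr_add [symmetric])
    also have "r powr (- s - \<nu>) = frac_kernel s z"
    proof -
      have "r = norm z powr 2" using z by (simp add: r_def)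
      moreover have "2 * (- s - \<nu>) = - (real CARD('n) + 2 * s)" by (simp add: \<nu>_def)
      ultimately show ?thesis by (simp only: powr_powr)
    qed
    finally show ?thesis .
  qed
  ultimately show ?thesis using c by (intro exI [of _ c]) auto
qed

section \<open>The kernel of the fractional Laplacian and Marchaud derivatives\<close>

text \<open>Half of the exponent absorbs the factor |z|^2 through y exp (-y) \<le> 1, and the other
  half is a Gaussian of doubled variance. This bounds the second moment of \<open>heat h\<close> by
  a multiple of \<open>h\<close> without computing it.\<close>

lemma norm_sq_heat_le:
  fixes z :: "real^'n::finite"
  assumes "h > 0"
  shows "(norm z)\<^sup>2 * heat h z \<le> 4 * h * 2 powr (real CARD('n) / 2) * heat (2 * h) z"
proof -
  define \<nu> where "\<nu> = real CARD('n) / 2"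
  define y where "y = (norm z)\<^sup>2 / (4 * h)"
  have y: "y \<ge> 0" "(norm z)\<^sup>2 = 4 * h * y" using assms by (auto simp: y_def)
  have "y * exp (- y) \<le> 1"
  proof -
    have "y \<le> exp y" using exp_ge_add_one_self [of y] by linarith
    then show ?thesis by (simp add: exp_minus field_simps)
  qed
  then have "y * exp (- y) * exp (- y) \<le> exp (- y)" by (simp add: mult_le_cancel_right1)
  then have "4 * h * (y * exp (- (2 * y))) \<le> 4 * h * exp (- y)"
    using assms by (simp add: mult.assoc exp_add [symmetric])
  then have "(2 * pi * h) powr (- \<nu>) * (4 * h * (y * exp (- (2 * y)))) \<le> (2 * pi * h) powr (- \<nu>) * (4 * h * exp (- y))"
    by (rule mult_left_mono) simp
  moreover have "(2 * pi * h) powr (- \<nu>) = 2 powr \<nu> * (2 * pi * (2 * h)) powr (- \<nu>)"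
  proof -
    have "2 * pi * (2 * h) = 2 * (2 * pi * h)" by simp
    then have "(2 * pi * (2 * h)) powr (- \<nu>) = 2 powr (- \<nu>) * (2 * pi * h) powr (- \<nu>)"
      by (simp only: powr_mult)
    then show ?thesis by (simp add: powr_minus)
  qed
  ultimately have "(2 * pi * h) powr (- \<nu>) * (4 * h * (y * exp (- (2 * y)))) \<le> 2 powr \<nu> * (2 * pi * (2 * h)) powr (- \<nu>) * (4 * h * exp (- y))"
    by simp
  moreover have "heat h z = (2 * pi * h) powr (- \<nu>) * exp (- (2 * y))"
    "heat (2 * h) z = (2 * pi * (2 * h)) powr (- \<nu>) * exp (- y)"
    using assms by (simp_all add: heat_def \<nu>_def y_def)
  ultimately show ?thesis unfolding y(2) \<nu>_def [symmetric] by (simp add: mult_ac)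
qed

lemma nn_integral_heat_min_le:
  assumes "h > 0"
  shows "(\<integral>\<^sup>+z. ennreal (min 1 ((norm z)\<^sup>2)) * ennreal (heat h z) \<partial>(lborel :: (real^'n::finite) measure))
    \<le> ennreal (min 1 (4 * 2 powr (real CARD('n) / 2) * h))"
proof -
  let ?L = "lborel :: (real^'n) measure"
  let ?I = "\<integral>\<^sup>+z. ennreal (min 1 ((norm z)\<^sup>2)) * ennreal (heat h z) \<partial>?L"
  have "?I \<le> (\<integral>\<^sup>+z. ennreal (heat h z) \<partial>?L)"
    by (intro nn_integral_mono) (simp add: ennreal_mult' [symmetric] mult_left_le_one_le)
  then have 1: "?I \<le> 1"
    using assms by (simp add: nn_integral_heat)
  let ?c = "4 * 2 powr (real CARD('n) / 2) * h"
  have "?I \<le> (\<integral>\<^sup>+z. ennreal ?c * ennreal (heat (2 * h) z) \<partial>?L)"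
  proof (rule nn_integral_mono)
    fix z :: "real^'n"
    have "min 1 ((norm z)\<^sup>2) * heat h z \<le> (norm z)\<^sup>2 * heat h z"
      by (intro mult_right_mono) auto
    also have "\<dots> \<le> ?c * heat (2 * h) z" using norm_sq_heat_le [OF assms, of z] by (simp add: mult_ac)
    finally show "ennreal (min 1 ((norm z)\<^sup>2)) * ennreal (heat h z) \<le> ennreal ?c * ennreal (heat (2 * h) z)"
      using assms by (simp add: ennreal_mult' [symmetric])
  qed
  also have "\<dots> = ennreal ?c" using assms by (simp add: nn_integral_cmult nn_integral_heat)
  finally show ?thesis using 1 by (simp add: min_def)
qed

text \<open>After writing the kernel as a mixture, the inner integral is at most min 1 (C h), and
  h^(-s-1) min 1 (C h) is integrable near 0 because s < 1 and near infinity because s > 0.\<close>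

lemma nn_integral_min_kernel:
  assumes s: "0 < s" "s < 1"
  shows "(\<integral>\<^sup>+z. ennreal (min 1 ((norm z)\<^sup>2)) * ennreal (frac_kernel s z) \<partial>(lborel :: (real^'n::finite) measure)) < \<infinity>"
proof -
  let ?L = "lborel :: (real^'n) measure"
  obtain c where c: "c > 0" "\<And>z :: real^'n. z \<noteq> 0 \<Longrightarrow>
    (\<integral>\<^sup>+h. ennreal (pw (- s) h) * ennreal (heat h z) \<partial>lborel) = ennreal (c * frac_kernel s z)"
    using nn_integral_heat_kernel [OF s(1), where ?'n = 'n] by blast
  define C where "C = 4 * 2 powr (real CARD('n) / 2)"
  have C: "C > 0" by (simp add: C_def)
  have "ennreal c * (\<integral>\<^sup>+z. ennreal (min 1 ((norm z)\<^sup>2)) * ennreal (frac_kernel s z) \<partial>?L)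
     = (\<integral>\<^sup>+z. ennreal (min 1 ((norm z)\<^sup>2)) * ennreal (c * frac_kernel s z) \<partial>?L)"
    using c(1) by (simp add: nn_integral_cmult [symmetric] ennreal_mult' mult_ac)
  also have "\<dots> = (\<integral>\<^sup>+z. (\<integral>\<^sup>+h. ennreal (min 1 ((norm z)\<^sup>2)) * (ennreal (pw (- s) h) * ennreal (heat h z)) \<partial>lborel) \<partial>?L)"
    using AE_lborel_singleton [of "0 :: real^'n"]
    by (intro nn_integral_cong_AE, eventually_elim) (simp add: nn_integral_cmult c(2))
  also have "\<dots> = (\<integral>\<^sup>+h. (\<integral>\<^sup>+z. ennreal (min 1 ((norm z)\<^sup>2)) * (ennreal (pw (- s) h) * ennreal (heat h z)) \<partial>?L) \<partial>lborel)"
    by (rule lborel_pair.Fubini') measurable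
  also have "\<dots> \<le> (\<integral>\<^sup>+h. ennreal C * (ennreal (pw (1 - s) h) * indicator {..1} h) + ennreal (pw (- s) h) * indicator {1<..} h \<partial>lborel)"
  proof (rule nn_integral_mono)
    fix h :: real
    show "(\<integral>\<^sup>+z. ennreal (min 1 ((norm z)\<^sup>2)) * (ennreal (pw (- s) h) * ennreal (heat h z)) \<partial>?L)
       \<le> ennreal C * (ennreal (pw (1 - s) h) * indicator {..1} h) + ennreal (pw (- s) h) * indicator {1<..} h"
    proof (cases "h > 0")
      case True
      have "(\<integral>\<^sup>+z. ennreal (min 1 ((norm z)\<^sup>2)) * (ennreal (pw (- s) h) * ennreal (heat h z)) \<partial>?L)
         = ennreal (pw (- s) h) * (\<integral>\<^sup>+z. ennreal (min 1 ((norm z)\<^sup>2)) * ennreal (heat h z) \<partial>?L)"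
        by (subst nn_integral_cmult [symmetric]) (simp_all add: mult_ac)
      also have "\<dots> \<le> ennreal (pw (- s) h) * ennreal (min 1 (C * h))"
        unfolding C_def using nn_integral_heat_min_le [OF True] by (intro mult_left_mono) auto
      also have "\<dots> \<le> ennreal C * (ennreal (pw (1 - s) h) * indicator {..1} h) + ennreal (pw (- s) h) * indicator {1<..} h"
      proof (cases "h \<le> 1")
        case h: True
        have "pw (- s) h * min 1 (C * h) \<le> pw (- s) h * (C * h)" by (intro mult_left_mono) auto
        also have "pw (- s) h * (C * h) = C * pw (1 - s) h"
          using True powr_mult_base [of h "- s - 1"] by (simp add: pw_def mult.commute)
        finally show ?thesis using h C by (simp add: ennreal_mult' [symmetric])
      next
        case False
        have "pw (- s) h * min 1 (C * h) \<le> pw (- s) h * 1" by (intro mult_left_mono) auto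
        with False show ?thesis by (simp add: ennreal_mult' [symmetric])
      qed
      finally show ?thesis .
    qed (simp add: pw_def)
  qed
  also have "\<dots> = ennreal C * ennreal (1 powr (1 - s) / (1 - s)) + ennreal (1 powr (- s) / s)"
    using s by (simp add: nn_integral_add nn_integral_cmult nn_integral_pw_tail nn_integral_pw_head)
  also have "\<dots> < \<infinity>" by (simp add: ennreal_mult_less_top)
  finally show ?thesis using c(1) by (auto simp: ennreal_mult_less_top)
qed

lemma integrable_min_kernel:
  assumes s: "0 < s" "s < 1"
  shows "integrable (lborel :: (real^'n::finite) measure) (\<lambda>z. min 1 ((norm z)\<^sup>2) * frac_kernel s z)"
  using nn_integral_min_kernel [OF s, where ?'n = 'n]
  by (intro integrableI_nonneg) (auto simp: ennreal_mult)

text \<open>A divergent Bochner integral is 0 by convention and \<open>inverse 0 = 0\<close>, so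
  integrability has to be shown as well as a nonzero value. The value is nonzero because the
  integrand is positive on the slab where the chosen coordinate lies in (0,1), a nonempty open
  set.\<close>

lemma frac_const_pos:
  assumes s: "0 < s" "s < 1"
  shows "frac_const TYPE('n::finite) s > 0"
proof -
  let ?L = "lborel :: (real^'n) measure"
  define i :: 'n where "i = (SOME i. True)"
  let ?f = "\<lambda>\<zeta>::real^'n. (1 - cos (\<zeta> $ i)) / norm \<zeta> powr (real CARD('n) + 2 * s)"
  have int: "integrable ?L ?f"
  proof (rule Bochner_Integration.integrable_bound)
    show "integrable ?L (\<lambda>z. 2 * (min 1 ((norm z)\<^sup>2) * frac_kernel s z))"
      using integrable_min_kernel [OF s, where ?'n = 'n] by simp
    show "?f \<in> borel_measurable ?L" by measurable
    show "AE z in ?L. norm (?f z) \<le> norm (2 * (min 1 ((norm z)\<^sup>2) * frac_kernel s z))"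
    proof (rule AE_I2)
      fix z :: "real^'n"
      have "1 - cos (z $ i) = 2 * (sin (z $ i / 2))\<^sup>2"
        using cos_double_sin [of "z $ i / 2"] by simp
      also have "(sin (z $ i / 2))\<^sup>2 \<le> (z $ i / 2)\<^sup>2"
        using abs_sin_x_le_abs_x [of "z $ i / 2"] by (simp only: abs_le_square_iff)
      also have "(z $ i / 2)\<^sup>2 \<le> (norm z)\<^sup>2"
        using component_le_norm_cart [of z i] norm_ge_zero [of z]
        by (simp only: abs_le_square_iff [symmetric] abs_divide abs_norm_cancel)
      finally have 1: "1 - cos (z $ i) \<le> 2 * (norm z)\<^sup>2" by simp
      have "1 - cos (z $ i) \<le> 2 * min 1 ((norm z)\<^sup>2)"
        using 1 cos_ge_minus_one [of "z $ i"] by (simp add: min_def)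
      then have "(1 - cos (z $ i)) * frac_kernel s z \<le> 2 * min 1 ((norm z)\<^sup>2) * frac_kernel s z"
        by (rule mult_right_mono) simp
      moreover have "?f z = (1 - cos (z $ i)) * frac_kernel s z"
        by (simp only: powr_minus divide_inverse)
      moreover have "0 \<le> (1 - cos (z $ i)) * frac_kernel s z"
        by (intro mult_nonneg_nonneg) auto
      ultimately show "norm (?f z) \<le> norm (2 * (min 1 ((norm z)\<^sup>2) * frac_kernel s z))"
        by simp
    qed
  qed
  have "integral\<^sup>L ?L ?f \<noteq> 0"
  proof
    assume "integral\<^sup>L ?L ?f = 0"
    then have "AE z in ?L. ?f z = 0"
      by (subst (asm) integral_nonneg_eq_0_iff_AE [OF int]) (auto intro!: divide_nonneg_nonneg)
    then have ae: "AE z in ?L. z \<notin> {z. 0 < z $ i \<and> z $ i < 1}"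
    proof eventually_elim
      case (elim z)
      show ?case
      proof
        assume "z \<in> {z. 0 < z $ i \<and> z $ i < 1}"
        then have z: "0 < z $ i" "z $ i < 1" "z \<noteq> 0" by auto
        then have "cos (z $ i) < cos 0" using pi_gt3 by (intro cos_monotone_0_pi) auto
        with elim z show False by simp
      qed
    qed
    have op: "open {z :: real^'n. 0 < z $ i \<and> z $ i < 1}"
      by (intro open_Collect_conj open_Collect_less continuous_intros)
    then have "{z :: real^'n. 0 < z $ i \<and> z $ i < 1} \<in> null_sets ?L"
      using ae by (subst (asm) AE_iff_null_sets [symmetric]) auto
    then have "negligible {z :: real^'n. 0 < z $ i \<and> z $ i < 1}"
      by (simp add: negligible_iff_null_sets null_sets_completionI)
    moreover have "(\<chi> j. 1/2) \<in> {z :: real^'n. 0 < z $ i \<and> z $ i < 1}" by simp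
    ultimately show False using open_not_negligible [OF op] by blast
  qed
  moreover have "integral\<^sup>L ?L ?f \<ge> 0"
    by (intro Bochner_Integration.integral_nonneg) (auto intro!: divide_nonneg_nonneg)
  ultimately show ?thesis by (simp add: frac_const_def i_def less_le)
qed

text \<open>The Marchaud derivative of order \<open>s\<close> inverts the Weyl integral of order
  \<open>s\<close>: with \<phi> the tail integral of \<psi>, the difference \<open>K 0 - K h\<close>
  is the inner double integral of \<open>nn_integral_marchaud\<close>. Finiteness of
  \<open>K 0\<close> makes the truncated subtraction of \<open>ennreal\<close> a genuine
  one.\<close>

lemma nn_integral_marchaud_diff:
  fixes \<psi> :: "real \<Rightarrow> ennreal"
  assumes [measurable]: "\<psi> \<in> borel_measurable borel" and s: "0 < s" "s < 1"
  defines "\<phi> \<equiv> \<lambda>\<sigma>. weyl 1 \<psi> \<sigma>"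
  defines "K \<equiv> \<lambda>h. weyl s \<phi> h"
  assumes fin: "K 0 < \<infinity>"
  shows "(\<integral>\<^sup>+h. ennreal (pw (- s) h) * (K 0 - K h) \<partial>lborel) = ennreal (Beta (1 - s) s / s) * \<phi> 0"
    and "h > 0 \<Longrightarrow> K h \<le> K 0"
proof -
  have [measurable]: "\<phi> \<in> borel_measurable borel" unfolding \<phi>_def by measurable
  let ?J = "\<lambda>h. \<integral>\<^sup>+\<tau>. ennreal (pw s \<tau>) * (\<integral>\<^sup>+r. indicator {0<..<h} r * \<psi> (\<tau> + r) \<partial>lborel) \<partial>lborel"
  \<comment> \<open>\<open>pw 1\<close> is the indicator of the positive half-line, so \<phi> is a
    tail integral and can be split at distance \<open>h\<close>.\<close>
  have \<phi>: "\<phi> \<tau> = (\<integral>\<^sup>+r. indicator {0<..<h} r * \<psi> (\<tau> + r) \<partial>lborel) + \<phi> (h + \<tau>)" if "h > 0" for h \<tau>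
  proof -
    have "\<phi> (h + \<tau>) = (\<integral>\<^sup>+r. ennreal (pw 1 (- h + 1 * r)) * \<psi> (h + \<tau> + (- h + 1 * r)) \<partial>lborel)"
      unfolding \<phi>_def by (subst nn_integral_real_affine [where t = "- h" and c = 1]) simp_all
    also have "\<dots> = (\<integral>\<^sup>+r. indicator {h<..} r * \<psi> (\<tau> + r) \<partial>lborel)"
      by (intro nn_integral_cong) (auto simp: pw_def indicator_def)
    finally have "(\<integral>\<^sup>+r. indicator {0<..<h} r * \<psi> (\<tau> + r) \<partial>lborel) + \<phi> (h + \<tau>)
        = (\<integral>\<^sup>+r. indicator {0<..<h} r * \<psi> (\<tau> + r) + indicator {h<..} r * \<psi> (\<tau> + r) \<partial>lborel)"
      by (simp add: nn_integral_add)
    also have "\<dots> = \<phi> \<tau>"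
      unfolding \<phi>_def
    proof (rule nn_integral_cong_AE)
      show "AE r in lborel. indicator {0<..<h} r * \<psi> (\<tau> + r) + indicator {h<..} r * \<psi> (\<tau> + r) = ennreal (pw 1 r) * \<psi> (\<tau> + r)"
        using AE_lborel_singleton [of h] by eventually_elim (use that in \<open>auto simp: pw_def indicator_def\<close>)
    qed
    finally show ?thesis by simp
  qed
  have K: "K 0 = ?J h + K h" if "h > 0" for h
  proof -
    have "K 0 = (\<integral>\<^sup>+\<tau>. ennreal (pw s \<tau>) * (\<integral>\<^sup>+r. indicator {0<..<h} r * \<psi> (\<tau> + r) \<partial>lborel) + ennreal (pw s \<tau>) * \<phi> (h + \<tau>) \<partial>lborel)"
      unfolding K_def by (subst \<phi> [OF that]) (simp add: distrib_left)
    also have "\<dots> = ?J h + K h" unfolding K_def by (rule nn_integral_add) measurable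
    finally show ?thesis .
  qed
  show le: "K h \<le> K 0" if "h > 0" for h
    using K [OF that] by simp
  have "(\<integral>\<^sup>+h. ennreal (pw (- s) h) * (K 0 - K h) \<partial>lborel) = (\<integral>\<^sup>+h. ennreal (pw (- s) h) * ?J h \<partial>lborel)"
  proof (rule nn_integral_cong)
    fix h :: real
    show "ennreal (pw (- s) h) * (K 0 - K h) = ennreal (pw (- s) h) * ?J h"
    proof (cases "h > 0")
      case True
      have "K h \<noteq> top" using le [OF True] fin by (auto simp: top_unique)
      then show ?thesis by (simp add: K [OF True])
    qed (simp add: pw_def)
  qed
  also have "\<dots> = ennreal (Beta (1 - s) s / s) * \<phi> 0"
    unfolding \<phi>_def using nn_integral_marchaud [OF assms(1) s] by simp
  finally show "(\<integral>\<^sup>+h. ennreal (pw (- s) h) * (K 0 - K h) \<partial>lborel) = ennreal (Beta (1 - s) s / s) * \<phi> 0" .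
qed


lemma Fubini_pw_shift:
  fixes \<psi> :: "real \<Rightarrow> ennreal"
  assumes [measurable]: "\<psi> \<in> borel_measurable borel"
  shows "weyl k (weyl m \<psi>) \<sigma>
       = weyl m (weyl k \<psi>) \<sigma>"
proof -
  have "weyl k (weyl m \<psi>) \<sigma>
      = (\<integral>\<^sup>+r. (\<integral>\<^sup>+b. ennreal (pw k r) * (ennreal (pw m b) * \<psi> (\<sigma> + r + b)) \<partial>lborel) \<partial>lborel)"
    by (simp add: nn_integral_cmult)
  also have "\<dots> = (\<integral>\<^sup>+b. (\<integral>\<^sup>+r. ennreal (pw k r) * (ennreal (pw m b) * \<psi> (\<sigma> + r + b)) \<partial>lborel) \<partial>lborel)"
    by (rule lborel_pair.Fubini') measurable
  also have "\<dots> = (\<integral>\<^sup>+b. (\<integral>\<^sup>+r. ennreal (pw m b) * (ennreal (pw k r) * \<psi> (\<sigma> + b + r)) \<partial>lborel) \<partial>lborel)"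
    by (simp add: mult.left_commute add.commute add.left_commute)
  also have "\<dots> = weyl m (weyl k \<psi>) \<sigma>"
    by (simp add: nn_integral_cmult)
  finally show ?thesis .
qed

text \<open>A decreasing F tending to 0 is the tail integral of f, so for g = s the preceding
  inversion applies with \<psi> = f. For g > s the Weyl integral of order g factors, up to
  \<open>Beta (g - s) s\<close>, into orders s and g - s; the inner one is moved onto f, and the
  inversion removes the outer one.\<close>

lemma has_bochner_integral_marchaud:
  fixes F f :: "real \<Rightarrow> real"
  assumes s: "0 < s" "s < 1" "s \<le> g" and a: "a > 0"
    and [measurable]: "f \<in> borel_measurable borel" "F \<in> borel_measurable borel"
    and deriv: "\<And>t. t > 0 \<Longrightarrow> (F has_real_derivative - f t) (at t)"
    and f_nonneg: "\<And>t. t > 0 \<Longrightarrow> f t \<ge> 0" and F_nonneg: "\<And>t. F t \<ge> 0" and lim: "(F \<longlongrightarrow> 0) at_top"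
    and int: "\<And>a. a > 0 \<Longrightarrow> integrable lborel (\<lambda>\<tau>. pw g \<tau> * F (a + \<tau>))"
    and int': "g > s \<Longrightarrow> integrable lborel (\<lambda>\<tau>. pw (g - s) \<tau> * F (a + \<tau>))"
  defines "K \<equiv> \<lambda>a. \<integral>\<tau>. pw g \<tau> * F (a + \<tau>) \<partial>lborel"
  shows "has_bochner_integral lborel (\<lambda>h. pw (- s) h * (K a - K (a + h)))
     (if g = s then Beta (1 - s) s / s * F a
      else Beta (1 - s) s / (s * Beta (g - s) s) * (\<integral>\<tau>. pw (g - s) \<tau> * F (a + \<tau>) \<partial>lborel))"
proof -
  define \<psi> where "\<psi> \<sigma> = ennreal (f (a + \<sigma>))" for \<sigma>
  have [measurable]: "\<psi> \<in> borel_measurable borel" unfolding \<psi>_def by measurable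
  have \<psi>: "weyl 1 \<psi> \<sigma> = ennreal (F (a + \<sigma>))" if "\<sigma> \<ge> 0" for \<sigma>
  proof -
    have "weyl 1 \<psi> \<sigma>
       = (\<integral>\<^sup>+r. ennreal (pw 1 (- (a + \<sigma>) + 1 * r)) * \<psi> (\<sigma> + (- (a + \<sigma>) + 1 * r)) \<partial>lborel)"
      by (subst nn_integral_real_affine [where t = "- (a + \<sigma>)" and c = 1]) simp_all
    also have "\<dots> = (\<integral>\<^sup>+r. ennreal (f r) * indicator {a + \<sigma>..} r \<partial>lborel)"
    proof (rule nn_integral_cong_AE)
      show "AE r in lborel. ennreal (pw 1 (- (a + \<sigma>) + 1 * r)) * \<psi> (\<sigma> + (- (a + \<sigma>) + 1 * r)) = ennreal (f r) * indicator {a + \<sigma>..} r"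
        using AE_lborel_singleton [of "a + \<sigma>"] by eventually_elim (auto simp: pw_def indicator_def \<psi>_def)
    qed
    also have "\<dots> = ennreal (- 0 - (- F (a + \<sigma>)))"
    proof (rule nn_integral_FTC_atLeast)
      show "((\<lambda>x. - F x) has_real_derivative f x) (at x)" if "a + \<sigma> \<le> x" for x
        using DERIV_minus [OF deriv [of x]] that \<open>\<sigma> \<ge> 0\<close> a by simp
      show "((\<lambda>x. - F x) \<longlongrightarrow> - 0) at_top" by (intro tendsto_minus lim)
    qed (use that a f_nonneg in auto)
    finally show ?thesis by simp
  qed
  have nnK: "weyl g (\<lambda>t. ennreal (F t)) b = ennreal (K b)" if "b > 0" for b
    unfolding K_def using nn_integral_eq_integral [OF int [OF that]] F_nonneg by (simp add: ennreal_mult)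
  have K_nonneg: "K b \<ge> 0" for b
    unfolding K_def using F_nonneg by (intro Bochner_Integration.integral_nonneg) auto
  have B: "Beta (1 - s) s > 0" using s by (intro Beta_real_pos) auto
  let ?I = "(\<integral>\<^sup>+h. ennreal (pw (- s) h) * (ennreal (K a) - ennreal (K (a + h))) \<partial>lborel)"
  let ?R = "if g = s then Beta (1 - s) s / s * F a
      else Beta (1 - s) s / (s * Beta (g - s) s) * (\<integral>\<tau>. pw (g - s) \<tau> * F (a + \<tau>) \<partial>lborel)"
  have "K (a + h) \<le> K a \<and> ?I = ennreal ?R" if "h > 0" for h
  proof (cases "g = s")
    case True
    have K': "weyl s (weyl 1 \<psi>) h = ennreal (K (a + h))" if "h \<ge> 0" for h
    proof -
      have "weyl s (weyl 1 \<psi>) h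
          = weyl g (\<lambda>t. ennreal (F t)) (a + h)"
      proof (rule nn_integral_cong)
        fix \<tau> :: real
        show "ennreal (pw s \<tau>) * weyl 1 \<psi> (h + \<tau>) = ennreal (pw g \<tau>) * ennreal (F (a + h + \<tau>))"
          using \<psi> [of "h + \<tau>"] that True by (cases "\<tau> > 0") (simp_all add: pw_def add.assoc)
      qed
      then show ?thesis using nnK [of "a + h"] a that by simp
    qed
    note M = nn_integral_marchaud_diff [OF \<open>\<psi> \<in> borel_measurable borel\<close> s(1,2)]
    have "?I = ennreal (Beta (1 - s) s / s) * ennreal (F a)"
    proof -
      let ?KK = "\<lambda>h. weyl s (weyl 1 \<psi>) h"
      have "?I = (\<integral>\<^sup>+h. ennreal (pw (- s) h) * (?KK 0 - ?KK h) \<partial>lborel)"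
      proof (rule nn_integral_cong)
        fix h :: real
        show "ennreal (pw (- s) h) * (ennreal (K a) - ennreal (K (a + h))) = ennreal (pw (- s) h) * (?KK 0 - ?KK h)"
          using K' [of h] K' [of 0] by (cases "h > 0") (simp_all add: pw_def)
      qed
      also have "\<dots> = ennreal (Beta (1 - s) s / s) * weyl 1 \<psi> 0"
        using K' [of 0] by (intro M(1)) simp
      finally show ?thesis using \<psi> [of 0] by simp
    qed
    moreover have "K (a + h) \<le> K a"
      using M(2) [of h] K' [of 0] K' [of h] that K_nonneg by (auto simp: ennreal_le_iff)
    ultimately show ?thesis using True B s F_nonneg by (simp add: ennreal_mult' [symmetric])
  next
    case False
    define m where "m = g - s"
    have m: "m > 0" "m + s = g" using False s by (auto simp: m_def)
    define \<psi>' where "\<psi>' \<sigma> = weyl m \<psi> \<sigma>" for \<sigma>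
    have [measurable]: "\<psi>' \<in> borel_measurable borel" unfolding \<psi>'_def by measurable
    have \<psi>': "weyl 1 \<psi>' \<sigma> = (\<integral>\<^sup>+b. ennreal (pw m b) * ennreal (F (a + \<sigma> + b)) \<partial>lborel)" if "\<sigma> \<ge> 0" for \<sigma>
    proof -
      have "weyl 1 \<psi>' \<sigma> = weyl m (weyl 1 \<psi>) \<sigma>"
        unfolding \<psi>'_def by (rule Fubini_pw_shift) simp
      also have "\<dots> = (\<integral>\<^sup>+b. ennreal (pw m b) * ennreal (F (a + \<sigma> + b)) \<partial>lborel)"
      proof (rule nn_integral_cong)
        fix b :: real
        show "ennreal (pw m b) * weyl 1 \<psi> (\<sigma> + b) = ennreal (pw m b) * ennreal (F (a + \<sigma> + b))"
          using \<psi> [of "\<sigma> + b"] that by (cases "b > 0") (simp_all add: pw_def add.assoc)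
      qed
      finally show ?thesis .
    qed
    have Bm: "Beta m s > 0" using s m by (intro Beta_real_pos) auto
    have K': "weyl s (weyl 1 \<psi>') h = ennreal (Beta m s) * ennreal (K (a + h))" if "h \<ge> 0" for h
    proof -
      have "weyl s (weyl 1 \<psi>') h
        = (\<integral>\<^sup>+\<tau>. ennreal (pw s \<tau>) * (\<integral>\<^sup>+b. ennreal (pw m b) * ennreal (F ((a + h) + \<tau> + b)) \<partial>lborel) \<partial>lborel)"
      proof (rule nn_integral_cong)
        fix \<tau> :: real
        show "ennreal (pw s \<tau>) * weyl 1 \<psi>' (h + \<tau>)
          = ennreal (pw s \<tau>) * (\<integral>\<^sup>+b. ennreal (pw m b) * ennreal (F ((a + h) + \<tau> + b)) \<partial>lborel)"
          using \<psi>' [of "h + \<tau>"] that by (cases "\<tau> > 0") (simp_all add: pw_def add.assoc)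
      qed
      also have "\<dots> = (\<integral>\<^sup>+b. ennreal (pw m b) * (\<integral>\<^sup>+\<tau>. ennreal (pw s \<tau>) * ennreal (F ((a + h) + (b + \<tau>))) \<partial>lborel) \<partial>lborel)"
        by (subst Fubini_pw_shift) (simp_all add: add_ac)
      also have "\<dots> = ennreal (Beta m s) * (\<integral>\<^sup>+\<sigma>. ennreal (pw (m + s) \<sigma>) * ennreal (F ((a + h) + \<sigma>)) \<partial>lborel)"
        using s m by (intro nn_integral_pw_conv) auto
      also have "\<dots> = ennreal (Beta m s) * ennreal (K (a + h))"
        using a that by (simp add: m(2) nnK)
      finally show ?thesis .
    qed
    let ?J = "(\<integral>\<^sup>+h. ennreal (pw (- s) h) * (ennreal (Beta m s) * ennreal (K a) - ennreal (Beta m s) * ennreal (K (a + h))) \<partial>lborel)"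
    note M = nn_integral_marchaud_diff [OF \<open>\<psi>' \<in> borel_measurable borel\<close> s(1,2)]
    have Q: "(\<integral>\<^sup>+b. ennreal (pw m b) * ennreal (F (a + b)) \<partial>lborel) = ennreal (\<integral>\<tau>. pw m \<tau> * F (a + \<tau>) \<partial>lborel)"
      using nn_integral_eq_integral [OF int'] s False F_nonneg by (simp add: ennreal_mult m_def)
    have "?J = ennreal (Beta (1 - s) s / s) * ennreal (\<integral>\<tau>. pw m \<tau> * F (a + \<tau>) \<partial>lborel)"
    proof -
      let ?KK = "\<lambda>h. weyl s (weyl 1 \<psi>') h"
      have "?J = (\<integral>\<^sup>+h. ennreal (pw (- s) h) * (?KK 0 - ?KK h) \<partial>lborel)"
      proof (rule nn_integral_cong)
        fix h :: real
        show "ennreal (pw (- s) h) * (ennreal (Beta m s) * ennreal (K a) - ennreal (Beta m s) * ennreal (K (a + h))) = ennreal (pw (- s) h) * (?KK 0 - ?KK h)"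
          using K' [of h] K' [of 0] by (cases "h > 0") (simp_all add: pw_def)
      qed
      also have "\<dots> = ennreal (Beta (1 - s) s / s) * weyl 1 \<psi>' 0"
        using K' [of 0] by (intro M(1)) (simp add: ennreal_mult_less_top)
      finally show ?thesis using \<psi>' [of 0] Q by simp
    qed
    also have "?J = (\<integral>\<^sup>+h. ennreal (Beta m s) * (ennreal (pw (- s) h) * (ennreal (K a) - ennreal (K (a + h)))) \<partial>lborel)"
    proof (rule nn_integral_cong)
      fix h :: real
      have "ennreal (Beta m s) * ennreal (K a) - ennreal (Beta m s) * ennreal (K (a + h)) = ennreal (Beta m s * (K a - K (a + h)))"
        using Bm K_nonneg by (simp add: ennreal_mult [symmetric] ennreal_minus right_diff_distrib)
      also have "\<dots> = ennreal (Beta m s) * (ennreal (K a) - ennreal (K (a + h)))"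
        using Bm K_nonneg by (simp add: ennreal_mult' ennreal_minus)
      finally show "ennreal (pw (- s) h) * (ennreal (Beta m s) * ennreal (K a) - ennreal (Beta m s) * ennreal (K (a + h)))
        = ennreal (Beta m s) * (ennreal (pw (- s) h) * (ennreal (K a) - ennreal (K (a + h))))"
        by (simp add: mult.left_commute)
    qed
    also have "\<dots> = ennreal (Beta m s) * ?I"
      unfolding K_def by (rule nn_integral_cmult) measurable
    finally have "ennreal (Beta m s) * ?I
       = ennreal (Beta (1 - s) s / s) * ennreal (\<integral>\<tau>. pw m \<tau> * F (a + \<tau>) \<partial>lborel)" .
    \<comment> \<open>Multiplication by the reciprocal replaces cancellation of the common factor
      \<open>Beta m s\<close> in \<open>ennreal\<close>.\<close>
    then have "ennreal (1 / Beta m s) * (ennreal (Beta m s) * ?I)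
       = ennreal (1 / Beta m s) * (ennreal (Beta (1 - s) s / s) * ennreal (\<integral>\<tau>. pw m \<tau> * F (a + \<tau>) \<partial>lborel))"
      by simp
    moreover have "(\<integral>\<tau>. pw m \<tau> * F (a + \<tau>) \<partial>lborel) \<ge> 0"
      using F_nonneg by (intro Bochner_Integration.integral_nonneg) auto
    ultimately have "?I = ennreal ?R"
      using False Bm B s by (simp add: mult.assoc [symmetric] ennreal_mult' [symmetric] m_def [symmetric])
    moreover have "K (a + h) \<le> K a"
      using M(2) [of h] K' [of 0] K' [of h] that K_nonneg Bm
      by (auto simp: ennreal_le_iff ennreal_mult' [symmetric] ennreal_mult_less_top)
    ultimately show ?thesis by blast
  qed
  then have mono: "\<And>h. h > 0 \<Longrightarrow> K (a + h) \<le> K a" and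
    I: "?I = ennreal ?R"
    using zero_less_one by blast+
  have R: "?R \<ge> 0"
    using F_nonneg B s Beta_real_pos [of "g - s" s] by (auto intro!: mult_nonneg_nonneg divide_nonneg_nonneg Bochner_Integration.integral_nonneg)
  have nonneg: "0 \<le> pw (- s) h * (K a - K (a + h))" for h
    using mono [of h] by (cases "h > 0") (auto simp: pw_def)
  have "(\<integral>\<^sup>+h. ennreal (pw (- s) h * (K a - K (a + h))) \<partial>lborel) = ennreal ?R"
    unfolding I [symmetric] using K_nonneg by (intro nn_integral_cong) (simp add: ennreal_mult' ennreal_minus)
  moreover have "(\<lambda>h. pw (- s) h * (K a - K (a + h))) \<in> borel_measurable lborel"
    unfolding K_def by measurable
  ultimately show ?thesis
    using R nonneg by (intro has_bochner_integral_nn_integral) auto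
qed

section \<open>The fractional Laplacian of a potential\<close>

lemma integrable_pw_shift:
  assumes "0 < g" "g < \<theta>" "a > 0" and [measurable]: "F \<in> borel_measurable borel"
    and "\<And>t. t > 0 \<Longrightarrow> \<bar>F t\<bar> \<le> C * t powr (- \<theta>)"
  shows "integrable lborel (\<lambda>\<tau>. pw g \<tau> * F (a + \<tau>))"
proof (rule Bochner_Integration.integrable_bound)
  obtain D where "(\<integral>\<^sup>+\<tau>. ennreal (pw g \<tau>) * ennreal ((\<tau> + a) powr (- \<theta>)) \<partial>lborel) = ennreal (D * a powr (g - \<theta>))"
    using nn_integral_pw_shift [OF assms(1,2)] assms(3) by blast
  then have "(\<integral>\<^sup>+\<tau>. ennreal (pw g \<tau> * (\<tau> + a) powr (- \<theta>)) \<partial>lborel) < \<infinity>"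
    by (simp add: ennreal_mult)
  then have "integrable lborel (\<lambda>\<tau>. pw g \<tau> * (\<tau> + a) powr (- \<theta>))"
    by (intro integrableI_nonneg) auto
  then show "integrable lborel (\<lambda>\<tau>. C * (pw g \<tau> * (\<tau> + a) powr (- \<theta>)))"
    by (rule integrable_mult_right)
  show "AE \<tau> in lborel. norm (pw g \<tau> * F (a + \<tau>)) \<le> norm (C * (pw g \<tau> * (\<tau> + a) powr (- \<theta>)))"
  proof (rule AE_I2)
    fix \<tau> :: real
    show "norm (pw g \<tau> * F (a + \<tau>)) \<le> norm (C * (pw g \<tau> * (\<tau> + a) powr (- \<theta>)))"
    proof (cases "\<tau> > 0")
      case True
      have "pw g \<tau> * \<bar>F (a + \<tau>)\<bar> \<le> pw g \<tau> * (C * (\<tau> + a) powr (- \<theta>))"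
        using assms(5) [of "a + \<tau>"] assms(3) True by (intro mult_left_mono) (auto simp: add_ac)
      also have "\<dots> = C * (pw g \<tau> * (\<tau> + a) powr (- \<theta>))" by (rule mult.left_commute)
      also have "\<dots> \<le> \<bar>C * (pw g \<tau> * (\<tau> + a) powr (- \<theta>))\<bar>" by (rule abs_ge_self)
      finally show ?thesis by (simp add: abs_mult)
    qed (simp add: pw_def)
  qed
qed measurable

text \<open>For x \<noteq> 0 the map t -> \<open>heat t x\<close> first increases and then
  decreases, so the preceding lemma does not apply to it. It is the difference of A, its value at x
  = 0, and D = A - \<open>heat\<close>; both are decreasing, tend to 0 and are bounded by a multiple
  of t^(-n/2), and the results are subtracted.\<close>

lemma marchaud_pot:
  assumes s: "0 < s" "s < 1" "s \<le> g" "g < real CARD('n) / 2"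
  shows "\<exists>c>0. \<forall>a>0. \<forall>x :: real^'n::finite.
    has_bochner_integral lborel (\<lambda>h. pw (- s) h * (pot g a x - pot g (a + h) x))
      (c * (if g = s then heat a x else pot (g - s) a x))"
proof -
  define \<nu> where "\<nu> = real CARD('n) / 2"
  have \<nu>: "\<nu> > 0" "g < \<nu>" using s by (auto simp: \<nu>_def)
  define c where "c = (if g = s then Beta (1 - s) s / s else Beta (1 - s) s / (s * Beta (g - s) s))"
  have c: "c > 0" using s Beta_real_pos [of "1 - s" s] Beta_real_pos [of "g - s" s] by (auto simp: c_def)
  have "has_bochner_integral lborel (\<lambda>h. pw (- s) h * (pot g a x - pot g (a + h) x))
      (c * (if g = s then heat a x else pot (g - s) a x))" if a: "a > 0" for a and x :: "real^'n"
  proof -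
    define y where "y = (norm x)\<^sup>2 / 2"
    have y: "y \<ge> 0" by (simp add: y_def)
    define A where "A t = (2 * pi * t) powr (- \<nu>)" for t
    define q where "q t = t powr (- 1)" for t :: real
    \<comment> \<open>D decreases as a product of two nonnegative decreasing factors, since 1 - exp
      (-y/t) decreases in t.\<close>
    define D where "D t = A t * (1 - exp (- (y * q t)))" for t
    define fA where "fA t = 2 * pi * \<nu> * (2 * pi * t) powr (- \<nu> - 1)" for t
    define fD where "fD t = fA t * (1 - exp (- (y * q t))) + A t * (exp (- (y * q t)) * (y * t powr (- 2)))" for t
    have [measurable]: "A \<in> borel_measurable borel" "D \<in> borel_measurable borel" "fA \<in> borel_measurable borel" "fD \<in> borel_measurable borel"
      unfolding A_def D_def fA_def fD_def q_def by measurable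
    have A0: "A t \<ge> 0" for t by (simp add: A_def)
    have D0: "D t \<ge> 0" "D t \<le> A t" for t
      using y by (auto simp: D_def A0 q_def intro!: mult_nonneg_nonneg mult_left_le)
    have dA: "(A has_real_derivative - fA t) (at t)" if "t > 0" for t
      unfolding A_def fA_def using that by (auto intro!: derivative_eq_intros)
    have dD: "(D has_real_derivative - fD t) (at t)" if "t > 0" for t
    proof -
      have dq: "(q has_real_derivative - (t powr (- 2))) (at t)"
        unfolding q_def using has_real_derivative_powr [OF that, of "- 1"] by simp
      show ?thesis
        unfolding D_def fD_def using that by (auto intro!: derivative_eq_intros dA dq simp: algebra_simps)
    qed
    have limA: "(A \<longlongrightarrow> 0) at_top"
    proof -
      have "((\<lambda>t. (2 * pi) powr (- \<nu>) * t powr (- \<nu>)) \<longlongrightarrow> (2 * pi) powr (- \<nu>) * 0) at_top"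
        using \<nu> by (intro tendsto_intros tendsto_neg_powr filterlim_ident) auto
      moreover have "A = (\<lambda>t. (2 * pi) powr (- \<nu>) * t powr (- \<nu>))"
        unfolding A_def by (simp add: fun_eq_iff powr_mult)
      ultimately show ?thesis by simp
    qed
    have limD: "(D \<longlongrightarrow> 0) at_top"
      by (rule tendsto_sandwich [OF _ _ tendsto_const limA]) (simp_all add: D0)
    have bA: "\<bar>A t\<bar> \<le> (2 * pi) powr (- \<nu>) * t powr (- \<nu>)" for t
      by (simp add: A_def powr_mult)
    have bD: "\<bar>D t\<bar> \<le> (2 * pi) powr (- \<nu>) * t powr (- \<nu>)" for t
      using bA [of t] D0 [of t] by simp
    have fA0: "fA t \<ge> 0" for t using \<nu> by (simp add: fA_def)
    have fD0: "fD t \<ge> 0" for t using y fA0 A0 by (simp add: fD_def q_def)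
    have iA: "integrable lborel (\<lambda>\<tau>. pw k \<tau> * A (b + \<tau>))" and iD: "integrable lborel (\<lambda>\<tau>. pw k \<tau> * D (b + \<tau>))"
      if "0 < k" "k \<le> g" "b > 0" for k b
      using integrable_pw_shift [of k \<nu> b A "(2 * pi) powr (- \<nu>)"] integrable_pw_shift [of k \<nu> b D "(2 * pi) powr (- \<nu>)"]
        that \<nu> bA bD by auto
    have heat: "heat t x = A t - D t" if "t > 0" for t
    proof -
      have "y * q t = (norm x)\<^sup>2 / (2 * t)" using that by (simp add: y_def q_def powr_minus_divide)
      then show ?thesis by (simp add: heat_def A_def D_def \<nu>_def algebra_simps)
    qed
    have pot: "pot k b x = (\<integral>\<tau>. pw k \<tau> * A (b + \<tau>) \<partial>lborel) - (\<integral>\<tau>. pw k \<tau> * D (b + \<tau>) \<partial>lborel)"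
      if "0 < k" "k \<le> g" "b > 0" for k b
    proof -
      have "pot k b x = (\<integral>\<tau>. pw k \<tau> * A (b + \<tau>) - pw k \<tau> * D (b + \<tau>) \<partial>lborel)"
        unfolding pot_def using that
        by (intro Bochner_Integration.integral_cong refl) (auto simp: pw_def heat algebra_simps)
      also have "\<dots> = (\<integral>\<tau>. pw k \<tau> * A (b + \<tau>) \<partial>lborel) - (\<integral>\<tau>. pw k \<tau> * D (b + \<tau>) \<partial>lborel)"
        using that by (intro Bochner_Integration.integral_diff iA iD)
      finally show ?thesis .
    qed
    define KA where "KA b = (\<integral>\<tau>. pw g \<tau> * A (b + \<tau>) \<partial>lborel)" for b
    define KD where "KD b = (\<integral>\<tau>. pw g \<tau> * D (b + \<tau>) \<partial>lborel)" for b
    let ?RA = "if g = s then Beta (1 - s) s / s * A a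
      else Beta (1 - s) s / (s * Beta (g - s) s) * (\<integral>\<tau>. pw (g - s) \<tau> * A (a + \<tau>) \<partial>lborel)"
    let ?RD = "if g = s then Beta (1 - s) s / s * D a
      else Beta (1 - s) s / (s * Beta (g - s) s) * (\<integral>\<tau>. pw (g - s) \<tau> * D (a + \<tau>) \<partial>lborel)"
    have 1: "has_bochner_integral lborel (\<lambda>h. pw (- s) h * (KA a - KA (a + h))) ?RA"
      unfolding KA_def
      using s a by (intro has_bochner_integral_marchaud [where f = fA] dA fA0 A0 limA iA) auto
    have 2: "has_bochner_integral lborel (\<lambda>h. pw (- s) h * (KD a - KD (a + h))) ?RD"
      unfolding KD_def
      using s a by (intro has_bochner_integral_marchaud [where f = fD] dD fD0 D0 limD iD) auto
    have "(\<lambda>h. pw (- s) h * (KA a - KA (a + h)) - pw (- s) h * (KD a - KD (a + h)))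
        = (\<lambda>h. pw (- s) h * (pot g a x - pot g (a + h) x))"
    proof
      fix h :: real
      show "pw (- s) h * (KA a - KA (a + h)) - pw (- s) h * (KD a - KD (a + h)) = pw (- s) h * (pot g a x - pot g (a + h) x)"
      proof (cases "h > 0")
        case True
        have "pot g a x = KA a - KD a" "pot g (a + h) x = KA (a + h) - KD (a + h)"
          unfolding KA_def KD_def using a s True by (auto intro!: pot)
        then show ?thesis by (simp only:) (simp add: algebra_simps)
      qed (simp add: pw_def)
    qed
    moreover have "?RA - ?RD = c * (if g = s then heat a x else pot (g - s) a x)"
    proof (cases "g = s")
      case True
      then show ?thesis using heat [OF a] by (simp add: c_def right_diff_distrib diff_divide_distrib)
    next
      case False
      then show ?thesis using pot [of "g - s" a] s a by (simp add: c_def right_diff_distrib diff_divide_distrib)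
    qed
    ultimately show ?thesis using has_bochner_integral_diff [OF 1 2] by simp
  qed
  with c show ?thesis by blast
qed

section \<open>Principal values as absolutely convergent integrals of second differences\<close>

lemma lborel_distr_reflect: "distr lborel borel (\<lambda>z. x - z) = (lborel :: (real^'n::finite) measure)"
proof -
  show ?thesis
    using lborel_affine [of "- 1" x] by (simp add: density_1)
qed

lemma
  fixes f :: "real^'n::finite \<Rightarrow> real"
  assumes [measurable]: "f \<in> borel_measurable borel"
  shows integral_translate: "(\<integral>y. f y \<partial>lborel) = (\<integral>z. f (x + z) \<partial>lborel)"
    and integral_reflect: "(\<integral>y. f y \<partial>lborel) = (\<integral>z. f (x - z) \<partial>lborel)"
    and integrable_translate_iff: "integrable lborel f \<longleftrightarrow> integrable lborel (\<lambda>z. f (x + z))"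
    and integrable_reflect_iff: "integrable lborel f \<longleftrightarrow> integrable lborel (\<lambda>z. f (x - z))"
proof -
  show "(\<integral>y. f y \<partial>lborel) = (\<integral>z. f (x + z) \<partial>lborel)"
    by (subst lborel_distr_plus [of x, symmetric], subst integral_distr) auto
  show "(\<integral>y. f y \<partial>lborel) = (\<integral>z. f (x - z) \<partial>lborel)"
    by (subst lborel_distr_reflect [of x, symmetric], subst integral_distr) auto
  show "integrable lborel f \<longleftrightarrow> integrable lborel (\<lambda>z. f (x + z))"
    by (subst lborel_distr_plus [of x, symmetric], subst integrable_distr_eq) auto
  show "integrable lborel f \<longleftrightarrow> integrable lborel (\<lambda>z. f (x - z))"
    by (subst lborel_distr_reflect [of x, symmetric], subst integrable_distr_eq) auto
qed

text \<open>The sign is that of the operator, nonnegative at a maximum. The linear Taylor terms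
  cancel, so for smooth bounded \<open>f\<close> this is O(min 1 |z|^2), which is integrable against
  the kernel without a principal value.\<close>

definition second_diff :: "(real^'n::finite \<Rightarrow> real) \<Rightarrow> real^'n \<Rightarrow> real^'n \<Rightarrow> real" where
  "second_diff f x z = 2 * f x - f (x + z) - f (x - z)"

lemma integrable_frac_kernel:
  fixes f :: "real^'n::finite \<Rightarrow> real"
  assumes s: "0 < s" "s < 1" and [measurable]: "f \<in> borel_measurable borel"
    and C: "\<And>z. \<bar>f z\<bar> \<le> C * min 1 ((norm z)\<^sup>2)"
  shows "integrable lborel (\<lambda>z. f z * frac_kernel s z)"
proof (rule Bochner_Integration.integrable_bound)
  show "integrable (lborel :: (real^'n) measure) (\<lambda>z. C * (min 1 ((norm z)\<^sup>2) * frac_kernel s z))"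
    using integrable_min_kernel [OF s, where ?'n = 'n] by simp
  show "AE z in lborel. norm (f z * frac_kernel s z) \<le> norm (C * (min 1 ((norm z)\<^sup>2) * frac_kernel s z))"
  proof (rule AE_I2)
    fix z :: "real^'n"
    have "\<bar>f z\<bar> * frac_kernel s z \<le> (C * min 1 ((norm z)\<^sup>2)) * frac_kernel s z"
      by (intro mult_right_mono C) simp
    also have "\<dots> \<le> \<bar>C * (min 1 ((norm z)\<^sup>2) * frac_kernel s z)\<bar>"
      by (simp add: mult.assoc)
    finally show "norm (f z * frac_kernel s z) \<le> norm (C * (min 1 ((norm z)\<^sup>2) * frac_kernel s z))"
      by (simp add: abs_mult)
  qed
qed measurable

lemma local_quadratic_bound:
  fixes f :: "real^'n::finite \<Rightarrow> real"
  assumes r: "r > 0" and B: "\<And>z. norm z < r \<Longrightarrow> \<bar>f z\<bar> \<le> B * (norm z)\<^sup>2" and M: "\<And>z. \<bar>f z\<bar> \<le> M"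
  shows "\<exists>C. \<forall>z. \<bar>f z\<bar> \<le> C * min 1 ((norm z)\<^sup>2)"
proof -
  have M0: "M \<ge> 0" using M [of 0] by linarith
  define r' where "r' = min r 1"
  have r': "0 < r'" "r' \<le> r" "r' \<le> 1" using r by (auto simp: r'_def)
  define C where "C = max \<bar>B\<bar> (M / r'\<^sup>2)"
  have C: "C \<ge> 0" by (auto simp: C_def le_max_iff_disj)
  have "\<bar>f z\<bar> \<le> C * min 1 ((norm z)\<^sup>2)" for z
  proof (cases "norm z < r'")
    case True
    then have "\<bar>f z\<bar> \<le> B * (norm z)\<^sup>2" using B r' by simp
    also have "\<dots> \<le> C * (norm z)\<^sup>2" by (intro mult_right_mono) (auto simp: C_def)
    also have "(norm z)\<^sup>2 = min 1 ((norm z)\<^sup>2)" using True r' power_le_one [of "norm z" 2] by (simp add: min_def)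
    finally show ?thesis .
  next
    case False
    have "\<bar>f z\<bar> \<le> M / r'\<^sup>2 * r'\<^sup>2" using M r' by simp
    also have "\<dots> \<le> C * min 1 ((norm z)\<^sup>2)"
    proof (rule mult_mono)
      show "r'\<^sup>2 \<le> min 1 ((norm z)\<^sup>2)" using r' False power_le_one [of r' 2] by (simp add: power_mono)
    qed (use C in \<open>auto simp: C_def\<close>)
    finally show ?thesis .
  qed
  then show ?thesis by blast
qed

lemma integrable_kernel_off_ball:
  fixes f :: "real^'n::finite \<Rightarrow> real"
  assumes s: "0 < s" "s < 1" and [measurable]: "f \<in> borel_measurable borel"
    and M: "\<And>z. \<bar>f z\<bar> \<le> M" and e: "\<epsilon> > 0"
  shows "integrable lborel (\<lambda>z. indicator (- ball 0 \<epsilon>) z * (f z * frac_kernel s z))"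
proof -
  have "M \<ge> 0" using M [of 0] by linarith
  \<comment> \<open>The truncated function vanishes on the ball of radius \<epsilon>, so it
    satisfies the quadratic bound there with constant 0.\<close>
  have "\<exists>C. \<forall>z. \<bar>indicator (- ball 0 \<epsilon>) z * f z\<bar> \<le> C * min 1 ((norm z)\<^sup>2)"
    by (rule local_quadratic_bound [OF e, where B = 0 and M = M]) (use M \<open>M \<ge> 0\<close> in \<open>auto simp: indicator_def\<close>)
  then obtain C where "\<And>z. \<bar>indicator (- ball 0 \<epsilon>) z * f z\<bar> \<le> C * min 1 ((norm z)\<^sup>2)" by blast
  then have "integrable lborel (\<lambda>z. (indicator (- ball 0 \<epsilon>) z * f z) * frac_kernel s z)"
    by (intro integrable_frac_kernel [OF s]) auto
  then show ?thesis by (simp add: mult.assoc)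
qed

lemma tendsto_integral_off_ball:
  fixes D :: "real^'n::finite \<Rightarrow> real"
  assumes int: "integrable lborel D" and "D x = 0"
  shows "((\<lambda>\<epsilon>. \<integral>y. indicator (- ball x \<epsilon>) y * D y \<partial>lborel) \<longlongrightarrow> (\<integral>y. D y \<partial>lborel)) (at_right 0)"
proof (rule tendsto_at_right_sequentially [of 0 1])
  have [measurable]: "D \<in> borel_measurable borel" using int by auto
  fix S :: "nat \<Rightarrow> real" assume S: "\<And>n. 0 < S n" "S \<longlonglongrightarrow> 0"
  show "(\<lambda>n. \<integral>y. indicator (- ball x (S n)) y * D y \<partial>lborel) \<longlonglongrightarrow> (\<integral>y. D y \<partial>lborel)"
  proof (rule integral_dominated_convergence [where w = "\<lambda>y. \<bar>D y\<bar>"])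
    show "integrable lborel (\<lambda>y. \<bar>D y\<bar>)" using int by (rule integrable_abs)
    show "AE y in lborel. (\<lambda>n. indicator (- ball x (S n)) y * D y) \<longlonglongrightarrow> D y"
    proof (rule AE_I2)
      fix y
      show "(\<lambda>n. indicator (- ball x (S n)) y * D y) \<longlonglongrightarrow> D y"
      \<comment> \<open>At the centre the truncated integrand is 0 for every radius, and the limit
        is 0 there because \<open>D x = 0\<close>.\<close>
      proof (cases "y = x")
        case False
        then have "\<forall>\<^sub>F n in sequentially. S n < dist x y"
          using S(2) by (intro order_tendstoD) auto
        then have "\<forall>\<^sub>F n in sequentially. D y = indicator (- ball x (S n)) y * D y"
          by eventually_elim simp
        then show ?thesis by (rule Lim_transform_eventually [OF tendsto_const])
      qed (simp add: assms)
    qed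
  qed (auto simp: indicator_def)
qed simp

text \<open>Complements of balls around x are symmetric under y -> 2x - y, so each truncated
  integral is half the sum of its forms in x + z and x - z. The integrand becomes the second
  difference, and dominated convergence gives the limit.\<close>

lemma has_frac_laplacian_second_diff:
  fixes f :: "real^'n::finite \<Rightarrow> real"
  assumes s: "0 < s" "s < 1" and [measurable]: "f \<in> borel_measurable borel"
    and M: "\<And>y. \<bar>f y\<bar> \<le> M"
    and C: "\<And>z. \<bar>second_diff f x z\<bar> \<le> C * min 1 ((norm z)\<^sup>2)"
  shows "has_frac_laplacian s f x (frac_const TYPE('n) s *
     ((\<integral>z. second_diff f x z * frac_kernel s z \<partial>lborel) / 2))"
proof -
  let ?k = "\<lambda>z::real^'n. frac_kernel s z"
  define g where "g \<epsilon> y = indicator (- ball x \<epsilon>) y * ((f x - f y) * ?k (x - y))" for \<epsilon> y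
  have [measurable]: "g \<epsilon> \<in> borel_measurable borel" for \<epsilon> unfolding g_def by measurable
  have eq: "indicator (- ball x \<epsilon>) y *\<^sub>R ((f x - f y) / norm (x - y) powr (real CARD('n) + 2 * s)) = g \<epsilon> y" for \<epsilon> y
    unfolding g_def powr_minus by (simp add: divide_inverse)
  have ball: "x + z \<in> ball x \<epsilon> \<longleftrightarrow> z \<in> ball 0 \<epsilon>" "x - z \<in> ball x \<epsilon> \<longleftrightarrow> z \<in> ball 0 \<epsilon>" for z \<epsilon>
    by (simp_all add: dist_norm)
  have gp: "g \<epsilon> (x + z) = indicator (- ball 0 \<epsilon>) z * ((f x - f (x + z)) * ?k z)"
    and gm: "g \<epsilon> (x - z) = indicator (- ball 0 \<epsilon>) z * ((f x - f (x - z)) * ?k z)" for \<epsilon> z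
    unfolding g_def using ball [of z \<epsilon>] by (simp_all add: indicator_def)
  have bnd: "\<bar>f x - f y\<bar> \<le> 2 * M" for y
    using M [of x] M [of y] by linarith
  have ip: "integrable lborel (\<lambda>z. g \<epsilon> (x + z))" and im: "integrable lborel (\<lambda>z. g \<epsilon> (x - z))" if "\<epsilon> > 0" for \<epsilon>
    unfolding gp gm by (rule integrable_kernel_off_ball [OF s, where M = "2 * M"]; (rule bnd | rule that | measurable))+
  have int: "integrable lborel (g \<epsilon>)" if "\<epsilon> > 0" for \<epsilon>
    using integrable_translate_iff [of "g \<epsilon>" x] ip [OF that] by simp
  let ?T = "\<lambda>\<epsilon>. \<integral>z. indicator (- ball 0 \<epsilon>) z * (second_diff f x z * ?k z) \<partial>lborel"
  have val: "(\<integral>y. g \<epsilon> y \<partial>lborel) = ?T \<epsilon> / 2" if "\<epsilon> > 0" for \<epsilon>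
  proof -
    have "2 * (\<integral>y. g \<epsilon> y \<partial>lborel) = (\<integral>z. g \<epsilon> (x + z) \<partial>lborel) + (\<integral>z. g \<epsilon> (x - z) \<partial>lborel)"
      using integral_translate [of "g \<epsilon>" x] integral_reflect [of "g \<epsilon>" x] by simp
    also have "\<dots> = (\<integral>z. g \<epsilon> (x + z) + g \<epsilon> (x - z) \<partial>lborel)"
      using ip [OF that] im [OF that] by simp
    also have "\<dots> = ?T \<epsilon>"
      unfolding gp gm by (intro Bochner_Integration.integral_cong) (auto simp: second_diff_def algebra_simps indicator_def)
    finally show ?thesis by simp
  qed
  have sd [measurable]: "second_diff f x \<in> borel_measurable borel" unfolding second_diff_def by measurable
  have lim: "(?T \<longlongrightarrow> (\<integral>z. second_diff f x z * ?k z \<partial>lborel)) (at_right 0)"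
    by (intro tendsto_integral_off_ball integrable_frac_kernel [OF s sd C]) (simp add: second_diff_def)
  show ?thesis
    unfolding has_frac_laplacian_def set_integrable_def set_lebesgue_integral_def eq
  proof (intro conjI allI impI)
    show "integrable lborel (g \<epsilon>)" if "\<epsilon> > 0" for \<epsilon> by (rule int [OF that])
    have "((\<lambda>\<epsilon>. frac_const TYPE('n) s * (?T \<epsilon> / 2))
       \<longlongrightarrow> frac_const TYPE('n) s * ((\<integral>z. second_diff f x z * ?k z \<partial>lborel) / 2)) (at_right 0)"
      by (intro tendsto_intros lim) simp
    moreover have "\<forall>\<^sub>F \<epsilon> in at_right 0. frac_const TYPE('n) s * (?T \<epsilon> / 2)
        = frac_const TYPE('n) s * (\<integral>y. g \<epsilon> y \<partial>lborel)"
      using eventually_at_right_less [of "0::real"] by eventually_elim (simp add: val)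
    ultimately show "((\<lambda>\<epsilon>. frac_const TYPE('n) s * (\<integral>y. g \<epsilon> y \<partial>lborel)) \<longlongrightarrow> frac_const TYPE('n) s * ((\<integral>z. second_diff f x z * ?k z \<partial>lborel) / 2)) (at_right 0)"
      by (rule Lim_transform_eventually)
  qed
qed

text \<open>\<open>P h\<close> is the heat average of \<open>f\<close> at \<open>x\<close>.
  Inserting the mixture for the kernel and exchanging integrals leaves the integral of the second
  difference against \<open>heat h\<close>, which is 2 (f x - P h) as \<open>heat h\<close> is even
  with mass 1. The quadratic bound provides the absolute convergence that the exchange
  requires.\<close>

lemma integral_second_diff_heat:
  assumes s: "0 < s" "s < 1"
  shows "\<exists>c>0. \<forall>(f :: real^'n::finite \<Rightarrow> real) x M C P. f \<in> borel_measurable borel \<longrightarrow> (\<forall>y. \<bar>f y\<bar> \<le> M) \<longrightarrow>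
     (\<forall>z. \<bar>second_diff f x z\<bar> \<le> C * min 1 ((norm z)\<^sup>2)) \<longrightarrow>
     (\<forall>h>0. (\<integral>z. f (x + z) * heat h z \<partial>lborel) = P h) \<longrightarrow>
     (\<integral>z. second_diff f x z * frac_kernel s z \<partial>lborel) = c * (\<integral>h. pw (- s) h * (f x - P h) \<partial>lborel)"
proof -
  obtain c where c: "c > 0" "\<And>z :: real^'n. z \<noteq> 0 \<Longrightarrow>
    (\<integral>\<^sup>+h. ennreal (pw (- s) h) * ennreal (heat h z) \<partial>lborel) = ennreal (c * frac_kernel s z)"
    using nn_integral_heat_kernel [OF s(1), where ?'n = 'n] by blast
  have "(\<integral>z. second_diff f x z * frac_kernel s z \<partial>lborel) = (2 / c) * (\<integral>h. pw (- s) h * (f x - P h) \<partial>lborel)"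
    if [measurable]: "f \<in> borel_measurable borel" and M: "\<forall>y. \<bar>f y\<bar> \<le> M"
     and C: "\<forall>z. \<bar>second_diff f x z\<bar> \<le> C * min 1 ((norm z)\<^sup>2)"
     and P: "\<forall>h>0. (\<integral>z. f (x + z) * heat h z \<partial>lborel) = P h"
    for f :: "real^'n \<Rightarrow> real" and x M C P
  proof -
    let ?k = "\<lambda>z::real^'n. frac_kernel s z"
    have sd [measurable]: "second_diff f x \<in> borel_measurable borel" unfolding second_diff_def by measurable
    define g where "g z h = second_diff f x z * (pw (- s) h * heat h z)" for z h
    have inth: "has_bochner_integral lborel (\<lambda>h. pw (- s) h * heat h z) (c * ?k z)" if "z \<noteq> 0" for z :: "real^'n"
      using c(1) c(2) [OF that] by (intro has_bochner_integral_nn_integral) (auto simp: ennreal_mult)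
    have g1: "(\<integral>h. g z h \<partial>lborel) = c * (second_diff f x z * ?k z)" for z
    proof (cases "z = 0")
      case False
      then show ?thesis
        using has_bochner_integral_integral_eq [OF inth [OF False]] unfolding g_def by simp
    qed (simp add: g_def second_diff_def)
    have nn: "(\<integral>\<^sup>+h. ennreal (norm (g z h)) \<partial>lborel) = ennreal c * ennreal \<bar>second_diff f x z * ?k z\<bar>" for z
    proof (cases "z = 0")
      case False
      have "(\<integral>\<^sup>+h. ennreal (norm (g z h)) \<partial>lborel) = (\<integral>\<^sup>+h. ennreal \<bar>second_diff f x z\<bar> * (ennreal (pw (- s) h) * ennreal (heat h z)) \<partial>lborel)"
        by (intro nn_integral_cong) (simp add: g_def abs_mult ennreal_mult)
      also have "\<dots> = ennreal \<bar>second_diff f x z\<bar> * ennreal (c * ?k z)"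
        by (subst nn_integral_cmult) (simp_all add: c(2) [OF False])
      finally show ?thesis using c(1) by (simp add: ennreal_mult [symmetric] abs_mult mult_ac)
    qed (simp add: g_def second_diff_def)
    have int: "integrable (lborel \<Otimes>\<^sub>M lborel) (\<lambda>(z, h). g z h)"
    proof (rule integrableI_bounded)
      show "(\<lambda>(z, h). g z h) \<in> borel_measurable (lborel \<Otimes>\<^sub>M lborel)"
        unfolding g_def by measurable
      have "(\<integral>\<^sup>+p. ennreal (norm (case p of (z, h) \<Rightarrow> g z h)) \<partial>(lborel \<Otimes>\<^sub>M lborel))
          = (\<integral>\<^sup>+z. (\<integral>\<^sup>+h. ennreal (norm (g z h)) \<partial>lborel) \<partial>lborel)"
        unfolding g_def by (subst lborel.nn_integral_fst [symmetric]) simp_all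
      also have "\<dots> = ennreal c * (\<integral>\<^sup>+z. ennreal \<bar>second_diff f x z * ?k z\<bar> \<partial>lborel)"
        unfolding nn by (rule nn_integral_cmult) measurable
      also have "\<dots> < \<infinity>"
        using integrable_frac_kernel [OF s sd C [rule_format]] c(1)
        by (auto simp: integrable_iff_bounded ennreal_mult_less_top)
      finally show "(\<integral>\<^sup>+p. ennreal (norm (case p of (z, h) \<Rightarrow> g z h)) \<partial>(lborel \<Otimes>\<^sub>M lborel)) < \<infinity>" .
    qed
    have g2: "(\<integral>z. g z h \<partial>lborel) = 2 * (pw (- s) h * (f x - P h))" for h
    proof (cases "h > 0")
      case True
      have hh: "has_bochner_integral lborel (\<lambda>z::real^'n. heat h z) 1"
        using nn_integral_heat [OF True, where ?'n = 'n] by (intro has_bochner_integral_nn_integral) auto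
      have ip: "integrable lborel (\<lambda>z. f (x + z) * heat h z)"
      proof (rule Bochner_Integration.integrable_bound)
        show "integrable lborel (\<lambda>z::real^'n. M * heat h z)"
          using hh by (auto simp: has_bochner_integral_iff)
        have "\<bar>f (x + z)\<bar> * heat h z \<le> \<bar>M * heat h z\<bar>" for z
          using mult_right_mono [OF order_trans [OF spec [OF M, of "x + z"] abs_ge_self], of "heat h z"] by (simp add: abs_mult)
        then show "AE z in lborel. norm (f (x + z) * heat h z) \<le> norm (M * heat h z)"
          by (auto simp: abs_mult)
      qed measurable
      let ?q = "\<lambda>z. f (x + z) * heat h z"
      have [measurable]: "?q \<in> borel_measurable borel" by measurable
      have im: "integrable lborel (\<lambda>z. f (x - z) * heat h z)"
        using ip integrable_reflect_iff [of ?q 0] by simp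
      have "(\<integral>z. f (x - z) * heat h z \<partial>lborel) = P h"
        using integral_reflect [of ?q 0] P True by simp
      moreover have "(\<integral>z. f (x + z) * heat h z \<partial>lborel) = P h" using P True by simp
      moreover have "(\<integral>z. g z h \<partial>lborel) = (\<integral>z. pw (- s) h * (2 * f x * heat h z - f (x + z) * heat h z - f (x - z) * heat h z) \<partial>lborel)"
        unfolding g_def second_diff_def by (intro Bochner_Integration.integral_cong) (auto simp: algebra_simps)
      ultimately show ?thesis
        using ip im hh by (simp add: has_bochner_integral_iff right_diff_distrib)
    qed (simp add: g_def pw_def)
    have "(\<integral>h. (\<integral>z. g z h \<partial>lborel) \<partial>lborel) = (\<integral>z. (\<integral>h. g z h \<partial>lborel) \<partial>lborel)"
      by (rule lborel_pair.Fubini_integral [OF int])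
    then show ?thesis using c(1) unfolding g1 g2 by simp
  qed
  moreover have "2 / c > 0" using c by simp
  ultimately show ?thesis by blast
qed

section \<open>Smoothness of potentials and calculus of C2 functions\<close>

lemma has_real_derivative_quadratic_bound:
  fixes F :: "real \<Rightarrow> real"
  assumes "\<And>\<delta>. \<bar>\<delta>\<bar> \<le> 1 \<Longrightarrow> \<bar>F (\<rho> + \<delta>) - F \<rho> - \<delta> * D\<bar> \<le> B * \<delta>\<^sup>2"
  shows "(F has_real_derivative D) (at \<rho>)"
  unfolding DERIV_def LIM_zero_iff [of _ D, symmetric]
proof (rule Lim_null_comparison)
  have "\<forall>\<^sub>F \<delta> in at (0::real). \<bar>\<delta>\<bar> \<le> 1 \<and> \<delta> \<noteq> 0"
    by (auto simp: eventually_at intro!: exI [of _ 1])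
  then show "\<forall>\<^sub>F \<delta> in at 0. norm ((F (\<rho> + \<delta>) - F \<rho>) / \<delta> - D) \<le> B * \<bar>\<delta>\<bar>"
  proof eventually_elim
    case (elim \<delta>)
    have "norm ((F (\<rho> + \<delta>) - F \<rho>) / \<delta> - D) = \<bar>F (\<rho> + \<delta>) - F \<rho> - \<delta> * D\<bar> / \<bar>\<delta>\<bar>"
      using elim by (simp add: abs_divide [symmetric] diff_divide_distrib)
    also have "\<dots> \<le> B * \<delta>\<^sup>2 / \<bar>\<delta>\<bar>"
      using assms elim by (intro divide_right_mono) auto
    also have "\<dots> = B * \<bar>\<delta>\<bar>" using elim by (simp add: power2_eq_square field_simps)
    finally show ?case .
  qed
  show "((\<lambda>\<delta>. B * \<bar>\<delta>\<bar>) \<longlongrightarrow> 0) (at 0)" by (auto intro!: tendsto_eq_intros)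
qed

lemma abs_exp_minus_linear_le: "\<bar>exp y - 1 - y\<bar> \<le> y\<^sup>2 * exp \<bar>y\<bar>" for y :: real
proof -
  have 1: "exp y - 1 - y \<ge> 0" using exp_ge_add_one_self [of y] by linarith
  have "(1 - y) * exp y \<le> exp (- y) * exp y"
    using exp_ge_add_one_self [of "- y"] by (intro mult_right_mono) auto
  then have 2: "exp y - 1 \<le> y * exp y" by (simp add: exp_add [symmetric] algebra_simps)
  have "exp y - 1 - y \<le> y * (exp y - 1)" using 2 by (simp add: algebra_simps)
  also have "\<dots> \<le> \<bar>y\<bar> * \<bar>exp y - 1\<bar>" by (metis abs_ge_self abs_mult)
  also have "\<bar>exp y - 1\<bar> \<le> \<bar>y\<bar> * exp \<bar>y\<bar>"
  proof (cases "y \<ge> 0")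
    case True
    then show ?thesis using 2 exp_ge_add_one_self [of y] by simp
  next
    case False
    have "\<bar>exp y - 1\<bar> = 1 - exp y" using False by simp
    also have "\<dots> \<le> - y" using exp_ge_add_one_self [of y] by linarith
    also have "- y = \<bar>y\<bar> * 1" using False by simp
    also have "\<dots> \<le> \<bar>y\<bar> * exp \<bar>y\<bar>" by (intro mult_left_mono) auto
    finally show ?thesis .
  qed
  finally show ?thesis using 1 by (simp add: power2_eq_square mult.assoc mult_left_mono)
qed

lemma integrable_mult_bounded:
  fixes w \<kappa> :: "real \<Rightarrow> real"
  assumes w: "integrable lborel w" and [measurable]: "\<kappa> \<in> borel_measurable borel" and \<kappa>: "\<And>t. 0 \<le> \<kappa> t" "\<And>t. \<kappa> t \<le> K"
  shows "integrable lborel (\<lambda>t. w t * \<kappa> t)"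
proof (rule Bochner_Integration.integrable_bound)
  have [measurable]: "w \<in> borel_measurable borel" using w by auto
  show "(\<lambda>t. w t * \<kappa> t) \<in> borel_measurable lborel" by measurable
  show "integrable lborel (\<lambda>t. K * w t)" using w by simp
  show "AE t in lborel. norm (w t * \<kappa> t) \<le> norm (K * w t)"
    using mult_left_mono [OF \<kappa>(2), of "\<bar>w _\<bar>"] \<kappa>(1) order_trans [OF \<kappa>] by (auto simp: abs_mult mult.commute)
qed

text \<open>As \<kappa> is bounded, the second-order remainder of the exponential is at most a
  constant times \<delta>^2 |m t|, uniformly in t for |\<delta>| \<le> 1. This justifies
  differentiating under the integral at every real \<rho>, negative ones included.\<close>

lemma laplace_has_derivative:
  fixes m \<kappa> :: "real \<Rightarrow> real"
  assumes m: "integrable lborel m" and [measurable]: "\<kappa> \<in> borel_measurable borel" and \<kappa>: "\<And>t. 0 \<le> \<kappa> t" "\<And>t. \<kappa> t \<le> K"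
  shows "((\<lambda>\<rho>. \<integral>t. m t * exp (- (\<kappa> t * \<rho>)) \<partial>lborel) has_real_derivative - (\<integral>t. m t * \<kappa> t * exp (- (\<kappa> t * \<rho>)) \<partial>lborel)) (at \<rho>)"
proof -
  have [measurable]: "m \<in> borel_measurable borel" using m by auto
  have K: "K \<ge> 0" using \<kappa> [of 0] by linarith
  have exple: "exp (- (\<kappa> t * \<rho>)) \<le> exp (K * \<bar>\<rho>\<bar>)" for t \<rho>
  proof -
    have "- (\<kappa> t * \<rho>) \<le> \<kappa> t * \<bar>\<rho>\<bar>" using mult_left_mono [OF abs_ge_minus_self [of \<rho>] \<kappa>(1) [of t]] by simp
    also have "\<dots> \<le> K * \<bar>\<rho>\<bar>" using \<kappa>(2) by (intro mult_right_mono) auto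
    finally show ?thesis by simp
  qed
  have int: "integrable lborel (\<lambda>t. w t * exp (- (\<kappa> t * \<rho>)))" if "integrable lborel w" for w \<rho>
    by (rule integrable_mult_bounded [OF that _ _ exple]) auto
  have m\<kappa>: "integrable lborel (\<lambda>t. m t * \<kappa> t)"
    by (rule integrable_mult_bounded [OF m _ \<kappa>]) simp
  let ?B = "K\<^sup>2 * exp (K * \<bar>\<rho>\<bar> + K) * (\<integral>t. \<bar>m t\<bar> \<partial>lborel)"
  show "((\<lambda>\<rho>. \<integral>t. m t * exp (- (\<kappa> t * \<rho>)) \<partial>lborel) has_real_derivative - (\<integral>t. m t * \<kappa> t * exp (- (\<kappa> t * \<rho>)) \<partial>lborel)) (at \<rho>)"
  proof (rule has_real_derivative_quadratic_bound [where B = ?B])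
    fix \<delta> :: real assume \<delta>: "\<bar>\<delta>\<bar> \<le> 1"
    let ?d = "\<lambda>t. m t * exp (- (\<kappa> t * (\<rho> + \<delta>))) - m t * exp (- (\<kappa> t * \<rho>)) + \<delta> * (m t * \<kappa> t * exp (- (\<kappa> t * \<rho>)))"
    let ?D = "(\<integral>t. m t * exp (- (\<kappa> t * (\<rho> + \<delta>))) \<partial>lborel) - (\<integral>t. m t * exp (- (\<kappa> t * \<rho>)) \<partial>lborel) - \<delta> * (- (\<integral>t. m t * \<kappa> t * exp (- (\<kappa> t * \<rho>)) \<partial>lborel))"
    have b: "\<bar>?d t\<bar>
       \<le> K\<^sup>2 * exp (K * \<bar>\<rho>\<bar> + K) * \<delta>\<^sup>2 * \<bar>m t\<bar>" for t
    proof -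
      let ?y = "- (\<kappa> t * \<delta>)"
      have "?d t
         = m t * exp (- (\<kappa> t * \<rho>)) * (exp ?y - 1 - ?y)"
      proof -
        have "- (\<kappa> t * (\<rho> + \<delta>)) = - (\<kappa> t * \<rho>) + ?y" by (simp add: algebra_simps)
        then have "exp (- (\<kappa> t * (\<rho> + \<delta>))) = exp (- (\<kappa> t * \<rho>)) * exp ?y" by (simp only: exp_add)
        then show ?thesis by (simp only:) (simp add: algebra_simps)
      qed
      then have "\<bar>?d t\<bar>
         = \<bar>m t\<bar> * (exp (- (\<kappa> t * \<rho>)) * \<bar>exp ?y - 1 - ?y\<bar>)"
        by (simp add: abs_mult)
      also have "\<dots> \<le> \<bar>m t\<bar> * (exp (K * \<bar>\<rho>\<bar>) * ((K\<^sup>2 * \<delta>\<^sup>2) * exp K))"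
      proof (intro mult_left_mono mult_mono exple)
        have "\<bar>exp ?y - 1 - ?y\<bar> \<le> ?y\<^sup>2 * exp \<bar>?y\<bar>" by (rule abs_exp_minus_linear_le)
        also have "\<dots> \<le> (K\<^sup>2 * \<delta>\<^sup>2) * exp K"
        proof (intro mult_mono)
          show "?y\<^sup>2 \<le> K\<^sup>2 * \<delta>\<^sup>2" using \<kappa> by (simp add: power_mult_distrib mult_right_mono power_mono)
          have "\<kappa> t * \<bar>\<delta>\<bar> \<le> K * 1" using \<kappa> \<delta> K by (intro mult_mono) auto
          then show "exp \<bar>?y\<bar> \<le> exp K" using \<kappa>(1) by (simp add: abs_mult)
        qed auto
        finally show "\<bar>exp ?y - 1 - ?y\<bar> \<le> (K\<^sup>2 * \<delta>\<^sup>2) * exp K" .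
      qed auto
      finally show ?thesis by (simp add: exp_add mult_ac)
    qed
    have i1: "integrable lborel (\<lambda>t. m t * exp (- (\<kappa> t * (\<rho> + \<delta>))))" and i2: "integrable lborel (\<lambda>t. m t * exp (- (\<kappa> t * \<rho>)))"
      and i3: "integrable lborel (\<lambda>t. m t * \<kappa> t * exp (- (\<kappa> t * \<rho>)))"
      by (rule int [OF m] int [OF m\<kappa>])+
    have eq: "?D
      = (\<integral>t. ?d t \<partial>lborel)"
      using i1 i2 i3 by simp
    have "\<bar>\<integral>t. ?d t \<partial>lborel\<bar> \<le> (\<integral>t. K\<^sup>2 * exp (K * \<bar>\<rho>\<bar> + K) * \<delta>\<^sup>2 * \<bar>m t\<bar> \<partial>lborel)"
    proof (rule order_trans [OF integral_abs_bound integral_mono])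
      show "integrable lborel (\<lambda>t. \<bar>?d t\<bar>)"
        using i1 i2 i3 by (intro integrable_abs Bochner_Integration.integrable_add Bochner_Integration.integrable_diff integrable_mult_right)
      show "integrable lborel (\<lambda>t. K\<^sup>2 * exp (K * \<bar>\<rho>\<bar> + K) * \<delta>\<^sup>2 * \<bar>m t\<bar>)"
        using m by simp
    qed (rule b)
    also have "\<dots> = ?B * \<delta>\<^sup>2" by (subst integral_mult_right_zero, simp only: mult_ac)
    finally show "\<bar>?D\<bar> \<le> ?B * \<delta>\<^sup>2"
      unfolding eq .
  qed
qed

lemma C2_closure_subset:
  assumes "C2_closure UNIV \<phi>"
  shows "C2_closure U \<phi>"
proof -
  obtain G H where "continuous_on UNIV \<phi>" "continuous_on UNIV G" "continuous_on UNIV H"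
    "\<forall>x. (\<phi> has_derivative (\<lambda>h. G x \<bullet> h)) (at x) \<and> (G has_derivative (\<lambda>h. H x *v h)) (at x)"
    using assms unfolding C2_closure_def by auto
  then show ?thesis
    unfolding C2_closure_def by (blast intro: continuous_on_subset)
qed

lemma C2_closure_const: "C2_closure UNIV (\<lambda>x. c)"
  unfolding C2_closure_def
proof (intro conjI exI [of _ "\<lambda>_. 0"] ballI)
  show "((\<lambda>x. c) has_derivative (\<lambda>h. 0 \<bullet> h)) (at x)" for x :: "real^'n" by simp
  show "((\<lambda>_. 0) has_derivative (\<lambda>h. 0 *v h)) (at x)" for x :: "real^'n" by simp
qed auto

lemma C2_closure_lincomb:
  assumes "C2_closure U \<phi>" "C2_closure U \<psi>"
  shows "C2_closure U (\<lambda>x. a * \<phi> x + b * \<psi> x)"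
proof -
  obtain G H where 1: "continuous_on (closure U) \<phi>" "continuous_on (closure U) G" "continuous_on (closure U) H"
    "\<And>x. x \<in> U \<Longrightarrow> (\<phi> has_derivative (\<lambda>h. G x \<bullet> h)) (at x) \<and> (G has_derivative (\<lambda>h. H x *v h)) (at x)"
    using assms(1) unfolding C2_closure_def by blast
  obtain G' H' where 2: "continuous_on (closure U) \<psi>" "continuous_on (closure U) G'" "continuous_on (closure U) H'"
    "\<And>x. x \<in> U \<Longrightarrow> (\<psi> has_derivative (\<lambda>h. G' x \<bullet> h)) (at x) \<and> (G' has_derivative (\<lambda>h. H' x *v h)) (at x)"
    using assms(2) unfolding C2_closure_def by blast
  show ?thesis
    unfolding C2_closure_def
  proof (intro conjI exI [of _ "\<lambda>x. a *\<^sub>R G x + b *\<^sub>R G' x"] exI [of _ "\<lambda>x. a *\<^sub>R H x + b *\<^sub>R H' x"] ballI)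
    show "continuous_on (closure U) (\<lambda>x. a * \<phi> x + b * \<psi> x)" using 1 2 by (intro continuous_intros)
    show "continuous_on (closure U) (\<lambda>x. a *\<^sub>R G x + b *\<^sub>R G' x)" using 1 2 by (intro continuous_intros)
    show "continuous_on (closure U) (\<lambda>x. a *\<^sub>R H x + b *\<^sub>R H' x)" using 1 2 by (intro continuous_intros)
    fix x assume x: "x \<in> U"
    have "((\<lambda>x. a * \<phi> x + b * \<psi> x) has_derivative (\<lambda>h. a * (G x \<bullet> h) + b * (G' x \<bullet> h))) (at x)"
      using 1(4) [OF x] 2(4) [OF x] by (auto intro!: derivative_intros)
    then show "((\<lambda>x. a * \<phi> x + b * \<psi> x) has_derivative (\<lambda>h. (a *\<^sub>R G x + b *\<^sub>R G' x) \<bullet> h)) (at x)"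
      by (simp add: inner_add_left)
    have "((\<lambda>x. a *\<^sub>R G x + b *\<^sub>R G' x) has_derivative (\<lambda>h. a *\<^sub>R (H x *v h) + b *\<^sub>R (H' x *v h))) (at x)"
      using 1(4) [OF x] 2(4) [OF x] by (auto intro!: derivative_intros)
    then show "((\<lambda>x. a *\<^sub>R G x + b *\<^sub>R G' x) has_derivative (\<lambda>h. (a *\<^sub>R H x + b *\<^sub>R H' x) *v h)) (at x)"
      by (simp add: matrix_vector_mult_add_rdistrib scaleR_matrix_vector_assoc)
  qed
qed

text \<open>Differentiability of the gradient at \<open>x\<close> gives |G y - G x| \<le> (K + 1) |y
  - x| near x; the mean value inequality for \<phi> minus its linear part on the ball of radius |z|
  then yields the quadratic remainder.\<close>

lemma C2_closure_taylor:
  assumes "C2_closure U \<phi>" "open U" "x \<in> U"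
  shows "\<exists>g r B. r > 0 \<and> (\<phi> has_derivative (\<lambda>h. g \<bullet> h)) (at x) \<and>
     (\<forall>z. norm z < r \<longrightarrow> \<bar>\<phi> (x + z) - \<phi> x - g \<bullet> z\<bar> \<le> B * (norm z)\<^sup>2)"
proof -
  obtain G H where G: "\<And>x. x \<in> U \<Longrightarrow> (\<phi> has_derivative (\<lambda>h. G x \<bullet> h)) (at x)"
    and H: "\<And>x. x \<in> U \<Longrightarrow> (G has_derivative (\<lambda>h. H x *v h)) (at x)"
    using assms(1) unfolding C2_closure_def by blast
  obtain r1 where r1: "r1 > 0" "ball x r1 \<subseteq> U" using assms(2,3) openE by blast
  obtain r2 where r2: "r2 > 0" "\<And>y. norm (y - x) < r2 \<Longrightarrow> norm (G y - G x - H x *v (y - x)) \<le> 1 * norm (y - x)"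
    using H [OF assms(3)] unfolding has_derivative_at_alt by (metis zero_less_one)
  obtain K where K: "\<And>h. norm (H x *v h) \<le> norm h * K"
    using bounded_linear.bounded [OF has_derivative_bounded_linear [OF H [OF assms(3)]]] by blast
  define r where "r = min r1 r2"
  have GL: "norm (G y - G x) \<le> (\<bar>K\<bar> + 1) * norm (y - x)" if "norm (y - x) < r" for y
  proof -
    have "norm (G y - G x) \<le> norm (G y - G x - H x *v (y - x)) + norm (H x *v (y - x))"
      by (metis diff_add_cancel norm_triangle_ineq)
    also have "\<dots> \<le> 1 * norm (y - x) + norm (y - x) * \<bar>K\<bar>"
    proof (rule add_mono)
      show "norm (G y - G x - H x *v (y - x)) \<le> 1 * norm (y - x)"
        using that by (intro r2(2)) (simp add: r_def)
      show "norm (H x *v (y - x)) \<le> norm (y - x) * \<bar>K\<bar>"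
        by (rule order_trans [OF K]) (intro mult_left_mono, auto)
    qed
    finally show ?thesis by (simp add: algebra_simps)
  qed
  have "\<bar>\<phi> (x + z) - \<phi> x - G x \<bullet> z\<bar> \<le> (\<bar>K\<bar> + 1) * (norm z)\<^sup>2" if z: "norm z < r" for z
  proof -
    let ?f = "\<lambda>y. \<phi> y - G x \<bullet> y"
    have "norm (?f (x + z) - ?f x) \<le> ((\<bar>K\<bar> + 1) * norm z) * norm (x + z - x)"
    proof (rule differentiable_bound [of "cball x (norm z)"])
      show "(?f has_derivative (\<lambda>h. G y \<bullet> h - G x \<bullet> h)) (at y within cball x (norm z))" if "y \<in> cball x (norm z)" for y
      proof -
        have "y \<in> U" using that z r1(2) by (auto simp: r_def subset_iff)
        then show ?thesis
          by (intro derivative_intros has_derivative_at_withinI [OF G])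
      qed
      show "onorm (\<lambda>h. G y \<bullet> h - G x \<bullet> h) \<le> (\<bar>K\<bar> + 1) * norm z" if "y \<in> cball x (norm z)" for y
      proof (rule onorm_bound)
        fix h
        have y: "norm (y - x) \<le> norm z" using that by (simp add: dist_norm norm_minus_commute)
        have "norm (G y \<bullet> h - G x \<bullet> h) \<le> norm (G y - G x) * norm h"
          by (simp add: inner_diff_left [symmetric] Cauchy_Schwarz_ineq2)
        also have "\<dots> \<le> ((\<bar>K\<bar> + 1) * norm (y - x)) * norm h"
          using y z by (intro mult_right_mono GL) auto
        also have "\<dots> \<le> (\<bar>K\<bar> + 1) * norm z * norm h"
          using y by (intro mult_right_mono mult_left_mono) auto
        finally show "norm (G y \<bullet> h - G x \<bullet> h) \<le> (\<bar>K\<bar> + 1) * norm z * norm h" .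
      qed simp
    qed (auto simp: dist_norm)
    then show ?thesis by (simp add: inner_add_right power2_eq_square mult.assoc)
  qed
  moreover have "r > 0" using r1 r2 by (simp add: r_def)
  ultimately show ?thesis using G [OF assms(3)] by blast
qed

text \<open>The gradient terms of the expansions at z and -z cancel, and boundedness of
  \<open>f\<close> covers large z.\<close>

lemma second_diff_bound:
  assumes "C2_closure UNIV f" and M: "\<And>y. \<bar>f y\<bar> \<le> M"
  shows "\<exists>C. \<forall>z. \<bar>second_diff f x z\<bar> \<le> C * min 1 ((norm z)\<^sup>2)"
proof -
  obtain g r B where r: "r > 0" and B: "\<And>z. norm z < r \<Longrightarrow> \<bar>f (x + z) - f x - g \<bullet> z\<bar> \<le> B * (norm z)\<^sup>2"
    using C2_closure_taylor [OF assms(1), of x] by auto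
  show ?thesis
  proof (rule local_quadratic_bound [OF r])
    show "\<bar>second_diff f x z\<bar> \<le> (2 * B) * (norm z)\<^sup>2" if "norm z < r" for z
      using B [of z] B [of "- z"] that by (simp add: second_diff_def)
    show "\<bar>second_diff f x z\<bar> \<le> 4 * M" for z
      using M [of x] M [of "x + z"] M [of "x - z"] by (simp add: second_diff_def)
  qed
qed

text \<open>Taking the squared norm as variable avoids the singularity of the norm at the centre.
  The Hessian is 4 W'' times the dyadic product of x - y with itself plus 2 W' times the
  identity.\<close>

lemma C2_closure_radial:
  fixes y :: "real^'n::finite"
  assumes W: "\<And>\<rho>. (W has_real_derivative W1 \<rho>) (at \<rho>)" "\<And>\<rho>. (W1 has_real_derivative W2 \<rho>) (at \<rho>)"
    and W2: "continuous_on UNIV W2"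
  shows "C2_closure UNIV (\<lambda>x. W ((norm (x - y))\<^sup>2))"
proof -
  define G where "G x = (2 * W1 ((norm (x - y))\<^sup>2)) *\<^sub>R (x - y)" for x
  define H :: "real^'n \<Rightarrow> real^'n^'n" where
    "H x = (\<chi> i j. 4 * W2 ((norm (x - y))\<^sup>2) * (x - y) $ i * (x - y) $ j + 2 * W1 ((norm (x - y))\<^sup>2) * (if i = j then 1 else 0))" for x
  have W_cont: "continuous_on UNIV W" "continuous_on UNIV W1"
    using DERIV_isCont [OF W(1)] DERIV_isCont [OF W(2)] by (auto simp: continuous_on_eq_continuous_at)
  have nd: "((\<lambda>x. (norm (x - y))\<^sup>2) has_derivative (\<lambda>h. 2 * ((x - y) \<bullet> h))) (at x)" for x
    unfolding power2_norm_eq_inner by (auto intro!: derivative_eq_intros simp: inner_commute)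
  have comp: "((\<lambda>x. V ((norm (x - y))\<^sup>2)) has_derivative (\<lambda>h. V' ((norm (x - y))\<^sup>2) * (2 * ((x - y) \<bullet> h)))) (at x)"
    if "\<And>\<rho>. (V has_real_derivative V' \<rho>) (at \<rho>)" for V V' x
    using has_derivative_compose [OF nd [of x], of V] that [of "(norm (x - y))\<^sup>2"] unfolding has_field_derivative_def by simp
  have c2: "continuous_on UNIV (\<lambda>x. V ((norm (x - y))\<^sup>2))" if "continuous_on UNIV V" for V :: "real \<Rightarrow> real"
    by (rule continuous_on_compose2 [OF that]) (auto intro!: continuous_intros)
  show ?thesis
    unfolding C2_closure_def
  proof (intro conjI exI [of _ G] exI [of _ H] ballI)
    show "continuous_on (closure UNIV) (\<lambda>x. W ((norm (x - y))\<^sup>2))"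
      using c2 [OF W_cont(1)] by simp
    show "continuous_on (closure UNIV) G"
      unfolding G_def using c2 [OF W_cont(2)] by (auto intro!: continuous_intros)
    have "continuous_on UNIV H"
      unfolding H_def
      by (intro continuous_on_vec_lambda continuous_intros c2 W_cont W2)
    then show "continuous_on (closure UNIV) H" by simp
    fix x
    have "W1 ((norm (x - y))\<^sup>2) * (2 * ((x - y) \<bullet> h)) = G x \<bullet> h" for h by (simp add: G_def)
    then show "((\<lambda>x. W ((norm (x - y))\<^sup>2)) has_derivative (\<lambda>h. G x \<bullet> h)) (at x)"
      using comp [OF W(1), of x] by simp
    have "(G has_derivative (\<lambda>h. (2 * W1 ((norm (x - y))\<^sup>2)) *\<^sub>R h + (2 * (W2 ((norm (x - y))\<^sup>2) * (2 * ((x - y) \<bullet> h)))) *\<^sub>R (x - y))) (at x)"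
      unfolding G_def by (rule derivative_eq_intros comp [OF W(2), of x] refl | simp)+
    moreover have "(2 * W1 ((norm (x - y))\<^sup>2)) *\<^sub>R h + (2 * (W2 ((norm (x - y))\<^sup>2) * (2 * ((x - y) \<bullet> h)))) *\<^sub>R (x - y) = H x *v h" for h
    proof (simp add: vec_eq_iff, intro allI)
      fix i
      have "(H x *v h) $ i = (\<Sum>j\<in>UNIV. (4 * W2 ((norm (x - y))\<^sup>2) * (x - y) $ i) * ((x - y) $ j * h $ j)
          + (if i = j then 2 * W1 ((norm (x - y))\<^sup>2) * h $ j else 0))"
        unfolding matrix_vector_mult_def H_def by (auto intro!: sum.cong simp: algebra_simps)
      also have "\<dots> = (4 * W2 ((norm (x - y))\<^sup>2) * (x - y) $ i) * ((x - y) \<bullet> h) + 2 * W1 ((norm (x - y))\<^sup>2) * h $ i"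
        by (simp add: sum.distrib sum_distrib_left [symmetric] inner_vec_def)
      finally show "2 * W1 ((norm (x - y))\<^sup>2) * h $ i + 4 * (W2 ((norm (x - y))\<^sup>2) * ((x - y) \<bullet> h)) * (x $ i - y $ i) = (H x *v h) $ i"
        by (simp add: algebra_simps)
    qed
    ultimately show "(G has_derivative (\<lambda>h. H x *v h)) (at x)" by simp
  qed
qed

text \<open>A potential is a Laplace transform in the variable |x - y|^2, with rates 1 / (2 (a +
  \<tau>)) bounded by 1 / (2a). Each derivative in that variable multiplies the integrable weight by
  the bounded rate, so \<open>laplace_has_derivative\<close> can be iterated.\<close>

lemma C2_closure_pot:
  fixes y :: "real^'n::finite"
  assumes "0 < g" "g < real CARD('n) / 2" "a > 0"
  shows "C2_closure UNIV (\<lambda>x. pot g a (x - y))"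
proof -
  define m where "m \<tau> = pw g \<tau> * (2 * pi * (a + \<tau>)) powr (- (real CARD('n) / 2))" for \<tau>
  \<comment> \<open>The rate is cut off for \<tau> \<le> 0, where it would be unbounded near \<tau>
    = - a; the weight \<open>m\<close> vanishes there anyway.\<close>
  define \<kappa> where "\<kappa> \<tau> = (if \<tau> > 0 then 1 / (2 * (a + \<tau>)) else 0)" for \<tau>
  define K where "K = 1 / (2 * a)"
  have [measurable]: "\<kappa> \<in> borel_measurable borel" unfolding \<kappa>_def by measurable
  have \<kappa>: "0 \<le> \<kappa> t" "\<kappa> t \<le> K" for t
    using assms(3) by (auto simp: \<kappa>_def K_def field_simps)
  have m: "integrable lborel m"
    unfolding m_def using assms
    by (intro integrable_pw_shift [where \<theta> = "real CARD('n) / 2" and C = "(2 * pi) powr (- (real CARD('n) / 2))"]) (auto simp: powr_mult)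
  have [measurable]: "m \<in> borel_measurable borel" using m by auto
  have step: "integrable lborel (\<lambda>t. w t * \<kappa> t)" if "integrable lborel w" for w
    by (rule integrable_mult_bounded [OF that _ \<kappa>]) simp
  define W where "W w \<rho> = (\<integral>t. w t * exp (- (\<kappa> t * \<rho>)) \<partial>lborel)" for w \<rho>
  have dW: "(W w has_real_derivative - W (\<lambda>t. w t * \<kappa> t) \<rho>) (at \<rho>)" if "integrable lborel w" for w \<rho>
    unfolding W_def using laplace_has_derivative [OF that _ \<kappa>, where \<rho> = \<rho>] by simp
  let ?m1 = "\<lambda>t. m t * \<kappa> t" and ?m2 = "\<lambda>t. m t * \<kappa> t * \<kappa> t"
  have i1: "integrable lborel ?m1" and i2: "integrable lborel ?m2"
    by (rule step m)+
  have "C2_closure UNIV (\<lambda>x. W m ((norm (x - y))\<^sup>2))"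
  proof (rule C2_closure_radial [where ?W1.0 = "\<lambda>\<rho>. - W ?m1 \<rho>" and ?W2.0 = "W ?m2"])
    show "(W m has_real_derivative - W ?m1 \<rho>) (at \<rho>)" for \<rho> by (rule dW [OF m])
    show "((\<lambda>\<rho>. - W ?m1 \<rho>) has_real_derivative W ?m2 \<rho>) (at \<rho>)" for \<rho>
      using DERIV_minus [OF dW [OF i1, of \<rho>]] by simp
    show "continuous_on UNIV (W ?m2)"
      using dW [OF i2] by (auto simp: continuous_on_eq_continuous_at intro: DERIV_isCont)
  qed
  moreover have "W m ((norm (x - y))\<^sup>2) = pot g a (x - y)" for x
    unfolding W_def pot_def
    by (intro Bochner_Integration.integral_cong refl) (auto simp: m_def \<kappa>_def heat_def pw_def)
  ultimately show ?thesis by simp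
qed

text \<open>Chains the three reductions: principal value to second differences, second differences
  to heat averages, and heat averages of \<open>pot g a\<close>, which are
  \<open>pot g (a + h)\<close>, to the Marchaud derivative in \<open>a\<close>.\<close>

lemma has_frac_laplacian_pot:
  assumes s: "0 < s" "s < 1" "s \<le> g" "g < real CARD('n) / 2"
  shows "\<exists>c>0. \<forall>a>0. \<forall>x y :: real^'n::finite.
    has_frac_laplacian s (\<lambda>x. pot g a (x - y)) x (c * (if g = s then heat a (x - y) else pot (g - s) a (x - y)))"
proof -
  have g: "0 < g" using s by simp
  obtain c1 where c1: "c1 > 0" "\<And>a x. a > 0 \<Longrightarrow> has_bochner_integral lborel (\<lambda>h. pw (- s) h * (pot g a x - pot g (a + h) x))
      (c1 * (if g = s then heat a x else pot (g - s) a (x :: real^'n)))"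
    using marchaud_pot [OF s] by blast
  from integral_second_diff_heat [OF s(1,2), where ?'n = 'n]
  obtain c2 where c2: "c2 > 0" "\<forall>(f :: real^'n \<Rightarrow> real) x M C P. f \<in> borel_measurable borel \<longrightarrow> (\<forall>y. \<bar>f y\<bar> \<le> M) \<longrightarrow>
     (\<forall>z. \<bar>second_diff f x z\<bar> \<le> C * min 1 ((norm z)\<^sup>2)) \<longrightarrow>
     (\<forall>h>0. (\<integral>z. f (x + z) * heat h z \<partial>lborel) = P h) \<longrightarrow>
     (\<integral>z. second_diff f x z * frac_kernel s z \<partial>lborel) = c2 * (\<integral>h. pw (- s) h * (f x - P h) \<partial>lborel)"
    by (elim exE conjE)
  obtain D where D: "D > 0" "\<And>a x. a > 0 \<Longrightarrow> pot g a (x :: real^'n) \<le> D * (a + (norm x)\<^sup>2) powr (g - real CARD('n) / 2)"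
    using pot_le [OF g s(4)] by blast
  define c where "c = frac_const TYPE('n) s * c2 * c1 / 2"
  have "has_frac_laplacian s (\<lambda>x. pot g a (x - y)) x (c * (if g = s then heat a (x - y) else pot (g - s) a (x - y)))"
    if a: "a > 0" for a and x y :: "real^'n"
  proof -
    let ?f = "\<lambda>x. pot g a (x - y)"
    define M where "M = D * a powr (g - real CARD('n) / 2)"
    have M: "\<bar>?f z\<bar> \<le> M" for z
    proof -
      have "pot g a (z - y) \<le> D * (a + (norm (z - y))\<^sup>2) powr (g - real CARD('n) / 2)" by (rule D(2) [OF a])
      also have "\<dots> \<le> M" unfolding M_def using D(1) a s by (intro mult_left_mono powr_mono2') auto
      finally show ?thesis by simp
    qed
    obtain C where C: "\<And>z. \<bar>second_diff ?f x z\<bar> \<le> C * min 1 ((norm z)\<^sup>2)"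
      using second_diff_bound [OF C2_closure_pot [OF g s(4) a] M] by blast
    have P: "(\<integral>z. ?f (x + z) * heat h z \<partial>lborel) = pot g (a + h) (x - y)" if h: "h > 0" for h
    proof -
      have "(\<integral>\<^sup>+z. ennreal (pot g a (x - y + z)) * ennreal (heat h z) \<partial>lborel) = ennreal (pot g (a + h) (x - y))"
        by (rule nn_integral_pot_conv [OF g s(4) a h])
      then have "has_bochner_integral lborel (\<lambda>z. pot g a (x - y + z) * heat h z) (pot g (a + h) (x - y))"
        by (intro has_bochner_integral_nn_integral) (auto simp: ennreal_mult)
      moreover have eq: "x + z - y = x - y + z" for z by simp
      ultimately show ?thesis unfolding eq by (simp add: has_bochner_integral_iff)
    qed
    have "(\<integral>z. second_diff ?f x z * frac_kernel s z \<partial>lborel) = c2 * (c1 * (if g = s then heat a (x - y) else pot (g - s) a (x - y)))"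
    proof -
      have "?f \<in> borel_measurable borel" by measurable
      note c2(2) [rule_format, OF this M C P]
      then show ?thesis using c1(2) [OF a, of "x - y"] by (simp add: has_bochner_integral_iff)
    qed
    moreover have "has_frac_laplacian s ?f x (frac_const TYPE('n) s *
       ((\<integral>z. second_diff ?f x z * frac_kernel s z \<partial>lborel) / 2))"
      by (rule has_frac_laplacian_second_diff [OF s(1,2) _ M C]) measurable
    ultimately show ?thesis by (simp add: c_def mult_ac)
  qed
  moreover have "c > 0" using c1 c2 frac_const_pos [OF s(1,2), where ?'n = 'n] by (simp add: c_def)
  ultimately show ?thesis by blast
qed

section \<open>Comparison with potentials\<close>

text \<open>One equation of the system, with the power of the other component frozen as a given
  right-hand side \<open>k\<close>; each component can then be compared separately.\<close>

definition visc_super :: "real \<Rightarrow> (real^'n::finite \<Rightarrow> real) \<Rightarrow> (real^'n \<Rightarrow> real) \<Rightarrow> bool" where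
  "visc_super s k u \<longleftrightarrow> (\<forall>x0. \<exists>U. open U \<and> x0 \<in> U \<and>
     (\<forall>\<phi>. touches_below U x0 \<phi> u \<longrightarrow> (\<exists>L. has_frac_laplacian s (glue U \<phi> u) x0 L \<and> L \<ge> k x0)))"

lemma has_frac_laplacian_mono:
  fixes f g :: "real^'n::finite \<Rightarrow> real"
  assumes s: "0 < s" "s < 1" and f: "has_frac_laplacian s f x L" and g: "has_frac_laplacian s g x L'"
    and "f x = g x" "\<And>y. f y \<le> g y"
  shows "L' \<le> L"
proof -
  let ?I = "\<lambda>f \<epsilon>. LINT y : - ball x \<epsilon> | lborel. (f x - f y) / norm (x - y) powr (real CARD('n) + 2 * s)"
  have "\<forall>\<^sub>F \<epsilon> in at_right 0. frac_const TYPE('n) s * ?I g \<epsilon> \<le> frac_const TYPE('n) s * ?I f \<epsilon>"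
    using eventually_at_right_less [of "0::real"]
  proof eventually_elim
    case (elim \<epsilon>)
    have "?I g \<epsilon> \<le> ?I f \<epsilon>"
      using f g elim assms(5,6) unfolding has_frac_laplacian_def
      by (intro set_integral_mono divide_right_mono) auto
    then show ?case using frac_const_pos [OF s, where ?'n = 'n] by simp
  qed
  moreover have "((\<lambda>\<epsilon>. frac_const TYPE('n) s * ?I g \<epsilon>) \<longlongrightarrow> L') (at_right 0)"
    "((\<lambda>\<epsilon>. frac_const TYPE('n) s * ?I f \<epsilon>) \<longlongrightarrow> L) (at_right 0)"
    using f g by (simp_all add: has_frac_laplacian_def)
  ultimately show ?thesis by (intro tendsto_le [of "at_right 0"]) auto
qed

lemma has_frac_laplacian_lincomb:
  fixes f g :: "real^'n::finite \<Rightarrow> real"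
  assumes f: "has_frac_laplacian s f x L" and g: "has_frac_laplacian s g x L'"
  shows "has_frac_laplacian s (\<lambda>y. a * f y + b * g y) x (a * L + b * L')"
proof -
  define F where "F y = (f x - f y) / norm (x - y) powr (real CARD('n) + 2 * s)" for y
  define G where "G y = (g x - g y) / norm (x - y) powr (real CARD('n) + 2 * s)" for y
  let ?I = "\<lambda>f \<epsilon>. LINT y : - ball x \<epsilon> | lborel. f y"
  have eq: "(a * f x + b * g x - (a * f y + b * g y)) / norm (x - y) powr (real CARD('n) + 2 * s) = a * F y + b * G y" for y
    by (simp add: F_def G_def algebra_simps diff_divide_distrib add_divide_distrib)
  have i: "set_integrable lborel (- ball x \<epsilon>) (\<lambda>y. a * F y)" "set_integrable lborel (- ball x \<epsilon>) (\<lambda>y. b * G y)"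
    if "\<epsilon> > 0" for \<epsilon> using f g that by (simp_all add: has_frac_laplacian_def F_def G_def del: times_divide_eq_right)
  show ?thesis
    unfolding has_frac_laplacian_def eq
  proof (intro conjI allI impI)
    show "set_integrable lborel (- ball x \<epsilon>) (\<lambda>y. a * F y + b * G y)" if "\<epsilon> > 0" for \<epsilon>
      using i [OF that] by (intro set_integral_add)
    have "((\<lambda>\<epsilon>. a * (frac_const TYPE('n) s * ?I F \<epsilon>) + b * (frac_const TYPE('n) s * ?I G \<epsilon>)) \<longlongrightarrow> a * L + b * L') (at_right 0)"
      using f g by (intro tendsto_intros) (simp_all add: has_frac_laplacian_def F_def G_def)
    moreover have "\<forall>\<^sub>F \<epsilon> in at_right 0. a * (frac_const TYPE('n) s * ?I F \<epsilon>) + b * (frac_const TYPE('n) s * ?I G \<epsilon>)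
       = frac_const TYPE('n) s * ?I (\<lambda>y. a * F y + b * G y) \<epsilon>"
      using eventually_at_right_less [of "0::real"]
    proof eventually_elim
      case (elim \<epsilon>)
      show ?case
        using set_integral_add(2) [OF i [OF elim]] by (simp add: algebra_simps)
    qed
    ultimately show "((\<lambda>\<epsilon>. frac_const TYPE('n) s * ?I (\<lambda>y. a * F y + b * G y) \<epsilon>) \<longlongrightarrow> a * L + b * L') (at_right 0)"
      by (rule Lim_transform_eventually)
  qed
qed

lemma has_frac_laplacian_const: "has_frac_laplacian s (\<lambda>y. c) x 0"
  by (simp add: has_frac_laplacian_def set_integrable_def set_lebesgue_integral_def)

text \<open>If w exceeded u somewhere, u - w would attain a negative minimum m, because w tends to 0
  and u is nonnegative. Then w + m touches u from below and lies below the glued function, so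
  monotonicity of the operator forces k \<le> g at the contact point, against the strict
  inequality.\<close>

lemma comparison:
  fixes u w :: "real^'n::finite \<Rightarrow> real"
  assumes s: "0 < s" "s < 1" and u: "continuous_on UNIV u" "\<And>x. u x \<ge> 0" "visc_super s k u"
    and w: "C2_closure UNIV w" "(w \<longlongrightarrow> 0) at_infinity"
    and g: "\<And>x. has_frac_laplacian s w x (g x)" "\<And>x. g x < k x"
  shows "w x \<le> u x"
proof (rule ccontr)
  assume "\<not> w x \<le> u x"
  define \<delta> where "\<delta> = w x - u x"
  have \<delta>: "\<delta> > 0" using \<open>\<not> w x \<le> u x\<close> by (simp add: \<delta>_def)
  have wc: "continuous_on UNIV w" using w(1) by (simp add: C2_closure_def)
  have "\<forall>\<^sub>F y in at_infinity. dist (w y) 0 < \<delta>" using w(2) \<delta> by (rule tendstoD)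
  then obtain R where R: "\<And>y. norm y \<ge> R \<Longrightarrow> \<bar>w y\<bar> < \<delta>"
    unfolding eventually_at_infinity by auto
  define S where "S = cball (0 :: real^'n) (max R (norm x))"
  have "compact S" "S \<noteq> {}" "x \<in> S" by (auto simp: S_def)
  moreover have "continuous_on S (\<lambda>y. u y - w y)"
    using u(1) wc by (intro continuous_intros) (auto intro: continuous_on_subset)
  ultimately obtain z where z: "z \<in> S" "\<And>y. y \<in> S \<Longrightarrow> u z - w z \<le> u y - w y"
    using continuous_attains_inf [of S "\<lambda>y. u y - w y"] by blast
  define m where "m = u z - w z"
  have m: "m \<le> - \<delta>" using z(2) [OF \<open>x \<in> S\<close>] by (simp add: m_def \<delta>_def)
  have le: "w y + m \<le> u y" for y
  proof (cases "y \<in> S")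
    case True
    then show ?thesis using z(2) [OF True] unfolding m_def by linarith
  next
    case False
    then have "\<bar>w y\<bar> < \<delta>" by (intro R) (simp add: S_def)
    then show ?thesis using m u(2) [of y] by linarith
  qed
  \<comment> \<open>The factors 1 bring the shifted function into the form of the
    \<open>lincomb\<close> lemmas.\<close>
  let ?\<phi> = "\<lambda>y. 1 * w y + 1 * m"
  obtain U where U: "open U" "z \<in> U" "\<And>\<phi>. touches_below U z \<phi> u \<Longrightarrow> \<exists>L. has_frac_laplacian s (glue U \<phi> u) z L \<and> L \<ge> k z"
    using u(3) unfolding visc_super_def by blast
  have C2: "C2_closure UNIV ?\<phi>"
    by (intro C2_closure_lincomb [OF w(1) C2_closure_const])
  have "touches_below U z ?\<phi> u"
    unfolding touches_below_def using C2_closure_subset [OF C2] le by (auto simp: m_def)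
  then obtain L where L: "has_frac_laplacian s (glue U ?\<phi> u) z L" "L \<ge> k z"
    using U(3) by blast
  have "has_frac_laplacian s ?\<phi> z (1 * g z + 1 * 0)"
    by (intro has_frac_laplacian_lincomb g has_frac_laplacian_const)
  then have "L \<le> 1 * g z + 1 * 0"
    using U(2) le by (intro has_frac_laplacian_mono [OF s _ L(1)]) (auto simp: glue_def)
  with g(2) [of z] L(2) show False by simp
qed

section \<open>Barriers and lower bounds for super-solutions\<close>

lemma pot_tendsto_0:
  fixes y :: "real^'n::finite"
  assumes "0 < g" "g < real CARD('n) / 2" "a > 0"
  shows "((\<lambda>x. pot g a (x - y)) \<longlongrightarrow> 0) at_infinity"
proof -
  obtain C where C: "\<And>x :: real^'n. pot g a x \<le> C * (a + (norm x)\<^sup>2) powr (g - real CARD('n) / 2)"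
    using pot_le [OF assms(1,2)] assms(3) by blast
  have "filterlim (\<lambda>x. norm (x - y)) at_top at_infinity"
  proof (rule filterlim_at_top_mono)
    show "filterlim (\<lambda>x. - norm y + norm x) at_top at_infinity"
      by (intro filterlim_tendsto_add_at_top [OF tendsto_const] filterlim_norm_at_top)
    show "\<forall>\<^sub>F x in at_infinity. - norm y + norm x \<le> norm (x - y)"
      by (intro always_eventually allI) (use norm_triangle_ineq2 in fastforce)
  qed
  then have "filterlim (\<lambda>x. a + (norm (x - y))\<^sup>2) at_top at_infinity"
    by (intro filterlim_tendsto_add_at_top [OF tendsto_const] filterlim_pow_at_top) auto
  then have "((\<lambda>x. C * (a + (norm (x - y))\<^sup>2) powr (g - real CARD('n) / 2)) \<longlongrightarrow> C * 0) at_infinity"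
    using assms by (intro tendsto_intros tendsto_neg_powr) auto
  then have lim: "((\<lambda>x. C * (a + (norm (x - y))\<^sup>2) powr (g - real CARD('n) / 2)) \<longlongrightarrow> 0) at_infinity"
    by simp
  show ?thesis
    by (rule tendsto_sandwich [OF _ _ tendsto_const lim]) (intro always_eventually allI C pot_nonneg)+
qed

text \<open>Here \<open>a\<close> is the square of a length scale, \<open>y\<close> the centre and
  \<open>g\<close> the fractional Laplacian of \<open>B\<close>, which can be positive only in the
  closed ball of radius \<open>sqrt (\<Lambda> * a)\<close>. The last clause says that
  \<open>B\<close> still decays no faster than the potential of a bump at that scale.\<close>

definition is_barrier ::
    "real \<Rightarrow> real \<Rightarrow> real \<Rightarrow> real \<Rightarrow> real \<Rightarrow> real^'n::finite \<Rightarrow> (real^'n \<Rightarrow> real) \<Rightarrow> (real^'n \<Rightarrow> real) \<Rightarrow> bool" where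
  "is_barrier s \<Lambda> c C a y B g \<longleftrightarrow> C2_closure UNIV B \<and> (B \<longlongrightarrow> 0) at_infinity \<and>
     (\<forall>x. has_frac_laplacian s B x (g x)) \<and> (\<forall>x. g x \<le> C * a powr (- (real CARD('n) / 2))) \<and>
     (\<forall>x. (norm (x - y))\<^sup>2 > \<Lambda> * a \<longrightarrow> g x < 0) \<and>
     (\<forall>x. B x \<ge> c * (a + (norm (x - y))\<^sup>2) powr (s - real CARD('n) / 2))"

text \<open>The barrier is the potential of \<open>heat a - \<kappa> heat (2a)\<close>: the subtracted, more slowly decaying Gaussian makes its
  fractional Laplacian negative away from the origin, without destroying the decay rate of the potential.\<close>

lemma barrier:
  assumes s: "0 < s" "s < 1" "s < real CARD('n) / 2"
  shows "\<exists>\<Lambda>>0. \<exists>c>0. \<exists>C>0. \<forall>a>0. \<forall>y :: real^'n::finite. \<exists>B g. is_barrier s \<Lambda> c C a y B g"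
proof -
  define \<nu> where "\<nu> = real CARD('n) / 2"
  have \<nu>: "\<nu> > 0" "s < \<nu>" using s by (auto simp: \<nu>_def)
  obtain C1 where C1: "C1 > 0" "\<And>a x. a > 0 \<Longrightarrow> pot s a (x :: real^'n) \<le> C1 * (a + (norm x)\<^sup>2) powr (s - \<nu>)"
    using pot_le [OF s(1,3)] unfolding \<nu>_def by blast
  obtain c1 where c1: "c1 > 0" "\<And>a x. a > 0 \<Longrightarrow> pot s a (x :: real^'n) \<ge> c1 * (a + (norm x)\<^sup>2) powr (s - \<nu>)"
    using pot_ge [OF s(1,3)] unfolding \<nu>_def by blast
  have "\<exists>c>0. \<forall>a>0. \<forall>x y :: real^'n. has_frac_laplacian s (\<lambda>x. pot s a (x - y)) x (c * heat a (x - y))"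
    using has_frac_laplacian_pot [OF s(1,2) order_refl s(3)] by simp
  then obtain d where d: "d > 0" "\<And>a x y. a > 0 \<Longrightarrow> has_frac_laplacian s (\<lambda>x. pot s a (x - y)) x (d * heat a (x - y :: real^'n))"
    by blast
  \<comment> \<open>With this choice the subtracted potential uses up at most half of the lower
    bound for \<open>pot s a\<close>.\<close>
  define \<kappa> where "\<kappa> = c1 / (2 * C1)"
  have \<kappa>: "\<kappa> > 0" using c1 C1 by (simp add: \<kappa>_def)
  \<comment> \<open>With z = |x - y|^2 / (4a), the source \<open>heat a - \<kappa> heat (2a)\<close>
    is negative exactly when exp (-z) < \<kappa> 2^(-n/2); \<Lambda> makes |x - y|^2 > \<Lambda> a
    sufficient for that.\<close>
  define \<Lambda> where "\<Lambda> = 4 * (1 + \<bar>ln (\<kappa> * 2 powr (- \<nu>))\<bar>)"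
  have \<Lambda>: "\<Lambda> > 0" by (simp add: \<Lambda>_def add_pos_nonneg)
  define C where "C = d * (2 * pi) powr (- \<nu>)"
  have "\<exists>B g. is_barrier s \<Lambda> (c1 / 2) C a y B g" if a: "a > 0" for a and y :: "real^'n"
  proof -
    define B where "B x = 1 * pot s a (x - y) + (- \<kappa>) * pot s (2 * a) (x - y)" for x
    define g where "g x = 1 * (d * heat a (x - y)) + (- \<kappa>) * (d * heat (2 * a) (x - y))" for x
    have "C2_closure UNIV B"
      unfolding B_def using s a by (intro C2_closure_lincomb C2_closure_pot) auto
    moreover have "(B \<longlongrightarrow> 0) at_infinity"
    proof -
      have "(B \<longlongrightarrow> 1 * 0 + (- \<kappa>) * 0) at_infinity"
        unfolding B_def using s a by (intro tendsto_intros pot_tendsto_0) auto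
      then show ?thesis by simp
    qed
    moreover have "has_frac_laplacian s B x (g x)" for x
      unfolding B_def g_def using a by (intro has_frac_laplacian_lincomb d) auto
    moreover have "g x \<le> C * a powr (- \<nu>)" for x
    proof -
      have "heat a (x - y) \<le> (2 * pi * a) powr (- \<nu>)"
        unfolding heat_def \<nu>_def using a by (intro mult_left_le) auto
      also have "\<dots> = (2 * pi) powr (- \<nu>) * a powr (- \<nu>)" using a by (simp add: powr_mult)
      finally have "d * heat a (x - y) \<le> C * a powr (- \<nu>)" using d(1) by (simp add: C_def)
      moreover have "\<kappa> * (d * heat (2 * a) (x - y)) \<ge> 0" using \<kappa> d by simp
      ultimately show ?thesis by (simp add: g_def)
    qed
    moreover have "g x < 0" if x: "(norm (x - y))\<^sup>2 > \<Lambda> * a" for x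
    proof -
      define z where "z = (norm (x - y))\<^sup>2 / (4 * a)"
      have "z > 1 + \<bar>ln (\<kappa> * 2 powr (- \<nu>))\<bar>" using x a by (simp add: z_def \<Lambda>_def field_simps)
      then have "- z < ln (\<kappa> * 2 powr (- \<nu>))" by linarith
      then have "exp (- z) < exp (ln (\<kappa> * 2 powr (- \<nu>)))" by (simp only: exp_less_mono)
      then have "exp (- z) < \<kappa> * 2 powr (- \<nu>)" using \<kappa> by simp
      then have "(2 * pi * a) powr (- \<nu>) * exp (- z) * exp (- z) < (2 * pi * a) powr (- \<nu>) * exp (- z) * (\<kappa> * 2 powr (- \<nu>))"
        using a by (intro mult_strict_left_mono) auto
      moreover have "heat a (x - y) = (2 * pi * a) powr (- \<nu>) * exp (- z) * exp (- z)"
        using a by (simp add: heat_def \<nu>_def z_def exp_add [symmetric] field_simps mult.assoc)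
      moreover have "heat (2 * a) (x - y) = (2 * pi * a) powr (- \<nu>) * exp (- z) * 2 powr (- \<nu>)"
      proof -
        have "2 * pi * (2 * a) = 2 * (2 * pi * a)" by simp
        then have "(2 * pi * (2 * a)) powr (- \<nu>) = 2 powr (- \<nu>) * (2 * pi * a) powr (- \<nu>)"
          by (simp only: powr_mult)
        then show ?thesis using a by (simp add: heat_def \<nu>_def z_def)
      qed
      ultimately have "heat a (x - y) < \<kappa> * heat (2 * a) (x - y)" by (simp add: mult_ac)
      then have "d * heat a (x - y) < d * (\<kappa> * heat (2 * a) (x - y))" using d(1) by simp
      then show ?thesis by (simp add: g_def mult_ac)
    qed
    moreover have "B x \<ge> (c1 / 2) * (a + (norm (x - y))\<^sup>2) powr (s - \<nu>)" for x
    proof -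
      have "pot s (2 * a) (x - y) \<le> C1 * (2 * a + (norm (x - y))\<^sup>2) powr (s - \<nu>)" using C1(2) a by simp
      also have "\<dots> \<le> C1 * (a + (norm (x - y))\<^sup>2) powr (s - \<nu>)"
        using C1(1) a \<nu> by (intro mult_left_mono powr_mono2') (auto simp: add_pos_nonneg)
      finally have "\<kappa> * pot s (2 * a) (x - y) \<le> \<kappa> * (C1 * (a + (norm (x - y))\<^sup>2) powr (s - \<nu>))"
        using \<kappa> by (intro mult_left_mono) auto
      also have "\<dots> = (c1 / 2) * (a + (norm (x - y))\<^sup>2) powr (s - \<nu>)" using C1(1) by (simp add: \<kappa>_def)
      finally show ?thesis using c1(2) [OF a, of "x - y"] by (simp add: B_def)
    qed
    ultimately have "is_barrier s \<Lambda> (c1 / 2) C a y B g"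
      unfolding is_barrier_def \<nu>_def [symmetric] by simp
    then show ?thesis by blast
  qed
  moreover have "C > 0" using d(1) by (simp add: C_def)
  moreover have "c1 / 2 > 0" using c1 by simp
  ultimately show ?thesis using \<Lambda> by blast
qed

text \<open>The constants depend on n and s only, not on the solution, the centre, the scale or the
  height M. The bound has the size of the Riesz potential of M times the indicator of a ball of
  radius comparable to \<open>sqrt a\<close>.\<close>

definition lower_bound_consts :: "'n::finite itself \<Rightarrow> real \<Rightarrow> real \<Rightarrow> real \<Rightarrow> bool" where
  "lower_bound_consts _ s \<Lambda> c \<longleftrightarrow> \<Lambda> > 0 \<and> c > 0 \<and> (\<forall>(u :: real^'n \<Rightarrow> real) k y a M. continuous_on UNIV u \<longrightarrow> (\<forall>x. u x \<ge> 0) \<longrightarrow> visc_super s k u \<longrightarrow>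
     (\<forall>x. k x \<ge> 0) \<longrightarrow> a > 0 \<longrightarrow> M > 0 \<longrightarrow> (\<forall>x. (norm (x - y))\<^sup>2 \<le> \<Lambda> * a \<longrightarrow> k x \<ge> M) \<longrightarrow>
     (\<forall>x. u x \<ge> c * M * a powr (real CARD('n) / 2) * (a + (norm (x - y))\<^sup>2) powr (s - real CARD('n) / 2)))"

lemma supersolution_lower_bound:
  assumes s: "0 < s" "s < 1" "s < real CARD('n) / 2"
  shows "\<exists>\<Lambda> c. lower_bound_consts TYPE('n::finite) s \<Lambda> c"
proof -
  define \<nu> where "\<nu> = real CARD('n) / 2"
  obtain \<Lambda> c C where \<Lambda>: "\<Lambda> > 0" and c: "c > 0" and C: "C > 0" and
    B: "\<And>a (y :: real^'n). a > 0 \<Longrightarrow> \<exists>B g. is_barrier s \<Lambda> c C a y B g"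
    using barrier [OF s] by blast
  have main: "u x \<ge> (c / (2 * C)) * M * a powr \<nu> * (a + (norm (x - y))\<^sup>2) powr (s - \<nu>)"
    if u: "continuous_on UNIV u" "\<forall>x. u x \<ge> 0" "visc_super s k u" and k: "\<forall>x. k x \<ge> 0" and a: "a > 0" and M: "M > 0"
     and kM: "\<forall>x. (norm (x - y))\<^sup>2 \<le> \<Lambda> * a \<longrightarrow> k x \<ge> M" for u :: "real^'n \<Rightarrow> real" and k y a M x
  proof -
    obtain B g where "is_barrier s \<Lambda> c C a y B g" using B [OF a] by blast
    then have B: "C2_closure UNIV B" "(B \<longlongrightarrow> 0) at_infinity"
     "\<And>x. has_frac_laplacian s B x (g x)" "\<And>x. g x \<le> C * a powr (- \<nu>)"
     "\<And>x. (norm (x - y))\<^sup>2 > \<Lambda> * a \<Longrightarrow> g x < 0"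
     "\<And>x. B x \<ge> c * (a + (norm (x - y))\<^sup>2) powr (s - \<nu>)"
      unfolding is_barrier_def \<nu>_def by simp_all
    \<comment> \<open>Where the source of the barrier may be positive it is at most C a^(-n/2), so
      this multiple keeps it at most M / 2, strictly below k.\<close>
    define \<theta> where "\<theta> = M * a powr \<nu> / (2 * C)"
    have \<theta>: "\<theta> > 0" using M a C by (simp add: \<theta>_def)
    \<comment> \<open>The empty summand \<open>0 * 0\<close> presents a scalar multiple as a linear
      combination with a constant function, as the \<open>lincomb\<close> lemmas expect.\<close>
    have "\<theta> * B x + 0 * 0 \<le> u x"
    proof (rule comparison [OF s(1,2) u(1) _ u(3)])
      show "u x \<ge> 0" for x using u(2) by simp
      show "C2_closure UNIV (\<lambda>x. \<theta> * B x + 0 * 0)" by (intro C2_closure_lincomb B C2_closure_const)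
      have "((\<lambda>x. \<theta> * B x + 0 * 0) \<longlongrightarrow> \<theta> * 0 + 0 * 0) at_infinity" by (intro tendsto_intros B)
      then show "((\<lambda>x. \<theta> * B x + 0 * 0) \<longlongrightarrow> 0) at_infinity" by simp
      show "has_frac_laplacian s (\<lambda>x. \<theta> * B x + 0 * 0) x (\<theta> * g x + 0 * 0)" for x
        by (intro has_frac_laplacian_lincomb B has_frac_laplacian_const)
      show "\<theta> * g x + 0 * 0 < k x" for x
      proof (cases "(norm (x - y))\<^sup>2 \<le> \<Lambda> * a")
        case True
        have "\<theta> * g x \<le> \<theta> * (C * a powr (- \<nu>))" using \<theta> B(4) by (intro mult_left_mono) auto
        also have "\<dots> = M / 2" using C a by (simp add: \<theta>_def powr_minus)
        also have "\<dots> < k x" using M kM True by force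
        finally show ?thesis by simp
      next
        case False
        then have "\<theta> * g x < 0" using B(5) [of x] \<theta> by (simp add: mult_less_0_iff)
        then show ?thesis using k [rule_format, of x] by simp
      qed
    qed
    moreover have "\<theta> * B x \<ge> \<theta> * (c * (a + (norm (x - y))\<^sup>2) powr (s - \<nu>))"
      using \<theta> B(6) by (intro mult_left_mono) auto
    ultimately show ?thesis by (simp add: \<theta>_def mult_ac)
  qed
  have pos: "c / (2 * C) > 0" using c C by simp
  have "lower_bound_consts TYPE('n) s \<Lambda> (c / (2 * C))"
    unfolding lower_bound_consts_def \<nu>_def [symmetric]
    by (intro conjI \<Lambda> pos allI impI, rule main)
  then show ?thesis by blast
qed

text \<open>The admissible terms form a geometric tail of ratio 4^(-\<nu>), dominated by its first
  term, which is at most y^(-\<nu>).\<close>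

lemma sum_geometric_tail_le:
  fixes y :: real
  assumes "0 < \<nu>" "y > 0"
  shows "(\<Sum>j<K. if y \<le> 4 ^ j then (4 ^ j) powr (- \<nu>) else 0) \<le> y powr (- \<nu>) / (1 - 4 powr (- \<nu>))"
proof -
  define q :: real where "q = 4 powr (- \<nu>)"
  have q: "0 < q" "q < 1" using assms by (auto simp: q_def powr_less_one)
  have pq: "(4 ^ j) powr (- \<nu>) = q ^ j" for j :: nat
    by (simp add: q_def powr_realpow [symmetric] powr_powr mult.commute)
  show ?thesis
  proof (cases "\<exists>j. y \<le> 4 ^ j")
    case False
    then show ?thesis using q assms by (auto simp: q_def [symmetric])
  next
    case True
    define j0 where "j0 = (LEAST j. y \<le> 4 ^ j)"
    have j0: "y \<le> 4 ^ j0" "\<And>j. y \<le> 4 ^ j \<Longrightarrow> j0 \<le> j"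
      using True unfolding j0_def by (auto intro: LeastI_ex Least_le)
    have "(\<Sum>j<K. if y \<le> 4 ^ j then (4 ^ j) powr (- \<nu>) else 0) \<le> (\<Sum>j<K. if j0 \<le> j then q ^ j else 0)"
      using j0(2) q by (intro sum_mono) (auto simp: pq)
    also have "\<dots> = (\<Sum>j\<in>{j0..<K}. q ^ j)"
      by (intro sum.mono_neutral_cong_right) auto
    also have "\<dots> \<le> q ^ j0 / (1 - q)"
    proof (cases "j0 < K")
      case True
      then obtain n where n: "K = Suc n" "j0 \<le> n" by (cases K) auto
      then have "(1 - q) * (\<Sum>j\<in>{j0..<K}. q ^ j) = q ^ j0 - q ^ K"
        using sum_gp_multiplied [of j0 n q] by (simp add: atLeastLessThanSuc_atLeastAtMost)
      also have "\<dots> \<le> q ^ j0" using q by simp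
      finally show ?thesis using q by (simp add: field_simps)
    qed (use q in simp)
    also have "q ^ j0 = (4 ^ j0) powr (- \<nu>)" by (simp add: pq)
    also have "\<dots> / (1 - q) \<le> y powr (- \<nu>) / (1 - q)"
      using q j0(1) assms by (intro divide_right_mono powr_mono2') auto
    finally show ?thesis by (simp add: q_def)
  qed
qed

text \<open>Barriers at scales a = 4^j are added. At a given x those with 4^j much smaller than 1 +
  |x|^2 contribute negatively to the fractional Laplacian, and the others sum geometrically, so the
  total is at most D (1 + |x|^2)^(-n/2) for every number K of scales. The lower bounds, in contrast,
  add up term by term, which is where the logarithm comes from.\<close>

lemma critical_lower_bound:
  fixes u k :: "real^'n::finite \<Rightarrow> real"
  assumes s: "0 < s" "s < 1" "s < real CARD('n) / 2"
    and u: "continuous_on UNIV u" "\<And>x. u x \<ge> 0" "visc_super s k u"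
    and k: "A > 0" "\<And>x. k x \<ge> A * (1 + (norm x)\<^sup>2) powr (- (real CARD('n) / 2))"
  shows "\<exists>c>0. \<forall>(K::nat) x. u x \<ge> c * (\<Sum>j<K. (4 ^ j + (norm x)\<^sup>2) powr (s - real CARD('n) / 2))"
proof -
  define \<nu> where "\<nu> = real CARD('n) / 2"
  have \<nu>: "\<nu> > 0" by (simp add: \<nu>_def)
  obtain \<Lambda> c C where \<Lambda>: "\<Lambda> > 0" and c: "c > 0" and C: "C > 0" and
    ex: "\<And>a. a > 0 \<Longrightarrow> \<exists>B g. is_barrier s \<Lambda> c C a (0 :: real^'n) B g"
    using barrier [OF s] by blast
  have "\<forall>j::nat. \<exists>B g. is_barrier s \<Lambda> c C (4 ^ j) (0 :: real^'n) B g"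
    using ex by simp
  then obtain B g where "\<And>j::nat. is_barrier s \<Lambda> c C (4 ^ j) (0 :: real^'n) (B j) (g j)"
    by metis
  then have B: "\<And>j. C2_closure UNIV (B j)" "\<And>j. (B j \<longlongrightarrow> 0) at_infinity"
    "\<And>j x. has_frac_laplacian s (B j) x (g j x)" "\<And>j x. g j x \<le> C * (4 ^ j) powr (- \<nu>)"
    "\<And>j x. (norm x)\<^sup>2 > \<Lambda> * 4 ^ j \<Longrightarrow> g j x < 0"
    "\<And>j x. B j x \<ge> c * (4 ^ j + (norm x)\<^sup>2) powr (s - \<nu>)"
    unfolding is_barrier_def \<nu>_def by simp_all
  define W where "W K x = (\<Sum>j<K. B j x)" for K :: nat and x
  define G where "G K x = (\<Sum>j<K. g j x)" for K :: nat and x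
  have W: "C2_closure UNIV (W K) \<and> (\<forall>x. has_frac_laplacian s (W K) x (G K x))" for K
  proof (induction K)
    case 0
    then show ?case by (simp add: W_def [abs_def] G_def C2_closure_const has_frac_laplacian_const)
  next
    case (Suc K)
    have "W (Suc K) = (\<lambda>x. 1 * W K x + 1 * B K x)" "G (Suc K) = (\<lambda>x. 1 * G K x + 1 * g K x)"
      by (simp_all add: W_def G_def fun_eq_iff)
    then show ?case
      using Suc B by (simp only:) (intro conjI allI C2_closure_lincomb has_frac_laplacian_lincomb; simp)
  qed
  have W0: "(W K \<longlongrightarrow> 0) at_infinity" for K
    unfolding W_def [abs_def] using tendsto_sum [of "{..<K}" B "\<lambda>_. 0" at_infinity] B(2) by simp
  define q :: real where "q = 4 powr (- \<nu>)"
  have q: "0 < q" "q < 1" using \<nu> by (auto simp: q_def powr_less_one)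
  define D where "D = C * (1 + \<Lambda>) powr \<nu> / (1 - q)"
  have D: "D > 0" using C \<Lambda> q by (simp add: D_def)
  have G: "G K x \<le> D * (1 + (norm x)\<^sup>2) powr (- \<nu>)" for K x
  proof -
    \<comment> \<open>If the j-th source can be positive at x, then |x|^2 \<le> \<Lambda> 4^j;
      together with 1 \<le> 4^j this gives y \<le> 4^j, the cutoff of the geometric sum.\<close>
    define y where "y = (1 + (norm x)\<^sup>2) / (1 + \<Lambda>)"
    have y: "y > 0" using \<Lambda> by (simp add: y_def add_pos_nonneg)
    have "G K x \<le> (\<Sum>j<K. C * (if y \<le> 4 ^ j then (4 ^ j) powr (- \<nu>) else 0))"
      unfolding G_def
    proof (rule sum_mono)
      fix j
      show "g j x \<le> C * (if y \<le> 4 ^ j then (4 ^ j) powr (- \<nu>) else 0)"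
      proof (cases "(norm x)\<^sup>2 > \<Lambda> * 4 ^ j")
        case True
        then have "g j x \<le> 0" using B(5) less_imp_le by blast
        also have "0 \<le> C * (if y \<le> 4 ^ j then (4 ^ j) powr (- \<nu>) else 0)" using C by simp
        finally show ?thesis .
      next
        case False
        then have "1 + (norm x)\<^sup>2 \<le> 4 ^ j + \<Lambda> * 4 ^ j" by (intro add_mono) auto
        then have "y \<le> 4 ^ j" using \<Lambda> by (simp add: y_def divide_le_eq algebra_simps)
        then show ?thesis using B(4) by simp
      qed
    qed
    also have "\<dots> = C * (\<Sum>j<K. if y \<le> 4 ^ j then (4 ^ j) powr (- \<nu>) else 0)"
      by (rule sum_distrib_left [symmetric])
    also have "\<dots> \<le> C * (y powr (- \<nu>) / (1 - q))"
      unfolding q_def using C y \<nu> by (intro mult_left_mono sum_geometric_tail_le) auto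
    also have "y powr (- \<nu>) = (1 + (norm x)\<^sup>2) powr (- \<nu>) * (1 + \<Lambda>) powr \<nu>"
      unfolding y_def using \<Lambda> by (subst powr_divide) (auto simp: powr_minus divide_inverse)
    finally show ?thesis by (simp add: D_def mult_ac)
  qed
  define \<theta> where "\<theta> = A / (2 * D)"
  have \<theta>: "\<theta> > 0" using k D by (simp add: \<theta>_def)
  have "u x \<ge> (\<theta> * c) * (\<Sum>j<K. (4 ^ j + (norm x)\<^sup>2) powr (s - \<nu>))" for K x
  proof -
    have "\<theta> * W K x + 0 * 0 \<le> u x"
    proof (rule comparison [OF s(1,2) u])
      show "C2_closure UNIV (\<lambda>x. \<theta> * W K x + 0 * 0)" using W by (intro C2_closure_lincomb C2_closure_const) auto
      have "((\<lambda>x. \<theta> * W K x + 0 * 0) \<longlongrightarrow> \<theta> * 0 + 0 * 0) at_infinity" by (intro tendsto_intros W0)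
      then show "((\<lambda>x. \<theta> * W K x + 0 * 0) \<longlongrightarrow> 0) at_infinity" by simp
      show "has_frac_laplacian s (\<lambda>x. \<theta> * W K x + 0 * 0) x (\<theta> * G K x + 0 * 0)" for x
        using W by (intro has_frac_laplacian_lincomb has_frac_laplacian_const) auto
      show "\<theta> * G K x + 0 * 0 < k x" for x
      proof -
        let ?p = "(1 + (norm x)\<^sup>2) powr (- \<nu>)"
        have p: "?p > 0" by (simp add: add_pos_nonneg less_imp_neq [symmetric])
        have "\<theta> * G K x \<le> \<theta> * (D * ?p)" using \<theta> G by (intro mult_left_mono) auto
        also have "\<dots> = A * ?p / 2" using D by (simp add: \<theta>_def)
        also have "\<dots> < A * ?p" using mult_pos_pos [OF k(1) p] by linarith
        also have "\<dots> \<le> k x" using k(2) by (simp add: \<nu>_def)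
        finally show ?thesis by simp
      qed
    qed
    moreover have "W K x \<ge> c * (\<Sum>j<K. (4 ^ j + (norm x)\<^sup>2) powr (s - \<nu>))"
      unfolding W_def sum_distrib_left by (intro sum_mono B(6))
    then have "\<theta> * W K x \<ge> \<theta> * (c * (\<Sum>j<K. (4 ^ j + (norm x)\<^sup>2) powr (s - \<nu>)))"
      using \<theta> by (intro mult_left_mono) auto
    ultimately show ?thesis by (simp add: mult.assoc)
  qed
  moreover have "\<theta> * c > 0" using \<theta> c by simp
  ultimately show ?thesis unfolding \<nu>_def by blast
qed

text \<open>A nonlocal strong maximum principle: by continuity k exceeds k y / 2 on a small ball
  around y, and the barrier for that single ball is positive on the whole space.\<close>

lemma supersolution_pos:
  fixes u k :: "real^'n::finite \<Rightarrow> real"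
  assumes s: "0 < s" "s < 1" "s < real CARD('n) / 2"
    and u: "continuous_on UNIV u" "\<And>x. u x \<ge> 0" "visc_super s k u"
    and k: "\<And>x. k x \<ge> 0" "continuous_on UNIV k" "k y > 0"
  shows "u x > 0"
proof -
  obtain \<Lambda> c where "lower_bound_consts TYPE('n) s \<Lambda> c"
    using supersolution_lower_bound [OF s] by blast
  note lb = this [unfolded lower_bound_consts_def]
  have \<Lambda>: "\<Lambda> > 0" and c: "c > 0" using lb by auto
  have "isCont k y" using k(2) by (simp add: continuous_on_eq_continuous_at)
  then obtain d where d: "d > 0" "\<And>x. dist x y < d \<Longrightarrow> dist (k x) (k y) < k y / 2"
    unfolding continuous_at_eps_delta using half_gt_zero [OF k(3)] by blast
  define a where "a = (d / 2)\<^sup>2 / \<Lambda>"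
  have a: "a > 0" using d \<Lambda> by (simp add: a_def)
  have km: "\<forall>x. (norm (x - y))\<^sup>2 \<le> \<Lambda> * a \<longrightarrow> k x \<ge> k y / 2"
  proof (intro allI impI)
    fix x assume "(norm (x - y))\<^sup>2 \<le> \<Lambda> * a"
    then have "(norm (x - y))\<^sup>2 \<le> (d / 2)\<^sup>2" using \<Lambda> by (simp add: a_def)
    then have "norm (x - y) \<le> d / 2" by (rule power2_le_imp_le) (use d(1) in simp)
    then have "dist x y < d" using d(1) by (simp add: dist_norm)
    from d(2) [OF this] show "k x \<ge> k y / 2" unfolding dist_real_def by linarith
  qed
  have "k y / 2 > 0" using k(3) by simp
  have "0 < c * (k y / 2) * a powr (real CARD('n) / 2) * (a + (norm (x - y))\<^sup>2) powr (s - real CARD('n) / 2)"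
    using c k(3) a by (auto simp: add_pos_nonneg less_imp_neq [symmetric])
  also have "\<dots> \<le> u x"
    using lb [THEN conjunct2, THEN conjunct2, rule_format, of u k a "k y / 2" y x, OF u k(1) a \<open>k y / 2 > 0\<close>] km by blast
  finally show ?thesis .
qed

section \<open>The Liouville theorem\<close>

lemma continuous_powr_nonneg:
  fixes f :: "real^'n::finite \<Rightarrow> real"
  assumes "continuous_on UNIV f" "\<And>x. f x \<ge> 0" "p > 0"
  shows "continuous_on UNIV (\<lambda>x. f x powr p)"
  using assms by (intro continuous_on_powr') auto

definition ball_min :: "(real^'n::finite \<Rightarrow> real) \<Rightarrow> real \<Rightarrow> real" where
  "ball_min f R = Inf (f ` cball 0 R)"

lemma ball_min:
  fixes f :: "real^'n::finite \<Rightarrow> real"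
  assumes f: "continuous_on UNIV f" and R: "R \<ge> 0"
  shows "\<exists>z. norm z \<le> R \<and> ball_min f R = f z" "norm x \<le> R \<Longrightarrow> ball_min f R \<le> f x"
proof -
  have "continuous_on (cball 0 R) f" using f by (rule continuous_on_subset) simp
  then obtain z where z: "z \<in> cball 0 R" "\<And>y. y \<in> cball 0 R \<Longrightarrow> f z \<le> f y"
    using continuous_attains_inf [of "cball 0 R" f] R by force
  have "ball_min f R = f z"
    unfolding ball_min_def by (rule cInf_eq_minimum) (use z in auto)
  then show "\<exists>z. norm z \<le> R \<and> ball_min f R = f z" "norm x \<le> R \<Longrightarrow> ball_min f R \<le> f x"
    using z by auto
qed

text \<open>The ball lower bound is used with M the p-th power of the minimum of v and with a = R^2
  / \<Lambda>, so that its ball has radius exactly R. Evaluating it in the same ball gives the first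
  estimate; fixing R = 1 and evaluating in larger balls gives the second.\<close>

lemma ball_min_estimates:
  fixes u v :: "real^'n::finite \<Rightarrow> real"
  assumes s: "0 < s" "s < 1" "s < real CARD('n) / 2" and p: "p > 0"
    and u: "continuous_on UNIV u" "\<And>x. u x \<ge> 0" "visc_super s (\<lambda>x. v x powr p) u"
    and v: "continuous_on UNIV v" "\<And>x. v x > 0"
  shows "\<exists>c>0. \<forall>R>0. ball_min u R \<ge> c * R powr (2 * s) * ball_min v R powr p"
    and "\<exists>c>0. \<forall>R\<ge>1. ball_min u R \<ge> c * R powr (2 * s - real CARD('n))"
proof -
  define \<nu> where "\<nu> = real CARD('n) / 2"
  have \<nu>: "\<nu> > 0" "s < \<nu>" using s by (auto simp: \<nu>_def)
  obtain \<Lambda> c where "lower_bound_consts TYPE('n) s \<Lambda> c"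
    using supersolution_lower_bound [OF s] by blast
  note lb = this [unfolded lower_bound_consts_def]
  have \<Lambda>: "\<Lambda> > 0" and c: "c > 0" using lb by auto
  have mv: "ball_min v R > 0" if "R \<ge> 0" for R
    using ball_min(1) [OF v(1) that] v(2) by auto
  have main: "u x \<ge> c * ball_min v R powr p * (R\<^sup>2 / \<Lambda>) powr \<nu> * (R\<^sup>2 / \<Lambda> + (norm x)\<^sup>2) powr (s - \<nu>)" if R: "R > 0" for R x
  proof -
    have "c * ball_min v R powr p * (R\<^sup>2 / \<Lambda>) powr (real CARD('n) / 2) * (R\<^sup>2 / \<Lambda> + (norm (x - 0))\<^sup>2) powr (s - real CARD('n) / 2) \<le> u x"
    proof (rule lb [THEN conjunct2, THEN conjunct2, rule_format])
      show "ball_min v R powr p > 0" using mv [of R] R by (simp add: less_imp_neq [symmetric])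
      show "R\<^sup>2 / \<Lambda> > 0" using R \<Lambda> by simp
      fix x :: "real^'n" assume "(norm (x - 0))\<^sup>2 \<le> \<Lambda> * (R\<^sup>2 / \<Lambda>)"
      then have "(norm x)\<^sup>2 \<le> R\<^sup>2" using \<Lambda> by simp
      then have "norm x \<le> R" by (rule power2_le_imp_le) (use R in simp)
      then have "ball_min v R \<le> v x" using ball_min(2) [OF v(1)] R by simp
      then show "ball_min v R powr p \<le> v x powr p" using mv [of R] R p by (intro powr_mono2) auto
    qed (use u in auto)
    then show ?thesis by (simp add: \<nu>_def)
  qed
  define e where "e = c * (1 / \<Lambda>) powr \<nu> * (1 / \<Lambda> + 1) powr (s - \<nu>)"
  have e: "e > 0" using c \<Lambda> by (auto simp: e_def add_pos_pos less_imp_neq [symmetric])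
  \<comment> \<open>Two radii are kept: the source is measured on the ball of radius R, the solution
    on that of radius R'. Both conclusions are specialisations.\<close>
  have le: "ball_min u R' \<ge> e * ball_min v R powr p * ((R\<^sup>2) powr \<nu> * (R'\<^sup>2) powr (s - \<nu>))" if R: "0 < R" "R \<le> R'" for R R'
  proof -
    obtain z where z: "norm z \<le> R'" "ball_min u R' = u z" using ball_min(1) [OF u(1), of R'] R by auto
    have "R\<^sup>2 \<le> R'\<^sup>2" "(norm z)\<^sup>2 \<le> R'\<^sup>2" using R z by (auto simp: power_mono)
    then have "R\<^sup>2 / \<Lambda> + (norm z)\<^sup>2 \<le> R'\<^sup>2 / \<Lambda> + R'\<^sup>2"
      using \<Lambda> by (intro add_mono divide_right_mono) auto
    then have "(R\<^sup>2 / \<Lambda> + (norm z)\<^sup>2) powr (s - \<nu>) \<ge> (R'\<^sup>2 * (1 / \<Lambda> + 1)) powr (s - \<nu>)"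
      using R \<Lambda> \<nu> by (intro powr_mono2') (auto simp: distrib_left add_pos_nonneg)
    then have "c * ball_min v R powr p * (R\<^sup>2 / \<Lambda>) powr \<nu> * (R'\<^sup>2 * (1 / \<Lambda> + 1)) powr (s - \<nu>)
      \<le> c * ball_min v R powr p * (R\<^sup>2 / \<Lambda>) powr \<nu> * (R\<^sup>2 / \<Lambda> + (norm z)\<^sup>2) powr (s - \<nu>)"
      using c by (intro mult_left_mono) auto
    also have "\<dots> \<le> ball_min u R'" using main [OF R(1), of z] z by simp
    finally have le: "c * ball_min v R powr p * (R\<^sup>2 / \<Lambda>) powr \<nu> * (R'\<^sup>2 * (1 / \<Lambda> + 1)) powr (s - \<nu>) \<le> ball_min u R'" .
    have eq: "(R\<^sup>2 / \<Lambda>) powr \<nu> = (R\<^sup>2) powr \<nu> * (1 / \<Lambda>) powr \<nu>"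
      by (subst powr_mult [symmetric]) simp
    show ?thesis using le unfolding e_def eq powr_mult by (simp only: mult_ac)
  qed
  have sq: "(R\<^sup>2) powr k = R powr (2 * k)" if "R > 0" for R k :: real
  proof -
    have "R\<^sup>2 = R powr 2" using that by simp
    then show ?thesis by (simp only: powr_powr)
  qed
  have "ball_min u R \<ge> e * R powr (2 * s) * ball_min v R powr p" if R: "R > 0" for R
    using le [OF R order_refl] R by (simp add: sq powr_add [symmetric] mult_ac)
  with e show "\<exists>c>0. \<forall>R>0. ball_min u R \<ge> c * R powr (2 * s) * ball_min v R powr p" by blast
  have "ball_min u R \<ge> (e * ball_min v 1 powr p) * R powr (2 * s - real CARD('n))" if R: "R \<ge> 1" for R
    using le [of 1 R] R sq [of R "s - \<nu>"] by (simp add: \<nu>_def right_diff_distrib)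
  moreover have "e * ball_min v 1 powr p > 0" using e mv [of 1] by simp
  ultimately show "\<exists>c>0. \<forall>R\<ge>1. ball_min u R \<ge> c * R powr (2 * s - real CARD('n))" by blast
qed

lemma liouville_pos:
  fixes u v :: "real^'n::finite \<Rightarrow> real"
  assumes s: "0 < s" "s < 1" "s < real CARD('n) / 2" and t: "0 < t" "t < 1" "t < real CARD('n) / 2"
    and p: "p > 0" "q > 0" "p * q > 1"
    and u: "continuous_on UNIV u" "\<And>x. u x > 0" "visc_super s (\<lambda>x. v x powr p) u"
    and v: "continuous_on UNIV v" "\<And>x. v x > 0" "visc_super t (\<lambda>x. u x powr q) v"
  shows "(2 * s + 2 * t * p) / (p * q - 1) < real CARD('n) - 2 * s"
proof (rule ccontr)
  define \<alpha> where "\<alpha> = (2 * s + 2 * t * p) / (p * q - 1)"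
  define N where "N = real CARD('n)"
  assume "\<not> (2 * s + 2 * t * p) / (p * q - 1) < real CARD('n) - 2 * s"
  then have \<alpha>N: "N - 2 * s \<le> \<alpha>" by (simp add: \<alpha>_def N_def)
  have \<alpha>: "\<alpha> * (p * q - 1) = 2 * s + 2 * t * p" using p by (simp add: \<alpha>_def)
  obtain c1 where c1: "c1 > 0" "\<And>R. R > 0 \<Longrightarrow> ball_min u R \<ge> c1 * R powr (2 * s) * ball_min v R powr p"
    using ball_min_estimates(1) [OF s p(1) u(1) less_imp_le [OF u(2)] u(3) v(1,2)] by blast
  obtain c2 where c2: "c2 > 0" "\<And>R. R > 0 \<Longrightarrow> ball_min v R \<ge> c2 * R powr (2 * t) * ball_min u R powr q"
    using ball_min_estimates(1) [OF t p(2) v(1) less_imp_le [OF v(2)] v(3) u(1,2)] by blast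
  obtain c0 where c0: "c0 > 0" "\<And>R. R \<ge> 1 \<Longrightarrow> ball_min u R \<ge> c0 * R powr (2 * s - N)"
    using ball_min_estimates(2) [OF s p(1) u(1) less_imp_le [OF u(2)] u(3) v(1,2)] unfolding N_def by blast
  have mu: "ball_min u R > 0" if "R > 0" for R
    using ball_min(1) [OF u(1), of R] u(2) that by auto
  have "\<exists>C>0. \<forall>R>0. ball_min u R \<le> C * R powr (- \<alpha>)"
  proof -
    define e where "e = c1 * c2 powr p"
    have e: "e > 0" using c1 c2 by (simp add: e_def)
    have "ball_min u R \<le> (1 / e) powr (1 / (p * q - 1)) * R powr (- \<alpha>)" if R: "R > 0" for R
    proof -
      let ?m = "ball_min u R"
      have m: "?m > 0" using mu [OF R] .
      have "(c2 * R powr (2 * t) * ?m powr q) powr p \<le> ball_min v R powr p"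
        using c2(1) c2(2) [of R] R p by (intro powr_mono2) auto
      then have "c1 * R powr (2 * s) * (c2 * R powr (2 * t) * ?m powr q) powr p \<le> c1 * R powr (2 * s) * ball_min v R powr p"
        using c1 by (intro mult_left_mono) auto
      also have "\<dots> \<le> ?m" by (rule c1(2) [OF R])
      also have "(c2 * R powr (2 * t) * ?m powr q) powr p = c2 powr p * R powr (2 * t * p) * ?m powr (q * p)"
        by (simp add: powr_mult powr_powr)
      finally have "e * R powr (2 * s + 2 * t * p) * ?m powr (q * p) \<le> ?m"
        by (simp add: e_def powr_add mult_ac)
      \<comment> \<open>Splitting off one factor \<open>?m\<close> leaves the positive exponent p q
        - 1, whose root bounds the minimum from above.\<close>
      also have "?m powr (q * p) = ?m powr (p * q - 1) * ?m"
        using m by (simp add: powr_diff mult.commute)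
      finally have "(e * R powr (2 * s + 2 * t * p) * ?m powr (p * q - 1)) * ?m \<le> 1 * ?m" by (simp add: mult.assoc)
      then have "e * R powr (2 * s + 2 * t * p) * ?m powr (p * q - 1) \<le> 1" using m by (simp only: mult_le_cancel_right_pos)
      then have "?m powr (p * q - 1) \<le> (1 / e) * R powr (- (2 * s + 2 * t * p))"
      proof -
        define E where "E = 2 * s + 2 * t * p"
        have "R powr E > 0" using R by simp
        moreover have "(e * R powr E) * ?m powr (p * q - 1) \<le> 1"
          using \<open>e * R powr (2 * s + 2 * t * p) * ?m powr (p * q - 1) \<le> 1\<close> by (simp add: E_def)
        ultimately have "?m powr (p * q - 1) \<le> 1 / (e * R powr E)"
          using e by (subst pos_le_divide_eq) (auto simp: mult.commute)
        then show ?thesis by (simp add: powr_minus_divide E_def [symmetric])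
      qed
      then have "(?m powr (p * q - 1)) powr (1 / (p * q - 1)) \<le> ((1 / e) * R powr (- (2 * s + 2 * t * p))) powr (1 / (p * q - 1))"
        using p by (intro powr_mono2) auto
      moreover have "(?m powr (p * q - 1)) powr (1 / (p * q - 1)) = ?m"
        using m p by (simp add: powr_powr)
      moreover have "- (2 * s + 2 * t * p) * (1 / (p * q - 1)) = - \<alpha>"
        unfolding \<alpha>_def by (simp only: mult_minus_left times_divide_eq_right mult_1_right)
      ultimately show ?thesis by (simp only: powr_mult powr_powr)
    qed
    moreover have "(1 / e) powr (1 / (p * q - 1)) > 0" using e by simp
    ultimately show ?thesis by blast
  qed
  then obtain C where C: "C > 0" "\<And>R. R > 0 \<Longrightarrow> ball_min u R \<le> C * R powr (- \<alpha>)" by blast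
  show False
  proof (cases "\<alpha> = N - 2 * s")
    case False
    define \<beta> where "\<beta> = \<alpha> - (N - 2 * s)"
    have \<beta>: "\<beta> > 0" using False \<alpha>N by (simp add: \<beta>_def)
    have bd: "R powr \<beta> \<le> C / c0" if R: "R \<ge> 1" for R
    proof -
      have "c0 * R powr (2 * s - N) \<le> C * R powr (- \<alpha>)"
        using c0(2) [OF R] C(2) [of R] R by linarith
      then have "c0 * R powr (2 * s - N) * R powr \<alpha> \<le> C * R powr (- \<alpha>) * R powr \<alpha>"
        by (intro mult_right_mono) auto
      then have "c0 * R powr (2 * s - N + \<alpha>) \<le> C"
        using R by (simp add: powr_add [symmetric] mult.assoc)
      then show ?thesis using c0(1) by (simp add: \<beta>_def field_simps)
    qed
    \<comment> \<open>Chosen so that R^\<beta> = 1 + C / c0, one more than the bound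
      permits.\<close>
    define R where "R = (1 + C / c0) powr (1 / \<beta>)"
    have "1 + C / c0 \<ge> 1" using C c0 by simp
    then have "R \<ge> 1" using \<beta> ge_one_powr_ge_zero [of "1 + C / c0" "1 / \<beta>"] by (simp add: R_def)
    then have "R powr \<beta> \<le> C / c0" by (rule bd)
    moreover have "R powr \<beta> = 1 + C / c0" using \<beta> \<open>1 + C / c0 \<ge> 1\<close> by (simp add: R_def powr_powr)
    ultimately show False by simp
  next
    case True
    have N: "N > 0" by (simp add: N_def)
    define A where "A = (c2 * c0 powr q) powr p"
    have A: "A > 0" using c2 c0 by (simp add: A_def)
    have kA: "v x powr p \<ge> A * (1 + (norm x)\<^sup>2) powr (- (real CARD('n) / 2))" for x
    proof -
      \<comment> \<open>The radius is adapted to x: the ball contains x, R \<ge> 1 as the lower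
        bound for the minimum of u requires, and R^2 is the quantity in the claim.\<close>
      define R where "R = sqrt (1 + (norm x)\<^sup>2)"
      have R: "R \<ge> 1" "norm x \<le> R" by (auto simp: R_def intro: real_le_rsqrt)
      have "c0 * R powr (- \<alpha>) \<le> ball_min u R" using c0(2) [OF R(1)] True by simp
      then have "(c0 * R powr (- \<alpha>)) powr q \<le> ball_min u R powr q"
        using c0 p by (intro powr_mono2) auto
      then have "c2 * R powr (2 * t) * (c0 * R powr (- \<alpha>)) powr q \<le> c2 * R powr (2 * t) * ball_min u R powr q"
        using c2 by (intro mult_left_mono) auto
      also have "\<dots> \<le> ball_min v R" using c2(2) [of R] R by simp
      also have "\<dots> \<le> v x" using ball_min(2) [OF v(1)] R by simp
      also have "c2 * R powr (2 * t) * (c0 * R powr (- \<alpha>)) powr q = (c2 * c0 powr q) * R powr (2 * t - \<alpha> * q)"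
      proof -
        have "2 * t - \<alpha> * q = 2 * t + (- \<alpha>) * q" by simp
        then show ?thesis by (simp only: powr_mult powr_powr powr_add mult_ac)
      qed
      finally have "((c2 * c0 powr q) * R powr (2 * t - \<alpha> * q)) powr p \<le> v x powr p"
        using c2 p by (intro powr_mono2) auto
      moreover have "((c2 * c0 powr q) * R powr (2 * t - \<alpha> * q)) powr p = A * R powr ((2 * t - \<alpha> * q) * p)"
        by (simp only: A_def powr_mult powr_powr)
      \<comment> \<open>Criticality enters here: \<alpha> (p q - 1) = 2 s + 2 t p and \<alpha> = n -
        2 s give exponent -n.\<close>
      moreover have "(2 * t - \<alpha> * q) * p = 2 * (- (real CARD('n) / 2))"
      proof -
        have "(2 * t - \<alpha> * q) * p = 2 * t * p - \<alpha> * (p * q - 1) - \<alpha>" by (simp add: algebra_simps)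
        also have "\<dots> = - (2 * s + \<alpha>)" unfolding \<alpha> by simp
        finally show ?thesis using True by (simp add: N_def)
      qed
      moreover have "R powr (2 * (- (real CARD('n) / 2))) = (1 + (norm x)\<^sup>2) powr (- (real CARD('n) / 2))"
      proof -
        have "R powr 2 = 1 + (norm x)\<^sup>2" using R by (simp add: R_def)
        then show ?thesis by (simp only: powr_powr [symmetric])
      qed
      ultimately show ?thesis by simp
    qed
    obtain c where c: "c > 0" "\<And>(K::nat) x. u x \<ge> c * (\<Sum>j<K. (4 ^ j + (norm x)\<^sup>2) powr (s - real CARD('n) / 2))"
      using critical_lower_bound [OF s u(1) less_imp_le [OF u(2)] u(3) A kA] by blast
    define e where "e = c * 2 powr (s - N / 2)"
    have e: "e > 0" using c by (simp add: e_def)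
    \<comment> \<open>At radius R = 2^K all K summands are at least (2 R^2)^(s - n/2), a constant
      times R^(-\<alpha>), while the minimum of u is at most C R^(-\<alpha>). Cancelling the power
      leaves a bound on K.\<close>
    have bd: "e * real K \<le> C" for K
    proof -
      define R :: real where "R = 2 ^ K"
      have R: "R \<ge> 1" "R\<^sup>2 = 4 ^ K"
        by (simp_all add: R_def power2_eq_square power_mult_distrib [symmetric])
      obtain z where z: "norm z \<le> R" "ball_min u R = u z" using ball_min(1) [OF u(1), of R] R by auto
      have "e * real K * R powr (- \<alpha>) = c * (\<Sum>j<K. (2 * R\<^sup>2) powr (s - N / 2))"
      proof -
        have "(2 * R\<^sup>2) powr (s - N / 2) = 2 powr (s - N / 2) * R powr (2 * (s - N / 2))"
        proof -
          have "R\<^sup>2 = R powr 2" using R by simp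
          then show ?thesis by (simp only: powr_mult powr_powr)
        qed
        moreover have "2 * (s - N / 2) = - \<alpha>" using True by simp
        ultimately show ?thesis by (simp add: e_def)
      qed
      also have "\<dots> \<le> c * (\<Sum>j<K. (4 ^ j + (norm z)\<^sup>2) powr (s - N / 2))"
      proof (intro mult_left_mono sum_mono powr_mono2')
        fix j assume "j \<in> {..<K}"
        then have "(4::real) ^ j \<le> 4 ^ K" by (intro power_increasing) auto
        moreover have "(norm z)\<^sup>2 \<le> R\<^sup>2" using z by (simp add: power_mono)
        ultimately show "4 ^ j + (norm z)\<^sup>2 \<le> 2 * R\<^sup>2" using R(2) by linarith
      qed (use c s in \<open>auto simp: N_def add_pos_nonneg\<close>)
      also have "\<dots> \<le> u z" using c(2) [of z K] by (simp add: N_def)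
      also have "\<dots> \<le> C * R powr (- \<alpha>)" using C(2) [of R] R z by simp
      finally show ?thesis using R by (simp add: mult_le_cancel_right)
    qed
    obtain K :: nat where "C / e < real K" using reals_Archimedean2 by blast
    then show False using bd [of K] e by (simp add: field_simps)
  qed
qed

text \<open>By \<open>supersolution_pos\<close>, positivity of either component at one point makes
  the other positive everywhere, and a second application returns it to the first. A nontrivial pair
  is therefore strictly positive, which is the case settled by \<open>liouville_pos\<close>.\<close>

lemma liouville:
  fixes u v :: "real^'n::finite \<Rightarrow> real"
  assumes s: "0 < s" "s < 1" "s < real CARD('n) / 2" and t: "0 < t" "t < 1" "t < real CARD('n) / 2"
    and p: "p > 0" "q > 0" "p * q > 1"
    and u: "continuous_on UNIV u" "\<And>x. u x \<ge> 0" "visc_super s (\<lambda>x. v x powr p) u"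
    and v: "continuous_on UNIV v" "\<And>x. v x \<ge> 0" "visc_super t (\<lambda>x. u x powr q) v"
    and ge: "(2 * s + 2 * t * p) / (p * q - 1) \<ge> real CARD('n) - 2 * s"
  shows "u = (\<lambda>x. 0) \<and> v = (\<lambda>x. 0)"
proof (rule ccontr)
  assume nz: "\<not> (u = (\<lambda>x. 0) \<and> v = (\<lambda>x. 0))"
  have vu: "u x > 0" if "v y > 0" for x y
    by (rule supersolution_pos [OF s u, of y]) (use that continuous_powr_nonneg [OF v(1,2) p(1)] in \<open>auto simp: less_imp_neq [symmetric]\<close>)
  have uv: "v x > 0" if "u y > 0" for x y
    by (rule supersolution_pos [OF t v, of y]) (use that continuous_powr_nonneg [OF u(1,2) p(2)] in \<open>auto simp: less_imp_neq [symmetric]\<close>)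
  obtain y where "u y > 0 \<or> v y > 0"
    using nz u(2) v(2) by (auto simp: fun_eq_iff less_le)
  then have "u x > 0 \<and> v x > 0" for x using vu uv by blast
  then have "(2 * s + 2 * t * p) / (p * q - 1) < real CARD('n) - 2 * s"
    using s t p u v by (intro liouville_pos [where u = u and v = v]) auto
  with ge show False by simp
qed

section \<open>Classical supersolutions\<close>

text \<open>Vanishing to second order at x makes the integral absolutely convergent, without
  symmetrisation; smoothness away from x is not involved, so functions that jump across the boundary
  of a ball are covered.\<close>

lemma has_frac_laplacian_quadratic:
  fixes d :: "real^'n::finite \<Rightarrow> real"
  assumes s: "0 < s" "s < 1" and [measurable]: "d \<in> borel_measurable borel"
    and d: "d x = 0" "\<And>z. \<bar>d (x + z)\<bar> \<le> C * min 1 ((norm z)\<^sup>2)"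
  shows "has_frac_laplacian s d x (- (frac_const TYPE('n) s * (\<integral>y. d y * frac_kernel s (x - y) \<partial>lborel)))"
proof -
  define D where "D y = d y * frac_kernel s (x - y)" for y
  have [measurable]: "D \<in> borel_measurable borel" unfolding D_def by measurable
  have Dz: "D (x + z) = d (x + z) * frac_kernel s z" for z
    by (simp add: D_def)
  have "integrable lborel (\<lambda>z. D (x + z))"
    unfolding Dz by (rule integrable_frac_kernel [OF s _ d(2)]) measurable
  then have int: "integrable lborel D" using integrable_translate_iff [of D x] by simp
  have intS: "integrable lborel (\<lambda>y. indicator (- ball x \<epsilon>) y * D y)" for \<epsilon>
    using integrable_real_mult_indicator [OF _ int, of "- ball x \<epsilon>"] by (simp add: mult.commute)
  have eq: "indicator (- ball x \<epsilon>) y *\<^sub>R ((d x - d y) / norm (x - y) powr (real CARD('n) + 2 * s)) = - (indicator (- ball x \<epsilon>) y * D y)" for \<epsilon> y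
    unfolding D_def powr_minus by (simp add: d(1) divide_inverse)
  have lim: "((\<lambda>\<epsilon>. \<integral>y. indicator (- ball x \<epsilon>) y * D y \<partial>lborel) \<longlongrightarrow> (\<integral>y. D y \<partial>lborel)) (at_right 0)"
    using int by (rule tendsto_integral_off_ball) (simp add: D_def)
  show ?thesis
    unfolding has_frac_laplacian_def set_integrable_def set_lebesgue_integral_def eq D_def [symmetric]
  proof (intro conjI allI impI)
    show "integrable lborel (\<lambda>y. - (indicator (- ball x \<epsilon>) y * D y))" for \<epsilon> using intS by simp
    have "((\<lambda>\<epsilon>. - (frac_const TYPE('n) s * (\<integral>y. indicator (- ball x \<epsilon>) y * D y \<partial>lborel))) \<longlongrightarrow> - (frac_const TYPE('n) s * (\<integral>y. D y \<partial>lborel))) (at_right 0)"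
      by (intro tendsto_intros lim)
    then show "((\<lambda>\<epsilon>. frac_const TYPE('n) s * (\<integral>y. - (indicator (- ball x \<epsilon>) y * D y) \<partial>lborel)) \<longlongrightarrow> - (frac_const TYPE('n) s * (\<integral>y. D y \<partial>lborel))) (at_right 0)"
      by simp
  qed
qed

text \<open>The glued function is u - d, where d is u - \<phi> inside the ball and 0 outside. As d
  is nonnegative and vanishes to second order at x, subtracting it adds a nonnegative amount to the
  fractional Laplacian.\<close>

lemma has_frac_laplacian_glue:
  fixes u \<phi> :: "real^'n::finite \<Rightarrow> real"
  assumes s: "0 < s" "s < 1" and u: "C2_closure UNIV u" "has_frac_laplacian s u x L"
    and \<phi>: "touches_below (ball x 1) x \<phi> u"
  shows "\<exists>L'. has_frac_laplacian s (glue (ball x 1) \<phi> u) x L' \<and> L' \<ge> L"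
proof -
  define U where "U = ball x 1"
  define e where "e y = 1 * u y + (- 1) * \<phi> y" for y
  define d where "d y = (if y \<in> U then e y else 0)" for y
  have \<phi>': "C2_closure U \<phi>" "u x = \<phi> x" "\<And>y. y \<in> U \<Longrightarrow> \<phi> y \<le> u y"
    using \<phi> by (auto simp: touches_below_def U_def)
  have eC: "C2_closure U e"
    unfolding e_def by (intro C2_closure_lincomb C2_closure_subset [OF u(1)] \<phi>')
  have e0: "e x = 0" and e_nonneg: "\<And>y. y \<in> U \<Longrightarrow> e y \<ge> 0" using \<phi>' by (auto simp: e_def)
  have xU: "x \<in> U" "open U" by (auto simp: U_def)
  have ec: "continuous_on (closure U) e" using eC by (simp add: C2_closure_def)
  have "compact (closure U)" by (simp add: U_def)
  then have "bounded (e ` closure U)" using ec by (intro compact_imp_bounded compact_continuous_image)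
  then obtain M where M: "\<And>y. y \<in> closure U \<Longrightarrow> \<bar>e y\<bar> \<le> M" unfolding bounded_iff by auto
  obtain g r B where r: "r > 0" and g: "(e has_derivative (\<lambda>h. g \<bullet> h)) (at x)"
    and B: "\<And>z. norm z < r \<Longrightarrow> \<bar>e (x + z) - e x - g \<bullet> z\<bar> \<le> B * (norm z)\<^sup>2"
    using C2_closure_taylor [OF eC xU(2,1)] by blast
  \<comment> \<open>The difference has an interior minimum at x, so its gradient vanishes and only
    the quadratic Taylor remainder survives.\<close>
  have "(\<lambda>h. g \<bullet> h) = (\<lambda>h. 0)"
    by (rule differential_zero_maxmin [OF xU g]) (use e0 e_nonneg in auto)
  then have g0: "g \<bullet> z = 0" for z by (rule fun_cong)
  have M0: "M \<ge> 0" using M [of x] xU closure_subset [of U] by force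
  have "\<exists>C. \<forall>z. \<bar>d (x + z)\<bar> \<le> C * min 1 ((norm z)\<^sup>2)"
  proof (rule local_quadratic_bound)
    show "min r 1 > 0" using r by simp
    show "\<bar>d (x + z)\<bar> \<le> B * (norm z)\<^sup>2" if "norm z < min r 1" for z
      using B [of z] that e0 g0 by (simp add: d_def U_def dist_norm)
    show "\<bar>d (x + z)\<bar> \<le> M" for z
      using M [of "x + z"] M0 closure_subset [of U] by (auto simp: d_def)
  qed
  then obtain C where d_bound: "\<And>z. \<bar>d (x + z)\<bar> \<le> C * min 1 ((norm z)\<^sup>2)" by blast
  have "(\<lambda>y. indicator U y *\<^sub>R e y) \<in> borel_measurable borel"
    by (rule borel_measurable_continuous_on_indicator)
       (use xU continuous_on_subset [OF ec closure_subset] in auto)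
  moreover have "(\<lambda>y. indicator U y *\<^sub>R e y) = d" by (auto simp: d_def fun_eq_iff)
  ultimately have dm: "d \<in> borel_measurable borel" by simp
  have d0: "d x = 0" using e0 by (simp add: d_def)
  define I where "I = (\<integral>y. d y * frac_kernel s (x - y) \<partial>lborel)"
  have I: "I \<ge> 0"
    unfolding I_def using e_nonneg by (intro Bochner_Integration.integral_nonneg mult_nonneg_nonneg) (auto simp: d_def)
  have "has_frac_laplacian s d x (- (frac_const TYPE('n) s * I))"
    unfolding I_def by (rule has_frac_laplacian_quadratic [OF s dm d0 d_bound])
  then have "has_frac_laplacian s (\<lambda>y. 1 * u y + (- 1) * d y) x (1 * L + (- 1) * (- (frac_const TYPE('n) s * I)))"
    by (intro has_frac_laplacian_lincomb u)
  moreover have "(\<lambda>y. 1 * u y + (- 1) * d y) = glue (ball x 1) \<phi> u"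
    by (auto simp: fun_eq_iff glue_def d_def e_def U_def)
  moreover have "L \<le> 1 * L + (- 1) * (- (frac_const TYPE('n) s * I))"
    using I frac_const_pos [OF s, where ?'n = 'n] by simp
  ultimately show ?thesis by (intro exI [of _ "1 * L + (- 1) * (- (frac_const TYPE('n) s * I))"]) simp
qed

lemma classical_imp_viscosity:
  fixes u v :: "real^'n::finite \<Rightarrow> real"
  assumes s: "0 < s" "s < 1" and t: "0 < t" "t < 1"
    and "C2_closure UNIV u" "C2_closure UNIV v" "\<And>x. u x \<ge> 0" "\<And>x. v x \<ge> 0"
    and u: "\<And>x. has_frac_laplacian s u x (f x)" "\<And>x. f x \<ge> v x powr p"
    and v: "\<And>x. has_frac_laplacian t v x (g x)" "\<And>x. g x \<ge> u x powr q"
  shows "nonneg_viscosity_supersolution s t p q u v"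
  unfolding nonneg_viscosity_supersolution_def viscosity_supersolution_def
proof (intro conjI allI)
  show "continuous_on UNIV u" "continuous_on UNIV v"
    using assms by (simp_all add: C2_closure_def)
  fix x0
  have "\<exists>L. has_frac_laplacian s (glue (ball x0 1) \<phi> u) x0 L \<and> L \<ge> v x0 powr p" if "touches_below (ball x0 1) x0 \<phi> u" for \<phi>
    using has_frac_laplacian_glue [OF s \<open>C2_closure UNIV u\<close> u(1) that] u(2) [of x0] by force
  moreover have "\<exists>L. has_frac_laplacian t (glue (ball x0 1) \<psi> v) x0 L \<and> L \<ge> u x0 powr q" if "touches_below (ball x0 1) x0 \<psi> v" for \<psi>
    using has_frac_laplacian_glue [OF t \<open>C2_closure UNIV v\<close> v(1) that] v(2) [of x0] by force
  ultimately show "\<exists>U. open U \<and> x0 \<in> U \<and>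
        (\<forall>\<phi>. touches_below U x0 \<phi> u \<longrightarrow> (\<exists>L. has_frac_laplacian s (glue U \<phi> u) x0 L \<and> L \<ge> v x0 powr p)) \<and>
        (\<forall>\<psi>. touches_below U x0 \<psi> v \<longrightarrow> (\<exists>L. has_frac_laplacian t (glue U \<psi> v) x0 L \<and> L \<ge> u x0 powr q))"
    by (intro exI [of _ "ball x0 1"]) auto
qed (use assms in auto)

section \<open>The trivial super-solution and a nontrivial one\<close>

lemma zero_supersolution:
  assumes "0 < s" "s < 1" "0 < t" "t < 1"
  shows "nonneg_viscosity_supersolution s t p q (\<lambda>x :: real^'n::finite. 0) (\<lambda>x. 0)"
  by (rule classical_imp_viscosity [where f = "\<lambda>x. 0" and g = "\<lambda>x. 0"])
     (use assms in \<open>auto intro: C2_closure_const has_frac_laplacian_const\<close>)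

text \<open>Potentials are comparable to powers of 1 + |x|^2 from both sides. The balance condition
  on the exponents says that the p-th power of \<open>pot d 1\<close> and the fractional Laplacian
  of \<open>pot g 1\<close> decay at the same rate, so a constant factor suffices.\<close>

lemma pot_dominates_powr:
  fixes g d s p :: real
  assumes s: "0 < s" "s < 1" "s < g" "g < real CARD('n) / 2" and d: "0 < d" "d < real CARD('n) / 2"
    and p: "p > 0" and e: "(d - real CARD('n) / 2) * p = g - s - real CARD('n) / 2"
  shows "\<exists>c>0. \<exists>k>0. \<forall>x :: real^'n::finite.
    has_frac_laplacian s (pot g 1) x (c * pot (g - s) 1 x) \<and> k * pot d 1 x powr p \<le> c * pot (g - s) 1 x"
proof -
  obtain c where c: "c > 0" "\<And>x y :: real^'n. has_frac_laplacian s (\<lambda>x. pot g 1 (x - y)) x (c * (if g = s then heat 1 (x - y) else pot (g - s) 1 (x - y)))"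
    using has_frac_laplacian_pot [OF s(1,2) less_imp_le [OF s(3)] s(4)] zero_less_one by blast
  obtain l where l: "l > 0" "\<And>x :: real^'n. l * (1 + (norm x)\<^sup>2) powr (g - s - real CARD('n) / 2) \<le> pot (g - s) 1 x"
    using pot_ge [of "g - s", where ?'n = 'n] s zero_less_one by auto
  obtain D where D: "D > 0" "\<And>x :: real^'n. pot d 1 x \<le> D * (1 + (norm x)\<^sup>2) powr (d - real CARD('n) / 2)"
    using pot_le [OF d] zero_less_one by blast
  define k where "k = c * l / D powr p"
  have k: "k > 0" using c l D by (simp add: k_def)
  have "k * pot d 1 x powr p \<le> c * pot (g - s) 1 x" for x :: "real^'n"
  proof -
    have "pot d 1 x powr p \<le> (D * (1 + (norm x)\<^sup>2) powr (d - real CARD('n) / 2)) powr p"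
      using D p by (intro powr_mono2) auto
    also have "\<dots> = D powr p * (1 + (norm x)\<^sup>2) powr (g - s - real CARD('n) / 2)"
      by (simp only: powr_mult powr_powr e)
    finally have "k * pot d 1 x powr p \<le> k * (D powr p * (1 + (norm x)\<^sup>2) powr (g - s - real CARD('n) / 2))"
      using k by (intro mult_left_mono) auto
    also have "\<dots> = c * (l * (1 + (norm x)\<^sup>2) powr (g - s - real CARD('n) / 2))"
      using D by (simp add: k_def)
    also have "\<dots> \<le> c * pot (g - s) 1 x" using l c by (intro mult_left_mono) auto
    finally show ?thesis .
  qed
  moreover have "has_frac_laplacian s (pot g 1) x (c * pot (g - s) 1 x)" for x :: "real^'n"
    using c(2) [of 0 x] s by simp
  ultimately show ?thesis using c k by blast
qed

lemma supersolution_exists: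
  fixes s t p q :: real
  assumes s: "0 < s" "s < 1" and t: "0 < t" "t < 1"
    and p: "p > 0" "q > 0" "p * q > 1"
    and \<alpha>: "(2 * s + 2 * t * p) / (p * q - 1) < real CARD('n) - 2 * s"
    and \<beta>: "(2 * t + 2 * s * q) / (p * q - 1) < real CARD('n) - 2 * t"
  shows "\<exists>u v :: real^'n::finite \<Rightarrow> real. nonneg_viscosity_supersolution s t p q u v \<and> u 0 > 0"
proof -
  define N where "N = real CARD('n)"
  define \<alpha> where "\<alpha> = (2 * s + 2 * t * p) / (p * q - 1)"
  define \<beta> where "\<beta> = (2 * t + 2 * s * q) / (p * q - 1)"
  have pos: "\<alpha> > 0" "\<beta> > 0" using s t p by (auto simp: \<alpha>_def \<beta>_def intro!: divide_pos_pos add_pos_pos)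
  have pq: "p * q - 1 \<noteq> 0" using p by simp
  \<comment> \<open>These are the scaling relations: they match the decay of each right-hand side
    with that of the corresponding fractional Laplacian.\<close>
  have ab: "\<beta> * p = \<alpha> + 2 * s" "\<alpha> * q = \<beta> + 2 * t"
    unfolding \<alpha>_def \<beta>_def using pq by (simp_all add: field_simps)
  \<comment> \<open>The order is chosen so that \<open>pot g 1\<close> decays like |x|^(-\<alpha>).
    Then g > s is exactly \<alpha> < n - 2 s, and g < n/2 is \<alpha> > 0; likewise for d and
    \<beta>.\<close>
  define g where "g = (N - \<alpha>) / 2"
  define d where "d = (N - \<beta>) / 2"
  have g: "s < g" "g < real CARD('n) / 2" and d: "t < d" "d < real CARD('n) / 2"
    using \<alpha> \<beta> pos by (auto simp: g_def d_def N_def \<alpha>_def [symmetric] \<beta>_def [symmetric])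
  have e1: "(d - real CARD('n) / 2) * p = g - s - real CARD('n) / 2"
    and e2: "(g - real CARD('n) / 2) * q = d - t - real CARD('n) / 2"
    using ab by (auto simp: g_def d_def N_def field_simps)
  obtain c1 k1 where 1: "c1 > 0" "k1 > 0" "\<And>x :: real^'n. has_frac_laplacian s (pot g 1) x (c1 * pot (g - s) 1 x)"
    "\<And>x :: real^'n. k1 * pot d 1 x powr p \<le> c1 * pot (g - s) 1 x"
    using pot_dominates_powr [OF s g _ d(2) p(1) e1] t d by auto
  obtain c2 k2 where 2: "c2 > 0" "k2 > 0" "\<And>x :: real^'n. has_frac_laplacian t (pot d 1) x (c2 * pot (d - t) 1 x)"
    "\<And>x :: real^'n. k2 * pot g 1 x powr q \<le> c2 * pot (d - t) 1 x"
    using pot_dominates_powr [OF t d _ g(2) p(2) e2] s g by auto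
  text \<open>The amplitudes solve \<open>B\<^sup>p = A k\<^sub>1\<close> and \<open>A\<^sup>q = B k\<^sub>2\<close>.\<close>
  define K where "K = k1 powr (1 / p) * k2"
  define r where "r = q - 1 / p"
  have K: "K > 0" using 1 2 by (simp add: K_def)
  have r: "r > 0" using p by (simp add: r_def field_simps)
  \<comment> \<open>Eliminating \<open>B\<close> from the two equations leaves A^r = K, solvable
    since p q > 1 makes r positive.\<close>
  define A where "A = K powr (1 / r)"
  define B where "B = (A * k1) powr (1 / p)"
  have A: "A > 0" using K by (simp add: A_def)
  have B: "B > 0" using A 1 by (simp add: B_def)
  have Bp: "B powr p = A * k1" using A 1 p by (simp add: B_def powr_powr)
  have Aq: "A powr q = B * k2"
  proof -
    have "A powr r = K" using K r by (simp add: A_def powr_powr)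
    then have "A powr (1 / p) * A powr r = A powr (1 / p) * (k1 powr (1 / p) * k2)" by (simp add: K_def)
    then show ?thesis by (simp add: B_def powr_mult powr_add [symmetric] r_def mult.assoc)
  qed
  define u where "u x = A * pot g 1 x + 0 * 0" for x :: "real^'n"
  define v where "v x = B * pot d 1 x + 0 * 0" for x :: "real^'n"
  have g0: "0 < g" and d0: "0 < d" using g s d t by auto
  have "nonneg_viscosity_supersolution s t p q u v"
  proof (rule classical_imp_viscosity [OF s t])
    have "C2_closure UNIV (pot g 1 :: real^'n \<Rightarrow> real)" "C2_closure UNIV (pot d 1 :: real^'n \<Rightarrow> real)"
      using C2_closure_pot [of g 1 "0 :: real^'n"] C2_closure_pot [of d 1 "0 :: real^'n"] g0 d0 g d by auto
    then show "C2_closure UNIV u" "C2_closure UNIV v"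
      unfolding u_def [abs_def] v_def [abs_def]
      by (simp_all only: C2_closure_lincomb [OF _ C2_closure_const])
    show "u x \<ge> 0" "v x \<ge> 0" for x using A B by (auto simp: u_def v_def)
    show "has_frac_laplacian s u x (A * (c1 * pot (g - s) 1 x) + 0 * 0)" for x
      unfolding u_def by (intro has_frac_laplacian_lincomb 1 has_frac_laplacian_const)
    show "has_frac_laplacian t v x (B * (c2 * pot (d - t) 1 x) + 0 * 0)" for x
      unfolding v_def by (intro has_frac_laplacian_lincomb 2 has_frac_laplacian_const)
    fix x :: "real^'n"
    have "v x powr p = A * (k1 * pot d 1 x powr p)" by (simp add: v_def powr_mult Bp)
    also have "\<dots> \<le> A * (c1 * pot (g - s) 1 x)" using A 1 by (intro mult_left_mono) auto
    finally show "v x powr p \<le> A * (c1 * pot (g - s) 1 x) + 0 * 0" by simp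
    have "u x powr q = B * (k2 * pot g 1 x powr q)" by (simp add: u_def powr_mult Aq)
    also have "\<dots> \<le> B * (c2 * pot (d - t) 1 x)" using B 2 by (intro mult_left_mono) auto
    finally show "u x powr q \<le> B * (c2 * pot (d - t) 1 x) + 0 * 0" by simp
  qed
  moreover have "u 0 > 0"
  proof -
    obtain l where "l > 0" "l * (1 + (norm (0 :: real^'n))\<^sup>2) powr (g - real CARD('n) / 2) \<le> pot g 1 (0 :: real^'n)"
      using pot_ge [OF g0 g(2)] zero_less_one by blast
    then have "pot g 1 (0 :: real^'n) > 0" by simp
    then show ?thesis using A by (simp add: u_def)
  qed
  ultimately show ?thesis by blast
qed

text \<open>Triviality is phrased as an inner equivalence, so it also asserts that the zero pair is
  a super-solution; that direction is \<open>zero_supersolution\<close> and holds for all exponents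
  considered.\<close>

theorem theorem1p2:
  fixes s t p q :: real
  assumes "CARD('n::finite) \<ge> 2"
    and "0 < s" "s < 1" "0 < t" "t < 1"
    and "real CARD('n) > 2 * s" "real CARD('n) > 2 * t"
    and "p > 0" "q > 0" "p * q > 1"
  shows "(\<forall>u v :: real^'n \<Rightarrow> real.
            nonneg_viscosity_supersolution s t p q u v \<longleftrightarrow> u = (\<lambda>x. 0) \<and> v = (\<lambda>x. 0))
     \<longleftrightarrow>
         (2 * s / p + 2 * t) * (p / (p * q - 1)) \<ge> real CARD('n) - 2 * s \<or>
         (2 * t / q + 2 * s) * (q / (p * q - 1)) \<ge> real CARD('n) - 2 * t"
proof -
  have \<alpha>: "(2 * s / p + 2 * t) * (p / (p * q - 1)) = (2 * s + 2 * t * p) / (p * q - 1)"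
    and \<beta>: "(2 * t / q + 2 * s) * (q / (p * q - 1)) = (2 * t + 2 * s * q) / (p * q - 1)"
    using assms(8,9) by (simp_all add: distrib_right)
  have half: "s < real CARD('n) / 2" "t < real CARD('n) / 2" using assms(6,7) by auto
  show ?thesis (is "?triv \<longleftrightarrow> ?cond")
  proof
    assume triv: ?triv
    show ?cond
    proof (rule ccontr)
      assume "\<not> ?cond"
      then obtain u v :: "real^'n \<Rightarrow> real" where "nonneg_viscosity_supersolution s t p q u v" "u 0 > 0"
        using supersolution_exists [of s t p q, where ?'n = 'n] assms unfolding \<alpha> \<beta> by auto
      then show False using triv by auto
    qed
  next
    assume cond: ?cond
    show ?triv
    proof (intro allI iffI)
      fix u v :: "real^'n \<Rightarrow> real"
      assume "nonneg_viscosity_supersolution s t p q u v"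
      then have nonneg: "\<And>x. u x \<ge> 0" "\<And>x. v x \<ge> 0" and cont: "continuous_on UNIV u" "continuous_on UNIV v"
        and visc: "\<forall>x0. \<exists>U. open U \<and> x0 \<in> U \<and>
        (\<forall>\<phi>. touches_below U x0 \<phi> u \<longrightarrow> (\<exists>L. has_frac_laplacian s (glue U \<phi> u) x0 L \<and> L \<ge> v x0 powr p)) \<and>
        (\<forall>\<psi>. touches_below U x0 \<psi> v \<longrightarrow> (\<exists>L. has_frac_laplacian t (glue U \<psi> v) x0 L \<and> L \<ge> u x0 powr q))"
        unfolding nonneg_viscosity_supersolution_def viscosity_supersolution_def by auto
      have vu: "visc_super s (\<lambda>x. v x powr p) u" and vv: "visc_super t (\<lambda>x. u x powr q) v"
        using visc unfolding visc_super_def by meson+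
      from cond show "u = (\<lambda>x. 0) \<and> v = (\<lambda>x. 0)"
      proof
        assume "(2 * s / p + 2 * t) * (p / (p * q - 1)) \<ge> real CARD('n) - 2 * s"
        then show ?thesis
          using liouville [of s t p q u v] assms half nonneg cont vu vv unfolding \<alpha> by auto
      next
        assume "(2 * t / q + 2 * s) * (q / (p * q - 1)) \<ge> real CARD('n) - 2 * t"
        then show ?thesis
          \<comment> \<open>The second alternative is the first one after exchanging the two
            equations.\<close>
          using liouville [of t s q p v u] assms half nonneg cont vu vv unfolding \<beta> by (auto simp: mult.commute [of q p])
      qed
    next
      fix u v :: "real^'n \<Rightarrow> real"
      assume "u = (\<lambda>x. 0) \<and> v = (\<lambda>x. 0)"
      then show "nonneg_viscosity_supersolution s t p q u v"
        using zero_supersolution assms by blast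
    qed
  qed
qed

end
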